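(* Let $\Sigma=(X,\sigma)$ be a topological dynamical system, with $X$ a non-empty compact Hausdorff space and $\sigma$ a homeomorphism of $X$, and let $I$ be a closed ideal of $\ell^1(\Sigma)$. Then the following are equivalent: (1) $I$ is well behaved, i.e., $E(I)\subset I$; (2) $E(I)=I\cap C(X)$; (3) $I=E(I)((\delta))$; (4) $I=\mathcal K(\mathcal H(I))$; (5) for every closed ideal $I'$ of $\ell^1(\Sigma)$, one has $I'\subset I$ if and only if $\mathcal H(I')\supset\mathcal H(I)$; (6) $I$ is invariant under the dual action of $\mathbb T$ on $\ell^1(\Sigma)$; (7) there exist $S_{\mathrm{ap}}\subset\mathrm{Aper}(\sigma)$ and $S_{\mathrm p}\subset\mathrm{Per}(\sigma)$ such that $I=\bigcap_{x\in S_{\mathrm{ap}}}P_x\,\cap\,\bigcap_{x\in S_{\mathrm p}}Q_x$. In that case, if $S_{\mathrm{ap}}\subset\mathrm{Aper}(\sigma)$ and $S_{\mathrm p}\subset\mathrm{Per}(\sigma)$ are chosen such that $$h(E(I))=\overline{\bigcup_{x\in S_{\mathrm{ap}}}\mathbb Z\cdot x\,\cup\,\bigcup_{x\in S_{\mathrm p}}\mathbb Z\cdot x},$$ then $$I=\bigcap_{x\in S_{\mathrm{ap}}}P_x\,\cap\,\bigcap_{x\in S_{\mathrm p}}Q_x .$$ If, furthermore, $\mathbb T_x$ is a dense subset of $\mathbb T$ for each $x\in S_{\mathrm p}$, then $$I=\bigcap_{x\in S_{\mathrm{ap}}}P_x\,\cap\,\bigcap_{x\in S_{\mathrm p}}\bigcap_{\lambda\in\mathbb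 T_x}P_{x,\lambda},$$ which establishes $I$ as an intersection of primitive ideals corresponding to pure state extensions of evaluations in points of $S_{\mathrm{ap}}\cup S_{\mathrm p}$.
   Context: Algebra. $C(X)$ is the algebra of continuous complex functions on $X$ with supremum norm, and $\alpha(f)=f\circ\sigma^{-1}$ for $f\in C(X)$. $\ell^1(\Sigma)$ is the set of maps $a:\mathbb Z\to C(X)$ with $\|a\|=\sum_n\|a(n)\|<\infty$, with product $(aa')(n)=\sum_{k\in\mathbb Z}a(k)\,\alpha^k(a'(n-k))$ and involution $a^*(n)=\overline{\alpha^n(a(-n))}$; it is a unital Banach $*$-algebra with isometric involution. Let $\delta$ be the element with value $1$ at $1$ and $0$ elsewhere, and identify $C(X)$ with the elements supported at $0$. Each $a\in\ell^1(\Sigma)$ is uniquely a norm convergent sum $a=\sum_n a_n\delta^n$ with $a_n=a(n)\in C(X)$. Ideals are two-sided. An intersection over an empty index set is $\ell^1(\Sigma)$. $E:\ell^1(\Sigma)\to C(X)$ is $E(a)=a_0$. For a linear subspace $L\subset C(X)$, $L((\delta))=\{a=\sum_n a_n\delta^n\in\ell^1(\Sigma): a_n\in L\text{ for all }n\}$. For an ideal $J$ of $C(X)$, $h(J)=\{x\in X: f(x)=0\ \forall f\in J\}$. For an ideal $I$ of $\ell^1(\Sigma)$, $\mathcal H(I)=\{x\in X: a_n(x)=0\text{ for all }a=\sum_n a_n\delta^n\in I\text{ and all }n\in\mathbb Z\}$. For $S\subset X$, $\mathcal K(S)=\{a=\sum_n a_n\delta^n\in\ell^1(\Sigma): a_n|_S=0\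 \forall n\}$. The dual action of $\mathbb T$ is $\alpha_\lambda(\sum_n a_n\delta^n)=\sum_n\lambda^n a_n\delta^n$ $(\lambda\in\mathbb T)$. Points and representations. $\mathrm{Aper}(\sigma)$ and $\mathrm{Per}(\sigma)$ are the sets of aperiodic and periodic points of $\sigma$; $\mathbb Z\cdot x$ is the orbit of $x$. For $x\in\mathrm{Aper}(\sigma)$, $\pi_x$ is the involutive representation of $\ell^1(\Sigma)$ on a Hilbert space with orthonormal basis $(e_k)_{k\in\mathbb Z}$ given by $\pi_x(\delta)e_k=e_{k+1}$, $\pi_x(f)e_k=f(\sigma^kx)e_k$ $(f\in C(X))$. For $x$ of (minimal) period $p$ and $\lambda\in\mathbb T$, $\pi_{x,\lambda}$ is the involutive representation on a Hilbert space with orthonormal basis $e_0,\dots,e_{p-1}$ given by $\pi_{x,\lambda}(\delta)e_k=e_{k+1}$ for $0\le k<p-1$, $\pi_{x,\lambda}(\delta)e_{p-1}=\lambda e_0$, $\pi_{x,\lambda}(f)e_k=f(\sigma^kx)e_k$. Put $P_x=\ker\pi_x$ for $x\in\mathrm{Aper}(\sigma)$, and $P_{x,\lambda}=\ker\pi_{x,\lambda}$, $Q_x=\bigcap_{\lambda\in\mathbb T}P_{x,\lambda}$ for $x\in\mathrm{Per}(\sigma)$. A primitive ideal of $\ell^1(\Sigma)$ is the kernel of a topologically irreducible unital involutive representation on a Hilbert space. The representations $\pi_x$ and $\pi_{x,\lambda}$ are the (irreducible) GNS-representations of the pure state extensions to $\ell^1(\Sigma)$ of the evaluation $f\mapsto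 f(x)$ on $C(X)$, so $P_x$ and $P_{x,\lambda}$ are primitive ideals. *)

theory Defs
  imports "HOL-Analysis.Analysis"
begin

section \<open>The algebra \<open>\<ell>\<^sup>1(\<Sigma>)\<close>\<close>

text \<open>
  The space \<open>X\<close> is the universe of a type of class \<open>t2_space\<close>; since it will be assumed compact,
  \<open>C(X)\<close> with the supremum norm is the library type of bounded continuous functions.
  The library equips it with a real normed space structure only.
\<close>

definition cf_mult :: "('a::topological_space \<Rightarrow>\<^sub>C complex) \<Rightarrow> ('a \<Rightarrow>\<^sub>C complex) \<Rightarrow> ('a \<Rightarrow>\<^sub>C complex)" where
  "cf_mult f g = Bcontfun (\<lambda>x. apply_bcontfun f x * apply_bcontfun g x)"

definition cf_cnj :: "('a::topological_space \<Rightarrow>\<^sub>C complex) \<Rightarrow> ('a \<Rightarrow>\<^sub>C complex)" where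
  "cf_cnj f = Bcontfun (\<lambda>x. cnj (apply_bcontfun f x))"

definition cf_scale :: "complex \<Rightarrow> ('a::topological_space \<Rightarrow>\<^sub>C complex) \<Rightarrow> ('a \<Rightarrow>\<^sub>C complex)" where
  "cf_scale c f = Bcontfun (\<lambda>x. c * apply_bcontfun f x)"

lemma apply_cf_mult [simp]: "apply_bcontfun (cf_mult f g) x = apply_bcontfun f x * apply_bcontfun g x"
proof -
  have "(\<lambda>x. apply_bcontfun f x * apply_bcontfun g x) \<in> bcontfun"
    by (rule bcontfun_normI[where b = "norm f * norm g"])
      (auto intro!: continuous_intros mult_mono norm_bounded simp: norm_mult)
  then show ?thesis by (simp add: cf_mult_def Bcontfun_inverse)
qed

lemma apply_cf_cnj [simp]: "apply_bcontfun (cf_cnj f) x = cnj (apply_bcontfun f x)"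
proof -
  have "(\<lambda>x. cnj (apply_bcontfun f x)) \<in> bcontfun"
    by (rule bcontfun_normI[where b = "norm f"]) (auto intro!: continuous_intros norm_bounded)
  then show ?thesis by (simp add: cf_cnj_def Bcontfun_inverse)
qed

lemma apply_cf_scale [simp]: "apply_bcontfun (cf_scale c f) x = c * apply_bcontfun f x"
proof -
  have "(\<lambda>x. c * apply_bcontfun f x) \<in> bcontfun"
    by (rule bcontfun_normI[where b = "cmod c * norm f"])
      (auto intro!: continuous_intros mult_left_mono norm_bounded simp: norm_mult)
  then show ?thesis by (simp add: cf_scale_def Bcontfun_inverse)
qed

text \<open>Integer powers of a map that is a bijection of \<open>H\<close> onto itself.\<close>

definition zpow_on :: "'b set \<Rightarrow> ('b \<Rightarrow> 'b) \<Rightarrow> int \<Rightarrow> 'b \<Rightarrow> 'b" where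
  "zpow_on H f n = (if 0 \<le> n then f ^^ nat n else inv_into H f ^^ nat (- n))"

abbreviation zpow :: "('b \<Rightarrow> 'b) \<Rightarrow> int \<Rightarrow> 'b \<Rightarrow> 'b" where
  "zpow \<equiv> zpow_on UNIV"

definition alpha :: "('a::topological_space \<Rightarrow> 'a) \<Rightarrow> ('a \<Rightarrow>\<^sub>C complex) \<Rightarrow> ('a \<Rightarrow>\<^sub>C complex)" where
  "alpha \<sigma> f = Bcontfun (\<lambda>x. apply_bcontfun f (inv \<sigma> x))"

lemma apply_alpha:
  assumes "continuous_on UNIV (inv \<sigma>)"
  shows "apply_bcontfun (alpha \<sigma> f) x = apply_bcontfun f (inv \<sigma> x)"
proof -
  have "(\<lambda>x. apply_bcontfun f (inv \<sigma> x)) \<in> bcontfun"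
    by (rule bcontfun_normI[where b = "norm f"])
      (auto intro!: norm_bounded continuous_on_compose2[OF continuous_on_apply_bcontfun assms])
  then show ?thesis by (simp add: alpha_def Bcontfun_inverse)
qed

type_synonym 'a cseq = "int \<Rightarrow> ('a \<Rightarrow>\<^sub>C complex)"

definition ell1 :: "'a::topological_space cseq set" where
  "ell1 = {a. (\<lambda>n. norm (a n)) summable_on UNIV}"

definition ell1_norm :: "'a::topological_space cseq \<Rightarrow> real" where
  "ell1_norm a = (\<Sum>\<^sub>\<infinity>n. norm (a n))"

definition ell1_topology :: "'a::topological_space cseq topology" where
  "ell1_topology = Metric_space.mtopology ell1 (\<lambda>a b. ell1_norm (\<lambda>n. a n - b n))"

lemma Metric_space_ell1:
  "Metric_space ell1 (\<lambda>a b :: 'a::topological_space cseq. ell1_norm (\<lambda>n. a n - b n))"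
proof
  fix a b c :: "'a cseq"
  show "0 \<le> ell1_norm (\<lambda>n. a n - b n)" by (simp add: ell1_norm_def infsum_nonneg)
  show "ell1_norm (\<lambda>n. a n - b n) = ell1_norm (\<lambda>n. b n - a n)"
    by (simp add: ell1_norm_def norm_minus_commute)
  have diff: "(\<lambda>n. norm (u n - v n)) summable_on UNIV" if "u \<in> ell1" "v \<in> ell1" for u v :: "'a cseq"
  proof -
    have "(\<lambda>n. norm (u n) + norm (v n)) summable_on UNIV"
      using that by (intro summable_on_add) (auto simp: ell1_def)
    then show ?thesis
      by (rule summable_on_comparison_test) (auto intro: norm_triangle_ineq4)
  qed
  assume a: "a \<in> ell1" and b: "b \<in> ell1"
  show "(ell1_norm (\<lambda>n. a n - b n) = 0) = (a = b)"
  proof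
    assume "ell1_norm (\<lambda>n. a n - b n) = 0"
    then have "norm (a n - b n) = 0" for n
      using nonneg_infsum_le_0D[OF _ diff[OF a b], of n]
      by (auto simp: ell1_norm_def)
    then show "a = b" by (auto simp: fun_eq_iff)
  qed (simp add: ell1_norm_def)
  assume c: "c \<in> ell1"
  have "(\<Sum>\<^sub>\<infinity>n. norm (a n - c n)) \<le> (\<Sum>\<^sub>\<infinity>n. norm (a n - b n) + norm (b n - c n))"
    by (intro infsum_mono summable_on_add diff a b c)
      (metis diff_add_cancel add_diff_eq norm_triangle_ineq)
  also have "\<dots> = (\<Sum>\<^sub>\<infinity>n. norm (a n - b n)) + (\<Sum>\<^sub>\<infinity>n. norm (b n - c n))"
    by (intro infsum_add diff a b c)
  finally show "ell1_norm (\<lambda>n. a n - c n) \<le> ell1_norm (\<lambda>n. a n - b n) + ell1_norm (\<lambda>n. b n - c n)"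
    by (simp add: ell1_norm_def)
qed

definition ell1_mult :: "('a::topological_space \<Rightarrow> 'a) \<Rightarrow> 'a cseq \<Rightarrow> 'a cseq \<Rightarrow> 'a cseq" where
  "ell1_mult \<sigma> a b = (\<lambda>n. \<Sum>\<^sub>\<infinity>k. cf_mult (a k) (zpow (alpha \<sigma>) k (b (n - k))))"

definition ell1_star :: "('a::topological_space \<Rightarrow> 'a) \<Rightarrow> 'a cseq \<Rightarrow> 'a cseq" where
  "ell1_star \<sigma> a = (\<lambda>n. cf_cnj (zpow (alpha \<sigma>) n (a (- n))))"

definition embed :: "('a::topological_space \<Rightarrow>\<^sub>C complex) \<Rightarrow> 'a cseq" where
  "embed f = (\<lambda>n. if n = 0 then f else 0)"

definition ell1_one :: "'a::topological_space cseq" where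
  "ell1_one = embed (const_bcontfun 1)"

definition ideal :: "('a::topological_space \<Rightarrow> 'a) \<Rightarrow> 'a cseq set \<Rightarrow> bool" where
  "ideal \<sigma> I \<longleftrightarrow>
     I \<subseteq> ell1 \<and> (\<lambda>n. 0) \<in> I \<and>
     (\<forall>a\<in>I. \<forall>b\<in>I. (\<lambda>n. a n + b n) \<in> I) \<and>
     (\<forall>c. \<forall>a\<in>I. (\<lambda>n. cf_scale c (a n)) \<in> I) \<and>
     (\<forall>a\<in>I. \<forall>b\<in>ell1. ell1_mult \<sigma> b a \<in> I \<and> ell1_mult \<sigma> a b \<in> I)"

definition closed_ideal :: "('a::topological_space \<Rightarrow> 'a) \<Rightarrow> 'a cseq set \<Rightarrow> bool" where
  "closed_ideal \<sigma> I \<longleftrightarrow> ideal \<sigma> I \<and> closedin ell1_topology I"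

definition E :: "'a::topological_space cseq \<Rightarrow> ('a \<Rightarrow>\<^sub>C complex)" where
  "E a = a 0"

definition well_behaved :: "'a::topological_space cseq set \<Rightarrow> bool" where
  "well_behaved I \<longleftrightarrow> embed ` (E ` I) \<subseteq> I"

definition delta_span :: "('a::topological_space \<Rightarrow>\<^sub>C complex) set \<Rightarrow> 'a cseq set" where
  "delta_span L = {a \<in> ell1. \<forall>n. a n \<in> L}"

definition zero_set :: "('a::topological_space \<Rightarrow>\<^sub>C complex) set \<Rightarrow> 'a set" where
  "zero_set J = {x. \<forall>f\<in>J. apply_bcontfun f x = 0}"

definition ell1_hull :: "'a::topological_space cseq set \<Rightarrow> 'a set" where
  "ell1_hull I = {x. \<forall>a\<in>I. \<forall>n. apply_bcontfun (a n) x = 0}"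

definition ell1_kernel :: "'a::topological_space set \<Rightarrow> 'a cseq set" where
  "ell1_kernel S = {a \<in> ell1. \<forall>n. \<forall>x\<in>S. apply_bcontfun (a n) x = 0}"

abbreviation circle :: "complex set" where
  "circle \<equiv> sphere 0 1"

definition dual_action :: "complex \<Rightarrow> 'a::topological_space cseq \<Rightarrow> 'a cseq" where
  "dual_action l a = (\<lambda>n. cf_scale (l powi n) (a n))"


section \<open>Orbits\<close>

definition Per :: "('a \<Rightarrow> 'a) \<Rightarrow> 'a set" where
  "Per \<sigma> = {x. \<exists>p>0. (\<sigma> ^^ p) x = x}"

definition Aper :: "('a \<Rightarrow> 'a) \<Rightarrow> 'a set" where
  "Aper \<sigma> = - Per \<sigma>"

definition period :: "('a \<Rightarrow> 'a) \<Rightarrow> 'a \<Rightarrow> nat" where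
  "period \<sigma> x = (LEAST p. p > 0 \<and> (\<sigma> ^^ p) x = x)"

definition orbit :: "('a \<Rightarrow> 'a) \<Rightarrow> 'a \<Rightarrow> 'a set" where
  "orbit \<sigma> x = range (\<lambda>n. zpow \<sigma> n x)"


section \<open>Involutive representations on Hilbert spaces\<close>

text \<open>
  The Hilbert space \<open>\<ell>\<^sup>2(B)\<close> with its canonical orthonormal basis indexed by \<open>B\<close>; up to unitary
  equivalence every Hilbert space has this form.
\<close>

definition ell2 :: "'b set \<Rightarrow> ('b \<Rightarrow> complex) set" where
  "ell2 B = {\<xi>. (\<forall>k. k \<notin> B \<longrightarrow> \<xi> k = 0) \<and> (\<lambda>k. (cmod (\<xi> k))\<^sup>2) summable_on B}"

definition ell2_inner :: "'b set \<Rightarrow> ('b \<Rightarrow> complex) \<Rightarrow> ('b \<Rightarrow> complex) \<Rightarrow> complex" where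
  "ell2_inner B \<xi> \<eta> = (\<Sum>\<^sub>\<infinity>k\<in>B. \<xi> k * cnj (\<eta> k))"

definition ell2_norm :: "'b set \<Rightarrow> ('b \<Rightarrow> complex) \<Rightarrow> real" where
  "ell2_norm B \<xi> = sqrt (\<Sum>\<^sub>\<infinity>k\<in>B. (cmod (\<xi> k))\<^sup>2)"

definition ell2_topology :: "'b set \<Rightarrow> ('b \<Rightarrow> complex) topology" where
  "ell2_topology B = Metric_space.mtopology (ell2 B) (\<lambda>\<xi> \<eta>. ell2_norm B (\<lambda>k. \<xi> k - \<eta> k))"

lemma Metric_space_ell2:
  "Metric_space (ell2 (B :: 'b set)) (\<lambda>\<xi> \<eta>. ell2_norm B (\<lambda>k. \<xi> k - \<eta> k))"
proof
  fix a b c :: "'b \<Rightarrow> complex"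
  show "0 \<le> ell2_norm B (\<lambda>n. a n - b n)" by (simp add: ell2_norm_def infsum_nonneg)
  show "ell2_norm B (\<lambda>n. a n - b n) = ell2_norm B (\<lambda>n. b n - a n)"
    by (simp add: ell2_norm_def norm_minus_commute)
  have diff: "(\<lambda>n. (cmod (u n - v n))\<^sup>2) summable_on B" if "u \<in> ell2 B" "v \<in> ell2 B" for u v
  proof -
    have "(\<lambda>n. 2 * ((cmod (u n))\<^sup>2 + (cmod (v n))\<^sup>2)) summable_on B"
      using that by (intro summable_on_cmult_right summable_on_add) (auto simp: ell2_def)
    moreover have "(cmod (u n - v n))\<^sup>2 \<le> 2 * ((cmod (u n))\<^sup>2 + (cmod (v n))\<^sup>2)" for n
    proof -
      have "(cmod (u n - v n))\<^sup>2 \<le> (cmod (u n) + cmod (v n))\<^sup>2"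
        by (intro power_mono norm_triangle_ineq4) auto
      also have "\<dots> \<le> 2 * ((cmod (u n))\<^sup>2 + (cmod (v n))\<^sup>2)"
        using sum_squares_bound[of "cmod (u n)" "cmod (v n)"] by (simp add: power2_sum)
      finally show ?thesis .
    qed
    ultimately show ?thesis
      by (rule summable_on_comparison_test) auto
  qed
  assume a: "a \<in> ell2 B" and b: "b \<in> ell2 B"
  show "(ell2_norm B (\<lambda>n. a n - b n) = 0) = (a = b)"
  proof
    assume "ell2_norm B (\<lambda>n. a n - b n) = 0"
    then have "(cmod (a n - b n))\<^sup>2 = 0" if "n \<in> B" for n
      using nonneg_infsum_le_0D[OF _ diff[OF a b] _ that] by (auto simp: ell2_norm_def)
    then have "a n = b n" for n
      using a b by (cases "n \<in> B") (auto simp: ell2_def)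
    then show "a = b" by (auto simp: fun_eq_iff)
  qed (simp add: ell2_norm_def)
  assume c: "c \<in> ell2 B"
  let ?n = "\<lambda>u v. ell2_norm B (\<lambda>k. u k - v k)"
  have fin: "L2_set (\<lambda>k. cmod (u k - v k)) F \<le> ?n u v"
    if "u \<in> ell2 B" "v \<in> ell2 B" "finite F" "F \<subseteq> B" for u v F
    unfolding L2_set_def ell2_norm_def
    by (intro real_sqrt_le_mono finite_sum_le_infsum diff that) auto
  have pos: "0 \<le> ?n u v" for u v :: "'b \<Rightarrow> complex" by (simp add: ell2_norm_def infsum_nonneg)
  have "(\<Sum>\<^sub>\<infinity>k\<in>B. (cmod (a k - c k))\<^sup>2) \<le> (?n a b + ?n b c)\<^sup>2"
  proof (rule infsum_le_finite_sums[OF diff[OF a c]])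
    fix F assume F: "finite F" "F \<subseteq> B"
    have "L2_set (\<lambda>k. cmod (a k - c k)) F \<le> L2_set (\<lambda>k. cmod (a k - b k) + cmod (b k - c k)) F"
      by (intro L2_set_mono) (auto intro: order_trans[OF _ norm_triangle_ineq])
    also have "\<dots> \<le> L2_set (\<lambda>k. cmod (a k - b k)) F + L2_set (\<lambda>k. cmod (b k - c k)) F"
      by (rule L2_set_triangle_ineq)
    also have "\<dots> \<le> ?n a b + ?n b c"
      by (intro add_mono fin a b c F)
    finally show "(\<Sum>k\<in>F. (cmod (a k - c k))\<^sup>2) \<le> (?n a b + ?n b c)\<^sup>2"
      unfolding L2_set_def using sqrt_le_D by blast
  qed
  then have "?n a c \<le> sqrt ((?n a b + ?n b c)\<^sup>2)"
    unfolding ell2_norm_def[of B "\<lambda>k. a k - c k"] by (rule real_sqrt_le_mono)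
  then show "?n a c \<le> ?n a b + ?n b c"
    using pos[of a b] pos[of b c] by simp
qed

definition basis_vec :: "'b \<Rightarrow> 'b \<Rightarrow> complex" where
  "basis_vec j = (\<lambda>k. if k = j then 1 else 0)"

definition ell2_operator :: "'b set \<Rightarrow> (('b \<Rightarrow> complex) \<Rightarrow> ('b \<Rightarrow> complex)) \<Rightarrow> bool" where
  "ell2_operator B T \<longleftrightarrow>
     (\<forall>\<xi>\<in>ell2 B. T \<xi> \<in> ell2 B) \<and>
     (\<forall>\<xi>\<in>ell2 B. \<forall>\<eta>\<in>ell2 B. T (\<lambda>k. \<xi> k + \<eta> k) = (\<lambda>k. T \<xi> k + T \<eta> k)) \<and>
     (\<forall>c. \<forall>\<xi>\<in>ell2 B. T (\<lambda>k. c * \<xi> k) = (\<lambda>k. c * T \<xi> k)) \<and>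
     (\<exists>C. \<forall>\<xi>\<in>ell2 B. ell2_norm B (T \<xi>) \<le> C * ell2_norm B \<xi>)"

definition unital_involutive_rep ::
  "('a::topological_space \<Rightarrow> 'a) \<Rightarrow> 'b set \<Rightarrow> ('a cseq \<Rightarrow> ('b \<Rightarrow> complex) \<Rightarrow> ('b \<Rightarrow> complex)) \<Rightarrow> bool" where
  "unital_involutive_rep \<sigma> B \<pi> \<longleftrightarrow>
     (\<forall>a\<in>ell1. ell2_operator B (\<pi> a)) \<and>
     (\<forall>a\<in>ell1. \<forall>b\<in>ell1. \<forall>\<xi>\<in>ell2 B. \<pi> (\<lambda>n. a n + b n) \<xi> = (\<lambda>k. \<pi> a \<xi> k + \<pi> b \<xi> k)) \<and>
     (\<forall>c. \<forall>a\<in>ell1. \<forall>\<xi>\<in>ell2 B. \<pi> (\<lambda>n. cf_scale c (a n)) \<xi> = (\<lambda>k. c * \<pi> a \<xi> k)) \<and>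
     (\<forall>a\<in>ell1. \<forall>b\<in>ell1. \<forall>\<xi>\<in>ell2 B. \<pi> (ell1_mult \<sigma> a b) \<xi> = \<pi> a (\<pi> b \<xi>)) \<and>
     (\<forall>a\<in>ell1. \<forall>\<xi>\<in>ell2 B. \<forall>\<eta>\<in>ell2 B.
        ell2_inner B (\<pi> (ell1_star \<sigma> a) \<xi>) \<eta> = ell2_inner B \<xi> (\<pi> a \<eta>)) \<and>
     (\<forall>\<xi>\<in>ell2 B. \<pi> ell1_one \<xi> = \<xi>)"

definition rep_kernel ::
  "'b set \<Rightarrow> ('a::topological_space cseq \<Rightarrow> ('b \<Rightarrow> complex) \<Rightarrow> ('b \<Rightarrow> complex)) \<Rightarrow> 'a cseq set" where
  "rep_kernel B \<pi> = {a \<in> ell1. \<forall>\<xi>\<in>ell2 B. \<pi> a \<xi> = (\<lambda>k. 0)}"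

definition closed_subspace :: "'b set \<Rightarrow> ('b \<Rightarrow> complex) set \<Rightarrow> bool" where
  "closed_subspace B K \<longleftrightarrow>
     (\<lambda>k. 0) \<in> K \<and>
     (\<forall>\<xi>\<in>K. \<forall>\<eta>\<in>K. (\<lambda>k. \<xi> k + \<eta> k) \<in> K) \<and>
     (\<forall>c. \<forall>\<xi>\<in>K. (\<lambda>k. c * \<xi> k) \<in> K) \<and>
     closedin (ell2_topology B) K"

definition top_irreducible ::
  "'b set \<Rightarrow> ('a::topological_space cseq \<Rightarrow> ('b \<Rightarrow> complex) \<Rightarrow> ('b \<Rightarrow> complex)) \<Rightarrow> bool" where
  "top_irreducible B \<pi> \<longleftrightarrow>
     B \<noteq> {} \<and>
     (\<forall>K. closed_subspace B K \<and> (\<forall>a\<in>ell1. \<forall>\<xi>\<in>K. \<pi> a \<xi> \<in> K) \<longrightarrow> K = {\<lambda>k. 0} \<or> K = ell2 B)"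

text \<open>
  Index sets \<open>B\<close> inside the type of \<open>\<ell>\<^sup>1(\<Sigma>)\<close> itself suffice for all Hilbert spaces that can occur:
  an irreducible representation is cyclic, so its Hilbert dimension is at most the cardinality
  of \<open>\<ell>\<^sup>1(\<Sigma>)\<close>.
\<close>

definition primitive_ideal :: "('a::topological_space \<Rightarrow> 'a) \<Rightarrow> 'a cseq set \<Rightarrow> bool" where
  "primitive_ideal \<sigma> P \<longleftrightarrow>
     (\<exists>(B :: 'a cseq set) \<pi>. unital_involutive_rep \<sigma> B \<pi> \<and> top_irreducible B \<pi> \<and> P = rep_kernel B \<pi>)"


section \<open>The representations attached to points\<close>

text \<open>
  The representation \<open>a \<mapsto> \<Sum>\<^sub>n \<pi>(a\<^sub>n) \<pi>(\<delta>)\<^sup>n\<close> determined by its values \<open>D = \<pi>\<close> on \<open>C(X)\<close> and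
  \<open>U = \<pi>(\<delta>)\<close>. The series applied to a vector \<open>\<xi>\<close> converges absolutely in \<open>\<ell>\<^sup>2(B)\<close>, hence its sum
  can be computed coordinatewise.
\<close>

definition integrated_rep ::
  "'b set \<Rightarrow> (('a::topological_space \<Rightarrow>\<^sub>C complex) \<Rightarrow> ('b \<Rightarrow> complex) \<Rightarrow> ('b \<Rightarrow> complex))
     \<Rightarrow> (('b \<Rightarrow> complex) \<Rightarrow> ('b \<Rightarrow> complex)) \<Rightarrow> 'a cseq \<Rightarrow> ('b \<Rightarrow> complex) \<Rightarrow> ('b \<Rightarrow> complex)" where
  "integrated_rep B D U a \<xi> = (\<lambda>k. \<Sum>\<^sub>\<infinity>n. D (a n) (zpow_on (ell2 B) U n \<xi>) k)"

definition diag_op ::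
  "('a::topological_space \<Rightarrow> 'a) \<Rightarrow> 'a \<Rightarrow> ('a \<Rightarrow>\<^sub>C complex) \<Rightarrow> (int \<Rightarrow> complex) \<Rightarrow> (int \<Rightarrow> complex)" where
  "diag_op \<sigma> x f \<xi> = (\<lambda>k. apply_bcontfun f (zpow \<sigma> k x) * \<xi> k)"

definition shift :: "(int \<Rightarrow> complex) \<Rightarrow> (int \<Rightarrow> complex)" where
  "shift \<xi> = (\<lambda>k. \<xi> (k - 1))"

definition cyclic_shift :: "nat \<Rightarrow> complex \<Rightarrow> (int \<Rightarrow> complex) \<Rightarrow> (int \<Rightarrow> complex)" where
  "cyclic_shift p l \<xi> =
     (\<lambda>k. if k = 0 then l * \<xi> (int p - 1) else if 0 < k \<and> k < int p then \<xi> (k - 1) else 0)"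

definition pi_aper ::
  "('a::topological_space \<Rightarrow> 'a) \<Rightarrow> 'a \<Rightarrow> 'a cseq \<Rightarrow> (int \<Rightarrow> complex) \<Rightarrow> (int \<Rightarrow> complex)" where
  "pi_aper \<sigma> x = integrated_rep UNIV (diag_op \<sigma> x) shift"

definition per_index :: "('a \<Rightarrow> 'a) \<Rightarrow> 'a \<Rightarrow> int set" where
  "per_index \<sigma> x = {0..<int (period \<sigma> x)}"

definition pi_per ::
  "('a::topological_space \<Rightarrow> 'a) \<Rightarrow> 'a \<Rightarrow> complex \<Rightarrow> 'a cseq \<Rightarrow> (int \<Rightarrow> complex) \<Rightarrow> (int \<Rightarrow> complex)" where
  "pi_per \<sigma> x l = integrated_rep (per_index \<sigma> x) (diag_op \<sigma> x) (cyclic_shift (period \<sigma> x) l)"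

definition P_aper :: "('a::topological_space \<Rightarrow> 'a) \<Rightarrow> 'a \<Rightarrow> 'a cseq set" where
  "P_aper \<sigma> x = rep_kernel UNIV (pi_aper \<sigma> x)"

definition P_per :: "('a::topological_space \<Rightarrow> 'a) \<Rightarrow> 'a \<Rightarrow> complex \<Rightarrow> 'a cseq set" where
  "P_per \<sigma> x l = rep_kernel (per_index \<sigma> x) (pi_per \<sigma> x l)"

definition Q_per :: "('a::topological_space \<Rightarrow> 'a) \<Rightarrow> 'a \<Rightarrow> 'a cseq set" where
  "Q_per \<sigma> x = (\<Inter>l\<in>circle. P_per \<sigma> x l)"


section \<open>Pure states and GNS representations\<close>

text \<open>Functionals are considered on \<open>\<ell>\<^sup>1(\<Sigma>)\<close> only; their values elsewhere are irrelevant.\<close>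

definition state :: "('a::topological_space \<Rightarrow> 'a) \<Rightarrow> ('a cseq \<Rightarrow> complex) \<Rightarrow> bool" where
  "state \<sigma> \<phi> \<longleftrightarrow>
     (\<forall>a\<in>ell1. \<forall>b\<in>ell1. \<phi> (\<lambda>n. a n + b n) = \<phi> a + \<phi> b) \<and>
     (\<forall>c. \<forall>a\<in>ell1. \<phi> (\<lambda>n. cf_scale c (a n)) = c * \<phi> a) \<and>
     (\<forall>a\<in>ell1. cmod (\<phi> a) \<le> ell1_norm a) \<and>
     (\<forall>a\<in>ell1. \<phi> (ell1_mult \<sigma> (ell1_star \<sigma> a) a) \<in> \<real>\<^sub>\<ge>\<^sub>0) \<and>
     \<phi> ell1_one = 1"

definition pure_state :: "('a::topological_space \<Rightarrow> 'a) \<Rightarrow> ('a cseq \<Rightarrow> complex) \<Rightarrow> bool" where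
  "pure_state \<sigma> \<phi> \<longleftrightarrow>
     state \<sigma> \<phi> \<and>
     (\<forall>\<psi>\<^sub>1 \<psi>\<^sub>2 t. state \<sigma> \<psi>\<^sub>1 \<and> state \<sigma> \<psi>\<^sub>2 \<and> 0 < t \<and> t < 1 \<and>
        (\<forall>a\<in>ell1. \<phi> a = complex_of_real t * \<psi>\<^sub>1 a + complex_of_real (1 - t) * \<psi>\<^sub>2 a) \<longrightarrow>
        (\<forall>a\<in>ell1. \<psi>\<^sub>1 a = \<phi> a \<and> \<psi>\<^sub>2 a = \<phi> a))"

definition extends_evaluation :: "('a::topological_space cseq \<Rightarrow> complex) \<Rightarrow> 'a \<Rightarrow> bool" where
  "extends_evaluation \<phi> x \<longleftrightarrow> (\<forall>f. \<phi> (embed f) = apply_bcontfun f x)"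

definition GNS_rep ::
  "('a::topological_space \<Rightarrow> 'a) \<Rightarrow> ('a cseq \<Rightarrow> complex)
     \<Rightarrow> 'b set \<Rightarrow> ('a cseq \<Rightarrow> ('b \<Rightarrow> complex) \<Rightarrow> ('b \<Rightarrow> complex)) \<Rightarrow> ('b \<Rightarrow> complex) \<Rightarrow> bool" where
  "GNS_rep \<sigma> \<phi> B \<pi> \<xi> \<longleftrightarrow>
     unital_involutive_rep \<sigma> B \<pi> \<and> \<xi> \<in> ell2 B \<and>
     ell2_topology B closure_of {\<pi> a \<xi> | a. a \<in> ell1} = ell2 B \<and>
     (\<forall>a\<in>ell1. \<phi> a = ell2_inner B (\<pi> a \<xi>) \<xi>)"

end

theory Submission
  imports Defs
begin

text \<open>
  A well behaved closed ideal contains its Fourier coefficients, so it is determined by a closed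
  ideal of \<open>C(X)\<close>, and such an ideal consists of all functions vanishing on its hull; this gives
  \<open>I = \<K>(\<H>(I))\<close>. Invariance under the dual action implies \<open>E(I) \<subseteq> I\<close> because \<open>E(a)\<close> is the norm limit
  of the averages of \<open>a\<close> under the dual action over the \<open>N\<close>-th roots of unity. The same
  averaging shows that the Fourier coefficients of an absolutely convergent series on the circle
  are determined by its values on a dense subset; hence \<open>P\<^sub>x\<close>, \<open>Q\<^sub>x\<close> and the intersection of the
  \<open>P\<^sub>x\<^sub>,\<^sub>\<lambda>\<close> over a dense set of \<open>\<lambda>\<close> all equal \<open>\<K>(\<int> \<cdot> x)\<close>.
  For purity, a convex component \<open>\<psi>\<close> of the vector state at \<open>x\<close> satisfies
  \<open>\<psi>(f\<delta>\<^sup>n) = f(x) \<psi>(\<delta>\<^sup>n)\<close>; here \<open>\<psi>(\<delta>\<^sup>n) = 0\<close> when \<open>\<sigma>\<^sup>n x \<noteq> x\<close>, by separating the two points, and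
  otherwise \<open>\<psi>(\<delta>\<^sup>n)\<close> is forced because the state has modulus one there.
\<close>

section \<open>Convolution\<close>

text \<open>An ideal is only known to contain finite combinations of its elements, so every limit
  argument first fixes a finite set of degrees carrying all but a small part of a norm, before the
  approximant is known. This is why averages over roots of unity stand in for integrals over the
  circle: they are finite sums, and for large \<open>N\<close> the unwanted degrees that survive all
  lie in the tail.

  Periodic and aperiodic points would call for two parallel developments. They are merged by viewing
  both kinds of representation as weighted permutations of an orthonormal basis; the weight is
  trivial at aperiodic points and a power of \<lambda> counting passages through the end of the
  cycle at periodic ones. Matrix entries then explain the kernels. At an aperiodic point an entry is
  one value of one coefficient. At a periodic point it is a Fourier series in \<lambda>, with the
  values of all coefficients in one residue class of degrees; one \<lambda> does not separate them,
  a dense set does.\<close>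

lemma zpow_on_eqI:
  assumes inj: "inj_on f H" and H: "\<And>n. g n \<in> H" and g0: "g 0 = x" and S: "\<And>n. g (n + 1) = f (g n)"
  shows "zpow_on H f n x = g n"
proof (cases "0 \<le> n")
  case True
  have "(f ^^ m) x = g (int m)" for m
    by (induction m) (simp_all add: g0 S add.commute[of 1])
  with True show ?thesis by (simp add: zpow_on_def)
next
  case False
  \<comment> \<open>\<open>inv_into H f\<close> undoes \<open>f\<close> only at values
    \<open>f z\<close> with \<open>z \<in> H\<close>, so the whole two-sided orbit \<open>g\<close>
    has to stay in \<open>H\<close>.\<close>
  have "(inv_into H f ^^ m) x = g (- int m)" for m
  proof (induction m)
    case (Suc m)
    have "g (- int m) = f (g (- int (Suc m)))"
      using S[of "- int (Suc m)"] by simp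
    then show ?case
      using Suc inj H by (simp add: inv_into_f_f)
  qed (simp add: g0)
  with False show ?thesis by (simp add: zpow_on_def)
qed

lemma zpow_0 [simp]: "zpow_on H f 0 x = x"
  by (simp add: zpow_on_def)

lemma zpow_of_nat: "zpow_on H f (int n) = f ^^ n"
  by (simp add: zpow_on_def)

lemma zpow_plus_1:
  assumes "bij f"
  shows "zpow f (n + 1) x = f (zpow f n x)"
proof (cases "0 \<le> n")
  case True
  then show ?thesis by (simp add: zpow_on_def nat_add_distrib)
next
  case False
  then have "nat (- n) = Suc (nat (- (n + 1)))" by simp
  moreover have "f (inv f z) = z" for z
    using assms by (simp add: bij_is_surj surj_f_inv_f)
  ultimately show ?thesis
    using False by (cases "n = -1") (auto simp: zpow_on_def)
qed

lemma zpow_add: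
  assumes "bij f"
  shows "zpow f (m + n) x = zpow f m (zpow f n x)"
proof (rule zpow_on_eqI[symmetric])
  show "zpow f (k + 1 + n) x = f (zpow f (k + n) x)" for k
    using zpow_plus_1[OF assms, of "k + n" x] by (simp add: algebra_simps)
qed (use assms in \<open>auto simp: bij_is_inj\<close>)

section \<open>Tails and uniform convergence of summable families\<close>

text \<open>The set \<open>F\<close> is chosen before \<open>g\<close>, so it serves every family
  dominated by \<open>f\<close> that vanishes on \<open>F\<close>. It may therefore be used to
  construct the very approximant whose error is then estimated.\<close>

lemma summable_tail:
  fixes f :: "'i \<Rightarrow> real"
  assumes f: "f summable_on A" and pos: "\<And>n. n \<in> A \<Longrightarrow> 0 \<le> f n" and e: "0 < e"
  obtains F where "finite F" "F \<subseteq> A"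
    "\<And>g. (\<And>n. n \<in> A \<Longrightarrow> 0 \<le> g n \<and> g n \<le> f n) \<Longrightarrow> (\<And>n. n \<in> F \<Longrightarrow> g n = 0) \<Longrightarrow> infsum g A < e"
proof -
  obtain F where F: "finite F" "F \<subseteq> A" "dist (sum f F) (infsum f A) \<le> e / 2"
    using infsum_finite_approximation[OF f, of "e / 2"] e by auto
  have "infsum g A < e"
    if g: "\<And>n. n \<in> A \<Longrightarrow> 0 \<le> g n \<and> g n \<le> f n" and gF: "\<And>n. n \<in> F \<Longrightarrow> g n = 0" for g
  proof -
    have fd: "f summable_on (A - F)"
      using f by (rule summable_on_subset_banach) auto
    have "g summable_on A"
      by (rule summable_on_comparison_test[OF f]) (use g in auto)
    then have gs: "g summable_on (A - F)"
      by (rule summable_on_subset_banach) auto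
    have "infsum f A = infsum f (F \<union> (A - F))"
      using F(2) by (simp add: Un_absorb1)
    also have "\<dots> = sum f F + infsum f (A - F)"
      using F(1) fd by (subst infsum_Un_disjoint) auto
    finally have "infsum f (A - F) \<le> e / 2"
      using F(3) by (simp add: dist_real_def)
    moreover have "infsum g A = infsum g (A - F)"
      by (rule infsum_cong_neutral) (use gF in auto)
    moreover have "infsum g (A - F) \<le> infsum f (A - F)"
      by (rule infsum_mono[OF gs fd]) (use g in auto)
    ultimately show ?thesis using e by simp
  qed
  with F that show thesis by blast
qed

lemma has_sum_shift:
  fixes f :: "int \<Rightarrow> 'b::{topological_comm_monoid_add,t2_space}"
  assumes "(f has_sum s) UNIV"
  shows "((\<lambda>n. f (n - k)) has_sum s) UNIV"
proof -
  have "((\<lambda>n. f (n - k)) has_sum s) UNIV = (f has_sum s) UNIV"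
    by (rule has_sum_reindex_bij_witness[of _ "\<lambda>n. n + k" "\<lambda>n. n - k"]) auto
  with assms show ?thesis by simp
qed

lemma infsum_single:
  assumes "\<And>k. k \<in> A \<Longrightarrow> k \<noteq> j \<Longrightarrow> f k = 0" and "j \<in> A"
  shows "infsum f A = f j"
proof -
  have "infsum f A = infsum f {j}"
    by (rule infsum_cong_neutral) (use assms in auto)
  then show ?thesis by simp
qed

lemma apply_bcontfun_sum: "apply_bcontfun (sum f F) x = (\<Sum>i\<in>F. apply_bcontfun (f i) x)"
  by (induction F rule: infinite_finite_induct) auto

text \<open>The Weierstrass test turns summable norms into uniform convergence, so the pointwise sum
  is again continuous and bounded. The second claim reduces identities in the algebra to identities
  of scalar series.\<close>

lemma bcontfun_has_sum:
  fixes f :: "'i \<Rightarrow> 'a::topological_space \<Rightarrow>\<^sub>C complex"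
  assumes "(\<lambda>i. norm (f i)) summable_on A"
  shows "f summable_on A"
    and "apply_bcontfun (infsum f A) x = (\<Sum>\<^sub>\<infinity>i\<in>A. apply_bcontfun (f i) x)"
    and "norm (infsum f A) \<le> (\<Sum>\<^sub>\<infinity>i\<in>A. norm (f i))"
proof -
  have "uniform_limit UNIV (\<lambda>X x. \<Sum>i\<in>X. apply_bcontfun (f i) x)
     (\<lambda>x. \<Sum>\<^sub>\<infinity>i\<in>A. apply_bcontfun (f i) x) (finite_subsets_at_top A)"
    by (rule Weierstrass_m_test_general[OF _ assms]) (auto intro: norm_bounded)
  then have u: "uniform_limit UNIV (\<lambda>X. apply_bcontfun (sum f X))
     (\<lambda>x. \<Sum>\<^sub>\<infinity>i\<in>A. apply_bcontfun (f i) x) (finite_subsets_at_top A)"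
    by (simp add: apply_bcontfun_sum[abs_def])
  obtain l where l: "(\<lambda>x. \<Sum>\<^sub>\<infinity>i\<in>A. apply_bcontfun (f i) x) = apply_bcontfun l"
      "(sum f \<longlongrightarrow> l) (finite_subsets_at_top A)"
    using uniform_limit_bcontfunE[OF u] by auto
  then have hs: "(f has_sum l) A" by (simp add: has_sum_def)
  then show s: "f summable_on A" by (rule has_sum_imp_summable)
  have "infsum f A = l" using hs by (rule infsumI)
  then show "apply_bcontfun (infsum f A) x = (\<Sum>\<^sub>\<infinity>i\<in>A. apply_bcontfun (f i) x)"
    using l(1) by metis
  show "norm (infsum f A) \<le> (\<Sum>\<^sub>\<infinity>i\<in>A. norm (f i))"
    using assms by (rule norm_infsum_bound)
qed

section \<open>Norms, monomials and closed sets in \<open>ell1\<close>\<close>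

lemma norm_cf_mult_le: "norm (cf_mult f g) \<le> norm f * norm g"
  by (rule norm_bound) (auto simp: norm_mult intro!: mult_mono norm_bounded)

lemma norm_cf_cnj_le: "norm (cf_cnj f) \<le> norm f"
  by (rule norm_bound) (auto simp: norm_bounded)

lemma norm_cf_scale_le: "norm (cf_scale c f) \<le> cmod c * norm f"
  by (rule norm_bound) (auto simp: norm_mult intro!: mult_left_mono norm_bounded)

lemma ell1_zero [simp]: "(\<lambda>n. 0) \<in> ell1"
  by (simp add: ell1_def)

lemma ell1_add:
  assumes "a \<in> ell1" "b \<in> ell1"
  shows "(\<lambda>n. a n + b n) \<in> ell1"
proof -
  have "(\<lambda>n. norm (a n) + norm (b n)) summable_on UNIV"
    using assms by (intro summable_on_add) (auto simp: ell1_def)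
  then show ?thesis
    unfolding ell1_def mem_Collect_eq
    by (rule Infinite_Sum.abs_summable_on_comparison_test') (auto intro: norm_triangle_ineq)
qed

lemma ell1_dominated:
  assumes "a \<in> ell1" "\<And>n. norm (b n) \<le> C * norm (a n)"
  shows "b \<in> ell1"
proof -
  have "(\<lambda>n. C * norm (a n)) summable_on UNIV"
    using assms(1) by (intro summable_on_cmult_right) (auto simp: ell1_def)
  then show ?thesis
    unfolding ell1_def mem_Collect_eq
    by (rule Infinite_Sum.abs_summable_on_comparison_test') (auto intro: assms)
qed

lemma ell1_scale: "a \<in> ell1 \<Longrightarrow> (\<lambda>n. cf_scale c (a n)) \<in> ell1"
  by (rule ell1_dominated[where C = "cmod c"]) (auto intro: norm_cf_scale_le)

lemma ell1_diff:
  assumes "a \<in> ell1" "b \<in> ell1"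
  shows "(\<lambda>n. a n - b n) \<in> ell1"
proof -
  have "a n + cf_scale (- 1) (b n) = a n - b n" for n
    by (rule bcontfun_eqI) simp
  then show ?thesis
    using ell1_add[OF assms(1) ell1_scale[OF assms(2), of "- 1"]] by simp
qed

text \<open>This is the element \<open>f\<delta>^n\<close>.\<close>

definition monomial :: "('a::topological_space \<Rightarrow>\<^sub>C complex) \<Rightarrow> int \<Rightarrow> 'a cseq" where
  "monomial f n = (\<lambda>m. if m = n then f else 0)"

lemma monomial_apply: "monomial f n m = (if m = n then f else 0)"
  by (simp add: monomial_def)

lemma embed_eq_monomial: "embed f = monomial f 0"
  by (simp add: embed_def monomial_def)

lemma monomial_in_ell1 [simp]: "monomial f n \<in> ell1"
  unfolding ell1_def monomial_def mem_Collect_eq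
  by (rule finite_nonzero_values_imp_summable_on) (auto intro: finite_subset[of _ "{n}"])

lemma embed_in_ell1 [simp]: "embed f \<in> ell1"
  by (simp add: embed_eq_monomial)

lemma ell1_norm_nonneg: "0 \<le> ell1_norm a"
  by (simp add: ell1_norm_def infsum_nonneg)

lemma norm_le_ell1_norm: "a \<in> ell1 \<Longrightarrow> norm (a n) \<le> ell1_norm a"
  unfolding ell1_norm_def ell1_def
  using finite_sum_le_infsum[of "\<lambda>n. norm (a n)" UNIV "{n}"] by simp

lemma ell1_norm_monomial [simp]: "ell1_norm (monomial f n) = norm f"
  unfolding ell1_norm_def monomial_def by (subst infsum_single[of _ n]) auto

lemma ell1_tail:
  fixes a :: "'a::topological_space cseq"
  assumes "a \<in> ell1" "0 < e"
  obtains F where "finite F"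
    "\<And>b :: 'a cseq. (\<And>n. norm (b n) \<le> norm (a n)) \<Longrightarrow> (\<And>n. n \<in> F \<Longrightarrow> b n = 0) \<Longrightarrow> ell1_norm b < e"
proof (rule summable_tail[of "\<lambda>n. norm (a n)" UNIV e])
  fix F :: "int set"
  assume F: "finite F" and H: "\<And>g. (\<And>n. n \<in> UNIV \<Longrightarrow> 0 \<le> g n \<and> g n \<le> norm (a n)) \<Longrightarrow>
       (\<And>n. n \<in> F \<Longrightarrow> g n = 0) \<Longrightarrow> infsum g UNIV < e"
  show thesis
  proof (rule that[OF F])
    fix b :: "'a cseq"
    assume "\<And>n. norm (b n) \<le> norm (a n)" "\<And>n. n \<in> F \<Longrightarrow> b n = 0"
    then show "ell1_norm b < e"
      unfolding ell1_norm_def by (intro H) auto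
  qed
qed (use assms in \<open>auto simp: ell1_def\<close>)

lemma closedin_ell1_topologyD:
  assumes "closedin ell1_topology I" "a \<in> ell1"
    and "\<And>e. 0 < e \<Longrightarrow> \<exists>b\<in>I. ell1_norm (\<lambda>n. a n - b n) < e"
  shows "a \<in> I"
proof (rule ccontr)
  assume "a \<notin> I"
  then obtain r where "I \<subseteq> ell1" "0 < r" "disjnt I (Metric_space.mball ell1 (\<lambda>a b. ell1_norm (\<lambda>n. a n - b n)) a r)"
    using assms(1,2)
    unfolding ell1_topology_def Metric_space.closedin_metric[OF Metric_space_ell1] by auto
  with assms(2,3) show False
    by (auto simp: disjnt_iff Metric_space.in_mball[OF Metric_space_ell1])
qed

lemma closedin_ell1_topologyI:
  assumes "I \<subseteq> ell1"
    and "\<And>a. a \<in> ell1 \<Longrightarrow> (\<And>e. 0 < e \<Longrightarrow> \<exists>b\<in>I. ell1_norm (\<lambda>n. a n - b n) < e) \<Longrightarrow> a \<in> I"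
  shows "closedin ell1_topology I"
  unfolding ell1_topology_def Metric_space.closedin_metric[OF Metric_space_ell1]
proof (intro conjI allI impI assms(1))
  fix a assume a: "a \<in> ell1 - I"
  then obtain e where "0 < e" "\<And>b. b \<in> I \<Longrightarrow> \<not> ell1_norm (\<lambda>n. a n - b n) < e"
    using assms(2) by blast
  then show "\<exists>r>0. disjnt I (Metric_space.mball ell1 (\<lambda>a b. ell1_norm (\<lambda>n. a n - b n)) a r)"
    by (auto simp: disjnt_iff Metric_space.in_mball[OF Metric_space_ell1])
qed

section \<open>Convolution and involution for a homeomorphism of a compact space\<close>

locale dynamics =
  fixes \<sigma> :: "'a::t2_space \<Rightarrow> 'a"
  assumes compact_UNIV: "compact (UNIV :: 'a set)"
    and homeo: "homeomorphism UNIV UNIV \<sigma> (inv \<sigma>)"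
begin

lemma bij: "bij \<sigma>"
  using homeo by (metis bijI' homeomorphism_def UNIV_I)

lemma continuous_zpow: "continuous_on UNIV (zpow \<sigma> n)"
proof -
  have "continuous_on UNIV (f ^^ m)" if "continuous_on UNIV f" for f :: "'a \<Rightarrow> 'a" and m
    by (induction m) (auto intro: continuous_on_compose2[OF that] simp: id_def)
  moreover have "continuous_on UNIV \<sigma>" "continuous_on UNIV (inv \<sigma>)"
    using homeo by (auto simp: homeomorphism_def)
  ultimately show ?thesis by (simp add: zpow_on_def)
qed

lemmas zpow_add = zpow_add[OF bij]

lemma inv_eq_zpow: "inv \<sigma> x = zpow \<sigma> (- 1) x"
  by (simp add: zpow_on_def)

lemma zpow_minus_cancel [simp]: "zpow \<sigma> n (zpow \<sigma> (- n) x) = x" "zpow \<sigma> (- n) (zpow \<sigma> n x) = x"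
  by (simp_all add: zpow_add[symmetric])

text \<open>Negative powers of \<open>alpha \<sigma>\<close> are built from a chosen inverse on the
  function space. Precomposition with powers of \<open>\<sigma>\<close> gives a two-sided orbit of
  \<open>alpha \<sigma>\<close> through \<open>f\<close>, and injectivity of
  \<open>alpha \<sigma>\<close> leaves only one such orbit.\<close>

lemma apply_zpow_alpha: "apply_bcontfun (zpow (alpha \<sigma>) n f) x = apply_bcontfun f (zpow \<sigma> (- n) x)"
proof -
  define g where "g n = Bcontfun (\<lambda>x. apply_bcontfun f (zpow \<sigma> (- n) x))" for n
  have g: "apply_bcontfun (g n) x = apply_bcontfun f (zpow \<sigma> (- n) x)" for n x
  proof -
    have "(\<lambda>x. apply_bcontfun f (zpow \<sigma> (- n) x)) \<in> bcontfun"
      by (rule bcontfun_normI[where b = "norm f"])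
        (auto intro!: norm_bounded continuous_on_compose2[OF continuous_on_apply_bcontfun continuous_zpow])
    then show ?thesis by (simp add: g_def Bcontfun_inverse)
  qed
  have al: "apply_bcontfun (alpha \<sigma> h) x = apply_bcontfun h (inv \<sigma> x)" for h x
    using homeo by (intro apply_alpha) (simp add: homeomorphism_def)
  have "zpow (alpha \<sigma>) n f = g n"
  proof (rule zpow_on_eqI)
    show "inj (alpha \<sigma>)"
    proof (rule injI, rule bcontfun_eqI)
      fix h k x assume "alpha \<sigma> h = alpha \<sigma> k"
      then have "apply_bcontfun h (inv \<sigma> (\<sigma> x)) = apply_bcontfun k (inv \<sigma> (\<sigma> x))"
        by (metis al)
      then show "apply_bcontfun h x = apply_bcontfun k x"
        using bij by (simp add: bij_is_inj)
    qed
    show "g (n + 1) = alpha \<sigma> (g n)" for n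
      by (rule bcontfun_eqI) (simp add: g al inv_eq_zpow zpow_add[symmetric])
  qed (auto intro!: bcontfun_eqI simp: g)
  then show ?thesis by (simp add: g)
qed

lemma norm_zpow_alpha_le: "norm (zpow (alpha \<sigma>) n f) \<le> norm f"
  by (rule norm_bound) (simp add: apply_zpow_alpha norm_bounded)

text \<open>For fixed \<open>k\<close> the sum over \<open>n\<close> is a translate of the norm
  series of \<open>b\<close>, hence independent of the translation. Joint summability bounds the
  product norm here and justifies the exchange of sums for the representations.\<close>

lemma ell1_convolution_summable:
  fixes a b :: "'a cseq"
  assumes "a \<in> ell1" "b \<in> ell1"
  shows "(\<lambda>(k, n). norm (a k) * norm (b (n - k))) summable_on UNIV \<times> UNIV"
proof (rule summable_on_SigmaI)
  fix k
  have "((\<lambda>n. norm (b (n - k))) has_sum ell1_norm b) UNIV"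
    using has_sum_shift[of "\<lambda>n. norm (b n)" "ell1_norm b" k] assms(2)
    by (simp add: ell1_norm_def ell1_def)
  then show "((\<lambda>n. case (k, n) of (k, n) \<Rightarrow> norm (a k) * norm (b (n - k))) has_sum norm (a k) * ell1_norm b) UNIV"
    by (simp add: has_sum_cmult_right)
next
  show "(\<lambda>k. norm (a k) * ell1_norm b) summable_on UNIV"
    using assms(1) by (intro summable_on_cmult_left) (simp add: ell1_def)
qed auto

lemma norm_convolution_term_le:
  "norm (cf_mult (a k) (zpow (alpha \<sigma>) k (b (n - k)))) \<le> norm (a k) * norm (b (n - k))"
  by (rule order_trans[OF norm_cf_mult_le]) (intro mult_left_mono norm_zpow_alpha_le norm_ge_zero)

lemma convolution_summable:
  fixes a b :: "'a cseq"
  assumes "a \<in> ell1" "b \<in> ell1"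
  shows "(\<lambda>k. norm (a k) * norm (b (n - k))) summable_on UNIV"
  using summable_on_SigmaD1[OF summable_on_swap[THEN iffD1, OF ell1_convolution_summable[OF assms]], of n]
  by simp

lemma convolution_term_summable:
  fixes a b :: "'a cseq"
  assumes "a \<in> ell1" "b \<in> ell1"
  shows "(\<lambda>k. norm (cf_mult (a k) (zpow (alpha \<sigma>) k (b (n - k))))) summable_on UNIV"
  by (rule Infinite_Sum.abs_summable_on_comparison_test'[OF convolution_summable[OF assms]])
    (rule norm_convolution_term_le)

lemma ell1_mult_in_ell1:
  fixes a b :: "'a cseq"
  assumes "a \<in> ell1" "b \<in> ell1"
  shows "ell1_mult \<sigma> a b \<in> ell1"
proof -
  have "(\<lambda>n. \<Sum>\<^sub>\<infinity>k. norm (a k) * norm (b (n - k))) summable_on UNIV"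
    using summable_on_Sigma_banach[OF summable_on_swap[THEN iffD1, OF ell1_convolution_summable[OF assms]]]
    by simp
  moreover have "norm (ell1_mult \<sigma> a b n) \<le> (\<Sum>\<^sub>\<infinity>k. norm (a k) * norm (b (n - k)))" for n
    unfolding ell1_mult_def
    by (rule order_trans[OF bcontfun_has_sum(3)[OF convolution_term_summable[OF assms]]])
      (intro infsum_mono norm_convolution_term_le convolution_term_summable convolution_summable assms)
  ultimately show ?thesis
    unfolding ell1_def mem_Collect_eq by (rule Infinite_Sum.abs_summable_on_comparison_test')
qed

lemma apply_ell1_mult:
  fixes a b :: "'a cseq"
  assumes "a \<in> ell1" "b \<in> ell1"
  shows "apply_bcontfun (ell1_mult \<sigma> a b n) x =
    (\<Sum>\<^sub>\<infinity>k. apply_bcontfun (a k) x * apply_bcontfun (b (n - k)) (zpow \<sigma> (- k) x))"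
  unfolding ell1_mult_def
  by (simp add: bcontfun_has_sum(2)[OF convolution_term_summable[OF assms]] apply_zpow_alpha)

lemma ell1_mult_monomial_left:
  "ell1_mult \<sigma> (monomial f m) b n = cf_mult f (zpow (alpha \<sigma>) m (b (n - m)))"
  unfolding ell1_mult_def
  by (subst infsum_single[of _ m]) (auto simp: monomial_def intro!: bcontfun_eqI)

lemma ell1_mult_monomial_right:
  "ell1_mult \<sigma> a (monomial f m) n = cf_mult (a (n - m)) (zpow (alpha \<sigma>) (n - m) f)"
  unfolding ell1_mult_def
  by (subst infsum_single[of _ "n - m"]) (auto simp: monomial_def intro!: bcontfun_eqI simp: apply_zpow_alpha)

lemma ell1_mult_monomial:
  "ell1_mult \<sigma> (monomial f m) (monomial g n) = monomial (cf_mult f (zpow (alpha \<sigma>) m g)) (m + n)"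
  by (rule ext) (auto simp: ell1_mult_monomial_left monomial_apply apply_zpow_alpha intro!: bcontfun_eqI)

lemma apply_ell1_star:
  "apply_bcontfun (ell1_star \<sigma> a n) x = cnj (apply_bcontfun (a (- n)) (zpow \<sigma> (- n) x))"
  by (simp add: ell1_star_def apply_zpow_alpha)

lemma ell1_star_in_ell1:
  fixes a :: "'a cseq"
  assumes "a \<in> ell1"
  shows "ell1_star \<sigma> a \<in> ell1"
proof -
  have "(\<lambda>n. norm (a (- n))) summable_on UNIV \<longleftrightarrow> (\<lambda>n. norm (a n)) summable_on UNIV"
    by (rule summable_on_reindex_bij_witness[of _ uminus uminus]) auto
  then have "(\<lambda>n. a (- n)) \<in> ell1" using assms by (simp add: ell1_def)
  then show ?thesis
    by (rule ell1_dominated[where C = 1])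
      (auto simp: ell1_star_def intro: order_trans[OF norm_cf_cnj_le norm_zpow_alpha_le])
qed

end

section \<open>Closed ideals and hulls\<close>

text \<open>The summands are the powers of one number \<open>z\<close>, itself an
  \<open>N\<close>-th root of unity, so the geometric sum vanishes unless \<open>z = 1\<close>. This
  is the finite counterpart of the orthogonality of characters.\<close>

lemma sum_roots_of_unity_powi:
  fixes n :: int
  assumes "0 < N"
  shows "(\<Sum>j<N. cis (2 * pi * real j / real N) powi n) = (if int N dvd n then of_nat N else 0)"
proof -
  define z where "z = cis (2 * pi * (of_int n / real N))"
  have "cis (2 * pi * real j / real N) powi n = z ^ j" for j
    by (simp add: z_def cis_power_int Complex.DeMoivre field_simps)
  then have eq: "(\<Sum>j<N. cis (2 * pi * real j / real N) powi n) = (\<Sum>j<N. z ^ j)" by simp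
  show ?thesis
  proof (cases "int N dvd n")
    case True
    then obtain m where "n = int N * m" by auto
    then have "z = 1"
      using assms cis_multiple_2pi[of "of_int m"] by (simp add: z_def)
    then show ?thesis using True eq by simp
  next
    case False
    have "z \<noteq> 1"
    proof
      assume "z = 1"
      then have "cos (2 * pi * (of_int n / real N)) = 1"
        by (simp add: z_def complex_eq_iff)
      then obtain m :: int where "2 * pi * (of_int n / real N) = of_int m * 2 * pi"
        unfolding cos_one_2pi_int by auto
      then have "of_int n = real_of_int (m * int N)"
        using assms by (simp add: field_simps)
      then have "n = m * int N" by linarith
      with False show False by simp
    qed
    moreover have "z ^ N = cis (2 * pi * of_int n)"
      using assms by (simp add: z_def Complex.DeMoivre)
    then have "z ^ N = 1"
      using cis_multiple_2pi[of "of_int n"] by simp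
    ultimately show ?thesis using False eq by (simp add: geometric_sum)
  qed
qed

lemma finite_set_int_less_nat:
  fixes F :: "int set"
  assumes "finite F"
  obtains N :: nat where "0 < N" "\<And>n. n \<in> F \<Longrightarrow> \<bar>n\<bar> < int N"
proof
  show "0 < Suc (\<Sum>n\<in>F. nat \<bar>n\<bar>)" by simp
  fix n assume "n \<in> F"
  then have "nat \<bar>n\<bar> \<le> (\<Sum>n\<in>F. nat \<bar>n\<bar>)"
    using assms by (intro member_le_sum) auto
  then show "\<bar>n\<bar> < int (Suc (\<Sum>n\<in>F. nat \<bar>n\<bar>))" by linarith
qed

lemma ell1_kernel_mono: "S \<subseteq> S' \<Longrightarrow> ell1_kernel S' \<subseteq> ell1_kernel S"
  by (auto simp: ell1_kernel_def)

lemma ell1_hull_antimono: "I \<subseteq> I' \<Longrightarrow> ell1_hull I' \<subseteq> ell1_hull I"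
  by (auto simp: ell1_hull_def)

lemma subset_kernel_hull: "I \<subseteq> ell1 \<Longrightarrow> I \<subseteq> ell1_kernel (ell1_hull I)"
  by (auto simp: ell1_kernel_def ell1_hull_def)

lemma hull_kernel_subset: "S \<subseteq> ell1_hull (ell1_kernel S)"
  by (auto simp: ell1_kernel_def ell1_hull_def)

lemma embed_in_kernel_iff: "embed f \<in> ell1_kernel S \<longleftrightarrow> (\<forall>x\<in>S. apply_bcontfun f x = 0)"
  by (auto simp: ell1_kernel_def embed_eq_monomial monomial_apply)

lemma well_behaved_kernel: "well_behaved (ell1_kernel S)"
  by (auto simp: well_behaved_def embed_in_kernel_iff E_def) (auto simp: ell1_kernel_def)

lemma idealD:
  assumes "ideal \<sigma> I"
  shows "I \<subseteq> ell1" "(\<lambda>n. 0) \<in> I"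
    "\<And>a b. a \<in> I \<Longrightarrow> b \<in> I \<Longrightarrow> (\<lambda>n. a n + b n) \<in> I"
    "\<And>c a. a \<in> I \<Longrightarrow> (\<lambda>n. cf_scale c (a n)) \<in> I"
    "\<And>a b. a \<in> I \<Longrightarrow> b \<in> ell1 \<Longrightarrow> ell1_mult \<sigma> b a \<in> I"
    "\<And>a b. a \<in> I \<Longrightarrow> b \<in> ell1 \<Longrightarrow> ell1_mult \<sigma> a b \<in> I"
  using assms by (auto simp: ideal_def)

lemma ideal_sum:
  assumes "ideal \<sigma> I" "\<And>i. i \<in> F \<Longrightarrow> b i \<in> I"
  shows "(\<lambda>n. \<Sum>i\<in>F. b i n) \<in> I"
  using assms(2)
proof (induction F rule: infinite_finite_induct)
  case (insert i F)
  then show ?case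
    using idealD(3)[OF assms(1), of "b i" "\<lambda>n. \<Sum>i\<in>F. b i n"] by simp
qed (auto simp: idealD(2)[OF assms(1)])

lemma dual_invariant_imp_well_behaved:
  assumes I: "closed_ideal \<sigma> I" and inv: "\<forall>l\<in>circle. dual_action l ` I \<subseteq> I"
  shows "well_behaved I"
  unfolding well_behaved_def
proof clarsimp
  fix a assume a: "a \<in> I"
  have id: "ideal \<sigma> I" and cl: "closedin ell1_topology I"
    using I by (auto simp: closed_ideal_def)
  have a1: "a \<in> ell1" using a idealD(1)[OF id] by auto
  show "embed (E a) \<in> I"
  proof (rule closedin_ell1_topologyD[OF cl])
    fix e :: real assume "0 < e"
    then obtain F where F: "finite F"
      "\<And>b :: 'a cseq. (\<And>n. norm (b n) \<le> norm (a n)) \<Longrightarrow> (\<And>n. n \<in> F \<Longrightarrow> b n = 0) \<Longrightarrow> ell1_norm b < e"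
      using ell1_tail[OF a1] by metis
    \<comment> \<open>With \<open>N\<close> above all absolute values in \<open>F\<close>, zero is
      the only multiple of \<open>N\<close> that can lie in \<open>F\<close>.\<close>
    obtain N where N: "0 < N" "\<And>n. n \<in> F \<Longrightarrow> \<bar>n\<bar> < int N"
      using finite_set_int_less_nat[OF F(1)] by metis
    define b where "b n = cf_scale (1 / of_nat N) (\<Sum>j<N. dual_action (cis (2 * pi * real j / real N)) a n)" for n
    have "b \<in> I"
      unfolding b_def
      by (intro idealD(4)[OF id] ideal_sum[OF id]) (use inv a in \<open>auto simp: image_subset_iff\<close>)
    moreover have b: "b n = (if int N dvd n then a n else 0)" for n
    proof (rule bcontfun_eqI)
      fix x
      have "apply_bcontfun (b n) x =
          (\<Sum>j<N. cis (2 * pi * real j / real N) powi n) * apply_bcontfun (a n) x / of_nat N"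
        by (simp add: b_def apply_bcontfun_sum dual_action_def sum_distrib_right)
      then show "apply_bcontfun (b n) x = apply_bcontfun (if int N dvd n then a n else 0) x"
        using N(1) by (simp add: sum_roots_of_unity_powi)
    qed
    \<comment> \<open>The difference is \<open>- a n\<close> at nonzero multiples of
      \<open>N\<close> and zero in all other degrees, so it lives off \<open>F\<close>.\<close>
    moreover have "ell1_norm (\<lambda>n. embed (E a) n - b n) < e"
    proof (rule F(2))
      fix n
      show "norm (embed (E a) n - b n) \<le> norm (a n)"
        by (auto simp: b embed_def E_def)
      assume n: "n \<in> F"
      show "embed (E a) n - b n = 0"
      proof (cases "n = 0")
        case False
        then have "\<not> int N dvd n"
          using N(2)[OF n] zdvd_imp_le[of "int N" "\<bar>n\<bar>"] by auto
        then show ?thesis using False by (simp add: b embed_def)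
      qed (simp add: b embed_def E_def)
    qed
    ultimately show "\<exists>b\<in>I. ell1_norm (\<lambda>n. embed (E a) n - b n) < e" by blast
  qed simp
qed

context dynamics
begin

section \<open>Closed ideals determined by their hulls\<close>

lemma bcontfunI: "continuous_on UNIV (f :: 'a \<Rightarrow> complex) \<Longrightarrow> f \<in> bcontfun"
  using compact_continuous_image[OF _ compact_UNIV] compact_imp_bounded by (auto simp: bcontfun_def)

text \<open>Right multiplication by a power of \<delta> shifts degrees without twisting, because
  \<open>alpha \<sigma>\<close> fixes constants. Hence \<open>E\<close> can reach every coefficient,
  not just the one in degree 0.\<close>

lemma ideal_translate:
  assumes "ideal \<sigma> I" "a \<in> I"
  shows "(\<lambda>m. a (m + n)) \<in> I"
proof -
  have "ell1_mult \<sigma> a (monomial (const_bcontfun 1) (- n)) = (\<lambda>m. a (m + n))"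
    by (auto simp: ell1_mult_monomial_right apply_zpow_alpha intro!: bcontfun_eqI)
  then show ?thesis
    using idealD(6)[OF assms, of "monomial (const_bcontfun 1) (- n)"] by simp
qed

text \<open>Left multiplication by \<open>\<delta>^(-n)\<close>, unlike right multiplication, moves
  the point of evaluation: the coefficient in degree \<open>m - n\<close> takes at \<open>x\<close>
  the value of \<open>a m\<close> at \<open>zpow \<sigma> n x\<close>.\<close>

lemma hull_invariant:
  assumes "ideal \<sigma> I" "x \<in> ell1_hull I"
  shows "zpow \<sigma> n x \<in> ell1_hull I"
  unfolding ell1_hull_def
proof clarify
  fix a m assume "a \<in> I"
  then have "ell1_mult \<sigma> (monomial (const_bcontfun 1) (- n)) a \<in> I"
    by (intro idealD(5)[OF assms(1)]) auto
  then have "apply_bcontfun (ell1_mult \<sigma> (monomial (const_bcontfun 1) (- n)) a (m - n)) x = 0"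
    using assms(2) by (simp add: ell1_hull_def)
  then show "apply_bcontfun (a m) (zpow \<sigma> n x) = 0"
    by (simp add: ell1_mult_monomial_left apply_zpow_alpha)
qed

text \<open>A product evaluates its right factor at \<open>zpow \<sigma> (- k) x\<close>; invariance
  keeps these points in \<open>S\<close>, so each summand vanishes. Closedness holds because
  evaluating a coefficient is bounded by the \<open>ell1\<close> norm.\<close>

lemma closed_ideal_kernel:
  assumes S: "\<And>x n. x \<in> S \<Longrightarrow> zpow \<sigma> n x \<in> S"
  shows "closed_ideal \<sigma> (ell1_kernel S)"
  unfolding closed_ideal_def ideal_def
proof (intro conjI ballI allI)
  show sub: "ell1_kernel S \<subseteq> ell1" by (auto simp: ell1_kernel_def)
  show "(\<lambda>n. 0) \<in> ell1_kernel S" by (simp add: ell1_kernel_def)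
  show "(\<lambda>n. a n + b n) \<in> ell1_kernel S" if "a \<in> ell1_kernel S" "b \<in> ell1_kernel S" for a b
    using that by (auto simp: ell1_kernel_def ell1_add)
  show "(\<lambda>n. cf_scale c (a n)) \<in> ell1_kernel S" if "a \<in> ell1_kernel S" for c a
    using that by (auto simp: ell1_kernel_def ell1_scale)
  fix a b :: "'a cseq" assume a: "a \<in> ell1_kernel S" and b: "b \<in> ell1"
  then have a1: "a \<in> ell1" and 0: "\<And>n x. x \<in> S \<Longrightarrow> apply_bcontfun (a n) x = 0"
    by (auto simp: ell1_kernel_def)
  show "ell1_mult \<sigma> b a \<in> ell1_kernel S" "ell1_mult \<sigma> a b \<in> ell1_kernel S"
    using S a1 b by (auto simp: ell1_kernel_def ell1_mult_in_ell1 apply_ell1_mult 0)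
next
  show "closedin ell1_topology (ell1_kernel S)"
  proof (rule closedin_ell1_topologyI)
    fix a :: "'a cseq"
    assume a: "a \<in> ell1" and ap: "\<And>e. 0 < e \<Longrightarrow> \<exists>b\<in>ell1_kernel S. ell1_norm (\<lambda>n. a n - b n) < e"
    show "a \<in> ell1_kernel S"
      unfolding ell1_kernel_def
    proof (clarsimp simp: a)
      fix n x assume x: "x \<in> S"
      have "cmod (apply_bcontfun (a n) x) \<le> 0 + e" if e: "0 < e" for e
      proof -
        obtain b where b: "b \<in> ell1_kernel S" "ell1_norm (\<lambda>n. a n - b n) < e"
          using ap[OF e] by auto
        then have "b \<in> ell1" "apply_bcontfun (b n) x = 0"
          using x by (auto simp: ell1_kernel_def)
        then have "cmod (apply_bcontfun (a n) x) \<le> ell1_norm (\<lambda>n. a n - b n)"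
          using norm_bounded[of "a n - b n" x] norm_le_ell1_norm[OF ell1_diff[OF a], of b n] by simp
        then show ?thesis using b(2) by simp
      qed
      then have "cmod (apply_bcontfun (a n) x) \<le> 0" by (rule field_le_epsilon)
      then show "apply_bcontfun (a n) x = 0" by simp
    qed
  qed (auto simp: ell1_kernel_def)
qed

lemma ell1_mult_embed: "ell1_mult \<sigma> (embed f) (embed g) = embed (cf_mult f g)"
  by (simp add: embed_eq_monomial ell1_mult_monomial)

text \<open>The set where \<open>|f| \<ge> e\<close> is compact and misses the common zeros of
  \<open>J\<close>, so \<open>J\<close> contains a nonnegative \<open>h\<close> bounded below there.
  Then \<open>f N h / (1 + N h)\<close> is in \<open>J\<close>, and its distance to \<open>f\<close>
  is small for large \<open>N\<close>.\<close>

lemma vanishing_on_common_zeros_approx: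
  fixes J :: "('a \<Rightarrow>\<^sub>C complex) set" and f :: "'a \<Rightarrow>\<^sub>C complex"
  assumes add: "\<And>g h. g \<in> J \<Longrightarrow> h \<in> J \<Longrightarrow> g + h \<in> J" and zero: "0 \<in> J"
    and mult: "\<And>g h. g \<in> J \<Longrightarrow> cf_mult h g \<in> J"
    and f: "\<And>x. x \<in> zero_set J \<Longrightarrow> apply_bcontfun f x = 0" and e: "0 < e"
  obtains g where "g \<in> J" "norm (f - g) \<le> e"
proof -
  define K where "K = {x. e \<le> cmod (apply_bcontfun f x)}"
  have "closed K" unfolding K_def
    by (intro closed_Collect_le continuous_intros continuous_on_apply_bcontfun)
  then have K: "compact K" using compact_UNIV by (metis compact_Int_closed inf_top_left)
  have "\<exists>g\<in>J. apply_bcontfun g x \<noteq> 0" if "x \<in> K" for x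
    using that f[of x] e by (force simp: K_def zero_set_def)
  then obtain g where g: "\<And>x. x \<in> K \<Longrightarrow> g x \<in> J" "\<And>x. x \<in> K \<Longrightarrow> apply_bcontfun (g x) x \<noteq> 0"
    by metis
  have "open {y. apply_bcontfun (g x) y \<noteq> 0}" for x :: 'a
    by (intro open_Collect_neq continuous_intros continuous_on_apply_bcontfun)
  then obtain D where D: "D \<subseteq> K" "finite D" "K \<subseteq> (\<Union>x\<in>D. {y. apply_bcontfun (g x) y \<noteq> 0})"
    by (rule compactE_image[OF K, of K "\<lambda>x. {y. apply_bcontfun (g x) y \<noteq> 0}"]) (use g in auto)
  \<comment> \<open>Squared moduli cannot cancel, so \<open>h\<close> is positive wherever one of
    the finitely many \<open>g x\<close> is nonzero.\<close>
  define h where "h = (\<Sum>x\<in>D. cf_mult (cf_cnj (g x)) (g x))"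
  define r where "r y = (\<Sum>x\<in>D. (cmod (apply_bcontfun (g x) y))\<^sup>2)" for y
  have hr: "apply_bcontfun h y = of_real (r y)" for y
    unfolding h_def r_def of_real_sum complex_norm_square by (simp add: apply_bcontfun_sum mult.commute)
  have "h \<in> J"
    unfolding h_def using D(2,1)
  proof (induction D rule: finite_induct)
    case (insert x D)
    then show ?case by (auto intro!: add mult g)
  qed (simp add: zero)
  have r0: "0 \<le> r y" for y by (simp add: r_def sum_nonneg)
  have rpos: "0 < r y" if y: "y \<in> K" for y
  proof -
    obtain x where "x \<in> D" "apply_bcontfun (g x) y \<noteq> 0" using D(3) y by blast
    then show ?thesis unfolding r_def using D(2) by (intro sum_pos2[of _ x]) auto
  qed
  have rc: "continuous_on UNIV r"
    unfolding r_def by (intro continuous_intros continuous_on_apply_bcontfun)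
  obtain c where c: "0 < c" "\<And>y. y \<in> K \<Longrightarrow> c \<le> r y"
  proof (cases "K = {}")
    case False
    then obtain y where "y \<in> K" "\<And>z. z \<in> K \<Longrightarrow> r y \<le> r z"
      using continuous_attains_inf[OF K False continuous_on_subset[OF rc]] by auto
    with that rpos show thesis by blast
  qed (use that[of 1] in auto)
  \<comment> \<open>The error at \<open>y\<close> will be \<open>|f y| / (1 + N * r y)\<close>. On
    \<open>K\<close> it is at most \<open>e\<close> since \<open>norm f = e * (N * c)\<close> and
    \<open>c \<le> r y\<close>; off \<open>K\<close> already \<open>|f y| < e\<close>.\<close>
  define N where "N = norm f / (e * c)"
  have N: "0 \<le> N" using c e by (simp add: N_def)
  have pos: "0 < 1 + N * r y" for y using N r0[of y] by (simp add: add_pos_nonneg)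
  define q where "q = Bcontfun (\<lambda>y. apply_bcontfun f y * of_real (N / (1 + N * r y)))"
  have q: "apply_bcontfun q y = apply_bcontfun f y * of_real (N / (1 + N * r y))" for y
  proof -
    have "(\<lambda>y. apply_bcontfun f y * of_real (N / (1 + N * r y))) \<in> bcontfun"
      by (intro bcontfunI continuous_intros continuous_on_apply_bcontfun rc)
        (use pos in \<open>simp add: less_imp_neq[symmetric]\<close>)
    then show ?thesis by (simp add: q_def Bcontfun_inverse)
  qed
  have "norm (f - cf_mult q h) \<le> e"
  proof (rule norm_bound)
    fix y
    have "apply_bcontfun (f - cf_mult q h) y = apply_bcontfun f y * of_real (1 - N / (1 + N * r y) * r y)"
      by (simp add: q hr algebra_simps)
    also have "1 - N / (1 + N * r y) * r y = 1 / (1 + N * r y)"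
      using pos[of y] by (simp add: field_simps)
    finally have "cmod (apply_bcontfun (f - cf_mult q h) y) = cmod (apply_bcontfun f y) * \<bar>1 / (1 + N * r y)\<bar>"
      by (simp only: norm_mult norm_of_real)
    then have eq: "cmod (apply_bcontfun (f - cf_mult q h) y) = cmod (apply_bcontfun f y) / (1 + N * r y)"
      using pos[of y] by simp
    show "cmod (apply_bcontfun (f - cf_mult q h) y) \<le> e"
    proof (cases "y \<in> K")
      case True
      have "cmod (apply_bcontfun f y) \<le> norm f" by (rule norm_bounded)
      also have "\<dots> = e * (N * c)" using e c by (simp add: N_def)
      also have "\<dots> \<le> e * (1 + N * r y)"
        using e mult_left_mono[OF c(2)[OF True] N] by (intro mult_left_mono) auto
      finally show ?thesis unfolding eq using pos[of y] by (simp add: divide_le_eq)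
    next
      case False
      then have "cmod (apply_bcontfun f y) \<le> e" by (simp add: K_def)
      also have "\<dots> \<le> e * (1 + N * r y)" using e N r0[of y] by simp
      finally show ?thesis unfolding eq using pos[of y] by (simp add: divide_le_eq)
    qed
  qed
  with mult[OF \<open>h \<in> J\<close>] that show thesis by blast
qed

lemma well_behaved_imp_kernel_hull:
  assumes I: "closed_ideal \<sigma> I" and wb: "well_behaved I"
  shows "I = ell1_kernel (ell1_hull I)"
proof
  have id: "ideal \<sigma> I" and cl: "closedin ell1_topology I"
    using I by (auto simp: closed_ideal_def)
  show "I \<subseteq> ell1_kernel (ell1_hull I)" by (rule subset_kernel_hull[OF idealD(1)[OF id]])
  \<comment> \<open>\<open>J\<close> is the part of \<open>I\<close> in \<open>C(X)\<close>.
    Translation and good behaviour put every coefficient of every element of \<open>I\<close> into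
    \<open>J\<close>, so the common zeros of \<open>J\<close> lie in the hull of
    \<open>I\<close>.\<close>
  define J where "J = {g. embed g \<in> I}"
  have coeff: "a n \<in> J" if "a \<in> I" for a n
  proof -
    have "embed (E (\<lambda>m. a (m + n))) \<in> I"
      using wb ideal_translate[OF id that] by (auto simp: well_behaved_def)
    then show ?thesis by (simp add: E_def J_def)
  qed
  have J: "f \<in> J" if f: "\<And>x. x \<in> ell1_hull I \<Longrightarrow> apply_bcontfun f x = 0" for f
    unfolding J_def mem_Collect_eq
  proof (rule closedin_ell1_topologyD[OF cl])
    fix e :: real assume "0 < e"
    obtain g where g: "g \<in> J" "norm (f - g) \<le> e / 2"
    proof (rule vanishing_on_common_zeros_approx[of J f "e / 2"])
      show "g + h \<in> J" if "g \<in> J" "h \<in> J" for g h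
      proof -
        have "(\<lambda>n. embed g n + embed h n) = embed (g + h)" by (auto simp: embed_def)
        then show ?thesis using idealD(3)[OF id, of "embed g" "embed h"] that by (simp add: J_def)
      qed
      show "0 \<in> J" using idealD(2)[OF id] by (simp add: J_def embed_def)
      show "cf_mult h g \<in> J" if "g \<in> J" for g h
        using idealD(5)[OF id, of "embed g" "embed h"] that by (simp add: J_def ell1_mult_embed)
      show "apply_bcontfun f x = 0" if "x \<in> zero_set J" for x
        using that coeff by (intro f) (auto simp: ell1_hull_def zero_set_def)
    qed (use \<open>0 < e\<close> in auto)
    have "(\<lambda>n. embed f n - embed g n) = monomial (f - g) 0" by (auto simp: embed_def monomial_def)
    then show "\<exists>b\<in>I. ell1_norm (\<lambda>n. embed f n - b n) < e"
      using g \<open>0 < e\<close> by (intro bexI[of _ "embed g"]) (auto simp: J_def)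
  qed simp
  show "ell1_kernel (ell1_hull I) \<subseteq> I"
  proof
    fix a assume a: "a \<in> ell1_kernel (ell1_hull I)"
    then have a1: "a \<in> ell1" and aJ: "\<And>n. a n \<in> J"
      by (auto simp: ell1_kernel_def intro!: J)
    have mono: "monomial (a n) n \<in> I" for n
    proof -
      have "ell1_mult \<sigma> (embed (a n)) (monomial (const_bcontfun 1) n) = monomial (a n) n"
        by (auto simp: embed_eq_monomial ell1_mult_monomial intro!: arg_cong2[of _ _ _ _ monomial] bcontfun_eqI)
      then show ?thesis
        using aJ[of n] idealD(6)[OF id, of "embed (a n)" "monomial (const_bcontfun 1) n"] by (simp add: J_def)
    qed
    show "a \<in> I"
    proof (rule closedin_ell1_topologyD[OF cl a1])
      fix e :: real assume "0 < e"
      then obtain F where F: "finite F"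
        "\<And>b :: 'a cseq. (\<And>n. norm (b n) \<le> norm (a n)) \<Longrightarrow> (\<And>n. n \<in> F \<Longrightarrow> b n = 0) \<Longrightarrow> ell1_norm b < e"
        using ell1_tail[OF a1] by metis
      \<comment> \<open>The finite truncations of \<open>a\<close> are in \<open>I\<close>, because
        each monomial is a coefficient in \<open>J\<close> times a power of \<delta>.\<close>
      have "(\<lambda>n. \<Sum>m\<in>F. monomial (a m) m n) \<in> I"
        by (rule ideal_sum[OF id mono])
      moreover have "(\<Sum>m\<in>F. monomial (a m) m n) = (if n \<in> F then a n else 0)" for n
        using F(1) by (simp add: monomial_def)
      then have "ell1_norm (\<lambda>n. a n - (\<Sum>m\<in>F. monomial (a m) m n)) < e"
        by (intro F(2)) auto
      ultimately show "\<exists>b\<in>I. ell1_norm (\<lambda>n. a n - b n) < e" by auto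
    qed
  qed
qed

section \<open>Equivalent forms of good behaviour\<close>

lemma well_behaved_iff_kernel_hull:
  assumes "closed_ideal \<sigma> I"
  shows "well_behaved I \<longleftrightarrow> I = ell1_kernel (ell1_hull I)"
  using well_behaved_imp_kernel_hull[OF assms] well_behaved_kernel by metis

text \<open>The inclusion of \<open>I \<inter> range embed\<close> holds for any \<open>I\<close>,
  since \<open>E\<close> is a left inverse of \<open>embed\<close>; the other one is good
  behaviour.\<close>

lemma well_behaved_iff_E_eq:
  fixes I :: "'a cseq set"
  shows "well_behaved I \<longleftrightarrow> embed ` (E ` I) = I \<inter> range embed"
proof -
  have "E (embed f) = f" for f :: "'a \<Rightarrow>\<^sub>C complex" by (simp add: E_def embed_def)
  then have "embed f \<in> embed ` (E ` I)" if "embed f \<in> I" for f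
    using that by (metis imageI)
  then show ?thesis unfolding well_behaved_def by blast
qed

lemma E_kernel: "E ` ell1_kernel (S :: 'a set) = {f. \<forall>x\<in>S. apply_bcontfun f x = 0}"
proof
  show "E ` ell1_kernel S \<subseteq> {f. \<forall>x\<in>S. apply_bcontfun f x = 0}"
    by (auto simp: ell1_kernel_def E_def)
  show "{f. \<forall>x\<in>S. apply_bcontfun f x = 0} \<subseteq> E ` ell1_kernel S"
  proof clarify
    fix f :: "'a \<Rightarrow>\<^sub>C complex" assume "\<forall>x\<in>S. apply_bcontfun f x = 0"
    moreover have "f = E (embed f)" by (simp add: E_def embed_def)
    ultimately show "f \<in> E ` ell1_kernel S" using embed_in_kernel_iff by blast
  qed
qed

lemma well_behaved_iff_delta_span:
  assumes "closed_ideal \<sigma> I"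
  shows "well_behaved I \<longleftrightarrow> I = delta_span (E ` I)"
proof
  assume "well_behaved I"
  then have I: "I = ell1_kernel (ell1_hull I)" using well_behaved_iff_kernel_hull[OF assms] by simp
  have "delta_span (E ` ell1_kernel (ell1_hull I)) = ell1_kernel (ell1_hull I)"
    unfolding E_kernel by (auto simp: delta_span_def ell1_kernel_def)
  with I show "I = delta_span (E ` I)" by simp
next
  assume I: "I = delta_span (E ` I)"
  have "0 \<in> E ` I"
    using idealD(2)[of \<sigma> I] assms by (auto simp: closed_ideal_def E_def image_iff intro!: bexI[of _ "\<lambda>n. 0"])
  then have "embed (E a) \<in> delta_span (E ` I)" if "a \<in> I" for a
    using that by (auto simp: delta_span_def embed_eq_monomial monomial_apply)
  with I show "well_behaved I" by (auto simp: well_behaved_def)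
qed

text \<open>For the converse the condition is tested on
  \<open>I' = ell1_kernel (ell1_hull I)\<close>, which is a closed ideal because hulls are invariant
  and whose hull contains that of \<open>I\<close>.\<close>

lemma well_behaved_iff_hull_order:
  assumes "closed_ideal \<sigma> I"
  shows "well_behaved I \<longleftrightarrow>
    (\<forall>I'. closed_ideal \<sigma> I' \<longrightarrow> (I' \<subseteq> I \<longleftrightarrow> ell1_hull I' \<supseteq> ell1_hull I))"
proof
  assume "well_behaved I"
  then have I: "I = ell1_kernel (ell1_hull I)" using well_behaved_iff_kernel_hull[OF assms] by simp
  show "\<forall>I'. closed_ideal \<sigma> I' \<longrightarrow> (I' \<subseteq> I \<longleftrightarrow> ell1_hull I' \<supseteq> ell1_hull I)"
  proof (intro allI impI iffI)
    fix I' assume I': "closed_ideal \<sigma> I'" and "ell1_hull I \<subseteq> ell1_hull I'"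
    then have "ell1_kernel (ell1_hull I') \<subseteq> I" using I ell1_kernel_mono by blast
    moreover have "I' \<subseteq> ell1_kernel (ell1_hull I')"
      using I' by (intro subset_kernel_hull) (auto simp: closed_ideal_def ideal_def)
    ultimately show "I' \<subseteq> I" by simp
  qed (rule ell1_hull_antimono)
next
  have id: "ideal \<sigma> I" using assms by (simp add: closed_ideal_def)
  assume *: "\<forall>I'. closed_ideal \<sigma> I' \<longrightarrow> (I' \<subseteq> I \<longleftrightarrow> ell1_hull I' \<supseteq> ell1_hull I)"
  have "closed_ideal \<sigma> (ell1_kernel (ell1_hull I))"
    by (rule closed_ideal_kernel) (rule hull_invariant[OF id])
  with * have "ell1_kernel (ell1_hull I) \<subseteq> I"
    using hull_kernel_subset by blast
  moreover have "I \<subseteq> ell1_kernel (ell1_hull I)" by (rule subset_kernel_hull[OF idealD(1)[OF id]])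
  ultimately show "well_behaved I" by (simp add: well_behaved_iff_kernel_hull[OF assms])
qed

lemma well_behaved_iff_dual_invariant:
  assumes "closed_ideal \<sigma> I"
  shows "well_behaved I \<longleftrightarrow> (\<forall>l\<in>circle. dual_action l ` I \<subseteq> I)"
proof
  assume "well_behaved I"
  then have I: "I = ell1_kernel (ell1_hull I)" using well_behaved_iff_kernel_hull[OF assms] by simp
  have "dual_action l a \<in> ell1_kernel S" if "l \<in> circle" "a \<in> ell1_kernel S" for l a S
  proof -
    have "a \<in> ell1" using that by (simp add: ell1_kernel_def)
    then have "dual_action l a \<in> ell1"
      by (rule ell1_dominated[where C = 1])
        (use that norm_cf_scale_le[of "l powi _"] in \<open>simp add: dual_action_def norm_power_int\<close>)
    then show ?thesis using that by (simp add: ell1_kernel_def dual_action_def)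
  qed
  with I show "\<forall>l\<in>circle. dual_action l ` I \<subseteq> I" by blast
qed (rule dual_invariant_imp_well_behaved[OF assms])

lemma zero_set_E_well_behaved:
  assumes "closed_ideal \<sigma> I" "well_behaved I"
  shows "zero_set (E ` I) = ell1_hull I"
proof
  have I: "I = ell1_kernel (ell1_hull I)" using well_behaved_iff_kernel_hull[OF assms(1)] assms(2) by simp
  have "a n \<in> E ` I" if "a \<in> I" for a n
  proof -
    have "a n \<in> E ` ell1_kernel (ell1_hull I)"
      using that unfolding E_kernel by (auto simp: ell1_hull_def)
    with I show ?thesis by simp
  qed
  then show "zero_set (E ` I) \<subseteq> ell1_hull I" unfolding zero_set_def ell1_hull_def by blast
  show "ell1_hull I \<subseteq> zero_set (E ` I)" by (auto simp: zero_set_def ell1_hull_def E_def)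
qed

lemma kernel_closure: "ell1_kernel (closure S) = ell1_kernel (S :: 'a set)"
proof
  show "ell1_kernel S \<subseteq> ell1_kernel (closure S)"
    unfolding ell1_kernel_def
  proof clarsimp
    fix a :: "'a cseq" and n x
    assume a: "\<forall>n. \<forall>x\<in>S. apply_bcontfun (a n) x = 0" and x: "x \<in> closure S"
    have "closed {x. apply_bcontfun (a n) x = 0}"
      by (intro closed_Collect_eq continuous_intros continuous_on_apply_bcontfun)
    then have "closure S \<subseteq> {x. apply_bcontfun (a n) x = 0}" using a by (intro closure_minimal) auto
    with x show "apply_bcontfun (a n) x = 0" by auto
  qed
qed (rule ell1_kernel_mono[OF closure_subset])

end

section \<open>Representations supported on an orbit\<close>

lemma ell2_add:
  assumes "\<xi> \<in> ell2 B" "\<eta> \<in> ell2 B"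
  shows "(\<lambda>k. \<xi> k + \<eta> k) \<in> ell2 B"
proof -
  have "(\<lambda>k. 2 * ((cmod (\<xi> k))\<^sup>2 + (cmod (\<eta> k))\<^sup>2)) summable_on B"
    using assms by (intro summable_on_cmult_right summable_on_add) (auto simp: ell2_def)
  moreover have "(cmod (\<xi> k + \<eta> k))\<^sup>2 \<le> 2 * ((cmod (\<xi> k))\<^sup>2 + (cmod (\<eta> k))\<^sup>2)" for k
  proof -
    have "(cmod (\<xi> k + \<eta> k))\<^sup>2 \<le> (cmod (\<xi> k) + cmod (\<eta> k))\<^sup>2"
      by (intro power_mono norm_triangle_ineq) auto
    also have "\<dots> \<le> 2 * ((cmod (\<xi> k))\<^sup>2 + (cmod (\<eta> k))\<^sup>2)"
      using sum_squares_bound[of "cmod (\<xi> k)" "cmod (\<eta> k)"] by (simp add: power2_sum)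
    finally show ?thesis .
  qed
  ultimately have "(\<lambda>k. (cmod (\<xi> k + \<eta> k))\<^sup>2) summable_on B"
    by (rule summable_on_comparison_test) auto
  then show ?thesis using assms by (auto simp: ell2_def)
qed

lemma ell2_scale: "\<xi> \<in> ell2 B \<Longrightarrow> (\<lambda>k. c * \<xi> k) \<in> ell2 B"
  by (auto simp: ell2_def norm_mult power_mult_distrib intro!: summable_on_cmult_right)

lemma basis_vec_apply: "basis_vec j k = (if k = j then 1 else 0)"
  by (simp add: basis_vec_def)

lemma ell2_basis_vec: "j \<in> B \<Longrightarrow> basis_vec j \<in> ell2 B"
  by (auto simp: ell2_def basis_vec_def intro!: finite_nonzero_values_imp_summable_on finite_subset[of _ "{j}"]
      split: if_splits)

lemma ell2_norm_nonneg: "0 \<le> ell2_norm B \<xi>"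
  by (simp add: ell2_norm_def infsum_nonneg)

lemma ell2_norm_square: "(ell2_norm B \<xi>)\<^sup>2 = (\<Sum>\<^sub>\<infinity>k\<in>B. (cmod (\<xi> k))\<^sup>2)"
  by (simp add: ell2_norm_def infsum_nonneg)

lemma cmod_le_ell2_norm:
  assumes "\<xi> \<in> ell2 B"
  shows "cmod (\<xi> k) \<le> ell2_norm B \<xi>"
proof (cases "k \<in> B")
  case True
  then have "(cmod (\<xi> k))\<^sup>2 \<le> (ell2_norm B \<xi>)\<^sup>2"
    using finite_sum_le_infsum[of "\<lambda>k. (cmod (\<xi> k))\<^sup>2" B "{k}"] assms
    by (simp add: ell2_def ell2_norm_square)
  then show ?thesis using ell2_norm_nonneg by (rule power2_le_imp_le)
qed (use assms in \<open>auto simp: ell2_def ell2_norm_nonneg\<close>)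

lemma ell2_tail:
  assumes "\<xi> \<in> ell2 B" "0 < e"
  obtains F where "finite F" "F \<subseteq> B"
    "\<And>\<eta>. (\<And>k. k \<in> B \<Longrightarrow> cmod (\<eta> k) \<le> cmod (\<xi> k)) \<Longrightarrow> (\<And>k. k \<in> F \<Longrightarrow> \<eta> k = 0) \<Longrightarrow> ell2_norm B \<eta> < e"
proof (rule summable_tail[of "\<lambda>k. (cmod (\<xi> k))\<^sup>2" B "e\<^sup>2"])
  fix F
  assume F: "finite F" "F \<subseteq> B" and H: "\<And>g. (\<And>n. n \<in> B \<Longrightarrow> 0 \<le> g n \<and> g n \<le> (cmod (\<xi> n))\<^sup>2) \<Longrightarrow>
       (\<And>n. n \<in> F \<Longrightarrow> g n = 0) \<Longrightarrow> infsum g B < e\<^sup>2"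
  show thesis
  proof (rule that[OF F])
    fix \<eta> assume "\<And>k. k \<in> B \<Longrightarrow> cmod (\<eta> k) \<le> cmod (\<xi> k)" "\<And>k. k \<in> F \<Longrightarrow> \<eta> k = 0"
    then have "(ell2_norm B \<eta>)\<^sup>2 < e\<^sup>2"
      unfolding ell2_norm_square by (intro H) (auto intro: power_mono)
    then show "ell2_norm B \<eta> < e" using assms(2) by (simp add: power_less_imp_less_base)
  qed
qed (use assms in \<open>auto simp: ell2_def\<close>)

lemma closedin_ell2_topologyD:
  assumes "closedin (ell2_topology B) K" "\<xi> \<in> ell2 B"
    and "\<And>e. 0 < e \<Longrightarrow> \<exists>\<eta>\<in>K. ell2_norm B (\<lambda>k. \<xi> k - \<eta> k) < e"
  shows "\<xi> \<in> K"
proof (rule ccontr)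
  assume "\<xi> \<notin> K"
  then obtain r where "K \<subseteq> ell2 B" "0 < r"
      "disjnt K (Metric_space.mball (ell2 B) (\<lambda>\<xi> \<eta>. ell2_norm B (\<lambda>k. \<xi> k - \<eta> k)) \<xi> r)"
    using assms(1,2)
    unfolding ell2_topology_def Metric_space.closedin_metric[OF Metric_space_ell2] by auto
  with assms(2,3) show False
    by (auto simp: disjnt_iff Metric_space.in_mball[OF Metric_space_ell2])
qed

text \<open>Finite truncations lie in any subspace containing the basis. This serves a closed
  invariant subspace in the proof of irreducibility and the span of \<open>\<pi> a \<xi>\<close> in
  the proof of cyclicity.\<close>

lemma ell2_span_basis_dense:
  assumes zero: "(\<lambda>k. 0) \<in> K"
    and add: "\<And>\<xi> \<eta>. \<xi> \<in> K \<Longrightarrow> \<eta> \<in> K \<Longrightarrow> (\<lambda>k. \<xi> k + \<eta> k) \<in> K"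
    and scale: "\<And>c \<xi>. \<xi> \<in> K \<Longrightarrow> (\<lambda>k. c * \<xi> k) \<in> K"
    and basis: "\<And>j. j \<in> B \<Longrightarrow> basis_vec j \<in> K"
    and \<xi>: "\<xi> \<in> ell2 B" and e: "0 < e"
  shows "\<exists>\<eta>\<in>K. ell2_norm B (\<lambda>k. \<xi> k - \<eta> k) < e"
proof -
  obtain F where F: "finite F" "F \<subseteq> B"
    "\<And>\<eta>. (\<And>k. k \<in> B \<Longrightarrow> cmod (\<eta> k) \<le> cmod (\<xi> k)) \<Longrightarrow> (\<And>k. k \<in> F \<Longrightarrow> \<eta> k = 0) \<Longrightarrow> ell2_norm B \<eta> < e"
    using ell2_tail[OF \<xi> e] by metis
  have "(\<lambda>k. if k \<in> F then \<xi> k else 0) \<in> K"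
    using F(1,2)
  proof (induction F rule: finite_induct)
    case (insert j F)
    have "(\<lambda>k. if k \<in> insert j F then \<xi> k else 0) =
        (\<lambda>k. \<xi> j * basis_vec j k + (if k \<in> F then \<xi> k else 0))"
      using insert.hyps by (auto simp: basis_vec_def)
    then show ?case using insert by (auto intro!: add scale basis)
  qed (simp add: zero)
  moreover have "ell2_norm B (\<lambda>k. \<xi> k - (if k \<in> F then \<xi> k else 0)) < e"
    by (rule F(3)) auto
  ultimately show ?thesis by (intro bexI[of _ "\<lambda>k. if k \<in> F then \<xi> k else 0"])
qed

lemma has_sum_finite_sum:
  fixes f :: "'i \<Rightarrow> 'j \<Rightarrow> 'c::topological_comm_monoid_add"
  assumes "finite F" "\<And>i. i \<in> F \<Longrightarrow> (f i has_sum s i) A"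
  shows "((\<lambda>j. \<Sum>i\<in>F. f i j) has_sum (\<Sum>i\<in>F. s i)) A"
  using assms by (induction F rule: finite_induct) (auto intro!: has_sum_add)

text \<open>The weighted sum of the squares \<open>(x i - r)\<^sup>2\<close> is a nonnegative
  quadratic polynomial in \<open>r\<close>. The weights will be the norms
  \<open>norm (a n)\<close>.\<close>

lemma infsum_Cauchy_Schwarz_weighted:
  fixes w x :: "'i \<Rightarrow> real"
  assumes w: "w summable_on A" "\<And>i. 0 \<le> w i" and x: "\<And>i. 0 \<le> x i" "\<And>i. x i \<le> C"
  shows "(\<lambda>i. w i * x i) summable_on A" "(\<lambda>i. w i * (x i)\<^sup>2) summable_on A"
    "(\<Sum>\<^sub>\<infinity>i\<in>A. w i * x i)\<^sup>2 \<le> infsum w A * (\<Sum>\<^sub>\<infinity>i\<in>A. w i * (x i)\<^sup>2)"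
proof -
  show S: "(\<lambda>i. w i * x i) summable_on A"
    by (rule summable_on_comparison_test[OF summable_on_cmult_left[OF w(1), of C]])
      (auto intro!: mult_left_mono mult_nonneg_nonneg w x)
  show T: "(\<lambda>i. w i * (x i)\<^sup>2) summable_on A"
    by (rule summable_on_comparison_test[OF summable_on_cmult_left[OF w(1), of "C\<^sup>2"]])
      (auto intro!: mult_left_mono mult_nonneg_nonneg power_mono w x)
  define s t a where "s = (\<Sum>\<^sub>\<infinity>i\<in>A. w i * x i)" and "t = (\<Sum>\<^sub>\<infinity>i\<in>A. w i * (x i)\<^sup>2)" and "a = infsum w A"
  have h: "((\<lambda>i. w i * x i) has_sum s) A" "((\<lambda>i. w i * (x i)\<^sup>2) has_sum t) A" "(w has_sum a) A"
    using S T w(1) by (auto simp: s_def t_def a_def)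
  have q: "0 \<le> t - 2 * r * s + r\<^sup>2 * a" for r
  proof -
    have "((\<lambda>i. w i * (x i)\<^sup>2 + ((- 2 * r) * (w i * x i) + r\<^sup>2 * w i)) has_sum (t + ((- 2 * r) * s + r\<^sup>2 * a))) A"
      by (intro has_sum_add has_sum_cmult_right h)
    moreover have "0 \<le> w i * (x i)\<^sup>2 + ((- 2 * r) * (w i * x i) + r\<^sup>2 * w i)" for i
    proof -
      have "w i * (x i)\<^sup>2 + ((- 2 * r) * (w i * x i) + r\<^sup>2 * w i) = w i * (x i - r)\<^sup>2"
        by (simp add: power2_eq_square algebra_simps)
      then show ?thesis using w(2)[of i] by simp
    qed
    ultimately have "0 \<le> t + ((- 2 * r) * s + r\<^sup>2 * a)" by (rule has_sum_nonneg)
    then show ?thesis by simp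
  qed
  have a0: "0 \<le> a" unfolding a_def using w by (intro infsum_nonneg)
  have "s\<^sup>2 \<le> a * t"
  proof (cases "a = 0")
    case True
    \<comment> \<open>Without total weight the polynomial is affine in \<open>r\<close>; for nonzero
      \<open>s\<close> this choice of \<open>r\<close> gives \<open>- t - 2\<close>, contradicting
      \<open>0 \<le> t\<close>.\<close>
    have "0 \<le> t - 2 * ((t + 1) / s) * s" using q[of "(t + 1) / s"] True by simp
    moreover have "0 \<le> t" using q[of 0] by simp
    ultimately have "s = 0" by (cases "s = 0") auto
    then show ?thesis using True by simp
  next
    case False
    \<comment> \<open>The value \<open>s / a\<close> minimises the quadratic.\<close>
    have "0 \<le> a * (t - 2 * (s / a) * s + (s / a)\<^sup>2 * a)" using q[of "s / a"] a0 by simp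
    also have "\<dots> = a * t - s\<^sup>2" using False by (simp add: power2_eq_square field_simps)
    finally show ?thesis by simp
  qed
  then show "(\<Sum>\<^sub>\<infinity>i\<in>A. w i * x i)\<^sup>2 \<le> infsum w A * (\<Sum>\<^sub>\<infinity>i\<in>A. w i * (x i)\<^sup>2)"
    by (simp add: s_def t_def a_def)
qed

text \<open>Urysohn's lemma in a compact Hausdorff space. The bound by one ensures that multiplying
  a vector by \<open>f\<close> does not enlarge its tail.\<close>

lemma (in dynamics) separating_function:
  fixes F :: "'a set"
  assumes "finite F" "x \<notin> F"
  obtains f :: "'a \<Rightarrow>\<^sub>C complex" where "apply_bcontfun f x = 1" "\<And>z. z \<in> F \<Longrightarrow> apply_bcontfun f z = 0"
    "\<And>z. cmod (apply_bcontfun f z) \<le> 1"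
proof -
  have "normal_space (euclidean :: 'a topology)"
    by (rule compact_Hausdorff_or_regular_imp_normal_space)
      (use compact_UNIV in \<open>auto simp: compact_space_def compactin_euclidean_iff Hausdorff_space_def separation_t2 disjnt_def\<close>)
  then obtain h where h: "continuous_map euclidean (top_of_set {0..1::real}) h" "h ` F \<subseteq> {0}" "h ` {x} \<subseteq> {1}"
    using Urysohn_lemma[of euclidean F "{x}" 0 1] assms finite_imp_closed[of F] by (auto simp: disjnt_def)
  have "continuous_on UNIV h" "\<And>z. h z \<in> {0..1}"
    using h(1) by (auto simp: continuous_map_in_subtopology image_subset_iff Pi_iff)
  then have "(\<lambda>z. complex_of_real (h z)) \<in> bcontfun"
    by (intro bcontfunI continuous_intros)
  then have "apply_bcontfun (Bcontfun (\<lambda>z. complex_of_real (h z))) z = h z" for z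
    by (simp add: Bcontfun_inverse)
  with h(2,3) \<open>\<And>z. h z \<in> {0..1}\<close> show thesis
    by (intro that[of "Bcontfun (\<lambda>z. complex_of_real (h z))"]) auto
qed

text \<open>
  Common form of \<open>\<pi>\<^sub>x\<close> and \<open>\<pi>\<^sub>x\<^sub>,\<^sub>\<lambda>\<close>: basis vectors are indexed by points \<open>y k\<close> of one orbit, \<open>\<tau> n k\<close> is the
  index of \<open>\<sigma>\<^sup>-\<^sup>n (y k)\<close>, and \<open>\<delta>\<^sup>n\<close> acts by \<open>\<xi> \<mapsto> (k \<mapsto> c n k * \<xi> (\<tau> n k))\<close> with a unitary cocycle \<open>c\<close>.
\<close>

locale orbit_rep = dynamics \<sigma> for \<sigma> :: "'a::t2_space \<Rightarrow> 'a" +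
  fixes B :: "'b set" and y :: "'b \<Rightarrow> 'a" and \<tau> :: "int \<Rightarrow> 'b \<Rightarrow> 'b" and c :: "int \<Rightarrow> 'b \<Rightarrow> complex"
    and \<pi> :: "'a cseq \<Rightarrow> ('b \<Rightarrow> complex) \<Rightarrow> ('b \<Rightarrow> complex)"
  assumes inj_y: "inj_on y B" and B_nonempty: "B \<noteq> {}"
    and tau_in: "k \<in> B \<Longrightarrow> \<tau> n k \<in> B"
    and tau_0: "k \<in> B \<Longrightarrow> \<tau> 0 k = k"
    and tau_add: "k \<in> B \<Longrightarrow> \<tau> (m + n) k = \<tau> n (\<tau> m k)"
    and y_tau: "k \<in> B \<Longrightarrow> y (\<tau> n k) = zpow \<sigma> (- n) (y k)"
    and transitive: "k \<in> B \<Longrightarrow> j \<in> B \<Longrightarrow> \<exists>n. \<tau> n k = j"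
    and cmod_c: "k \<in> B \<Longrightarrow> cmod (c n k) = 1"
    and c_add: "k \<in> B \<Longrightarrow> c (m + n) k = c m k * c n (\<tau> m k)"
    and rep_eq: "\<xi> \<in> ell2 B \<Longrightarrow>
      \<pi> a \<xi> = (\<lambda>k. if k \<in> B then \<Sum>\<^sub>\<infinity>n. apply_bcontfun (a n) (y k) * (c n k * \<xi> (\<tau> n k)) else 0)"
begin

lemma tau_inverse: "k \<in> B \<Longrightarrow> \<tau> n (\<tau> (- n) k) = k" "k \<in> B \<Longrightarrow> \<tau> (- n) (\<tau> n k) = k"
  using tau_add[of k n "- n"] tau_add[of k "- n" n] tau_0[of k] by auto

text \<open>The cocycle law makes \<open>c 0 k\<close> idempotent, and modulus one excludes
  zero.\<close>

lemma c_0: "k \<in> B \<Longrightarrow> c 0 k = 1"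
  using c_add[of k 0 0] cmod_c[of k 0] by (auto simp: tau_0)

lemma c_minus: "k \<in> B \<Longrightarrow> c (- n) (\<tau> n k) = cnj (c n k)"
proof -
  assume k: "k \<in> B"
  have "c n k * c (- n) (\<tau> n k) = 1" using c_add[OF k, of n "- n"] c_0[OF k] by simp
  moreover have "c n k * cnj (c n k) = 1"
    using cmod_c[OF k, of n] by (simp flip: complex_norm_square)
  moreover have "c n k \<noteq> 0" using cmod_c[OF k, of n] by auto
  ultimately show ?thesis by (metis mult_cancel_left)
qed

lemma has_sum_tau:
  assumes "\<xi> \<in> ell2 B"
  shows "((\<lambda>k. (cmod (\<xi> (\<tau> n k)))\<^sup>2) has_sum (ell2_norm B \<xi>)\<^sup>2) B"
proof -
  have "((\<lambda>k. (cmod (\<xi> (\<tau> n k)))\<^sup>2) has_sum (ell2_norm B \<xi>)\<^sup>2) B =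
      ((\<lambda>k. (cmod (\<xi> k))\<^sup>2) has_sum (ell2_norm B \<xi>)\<^sup>2) B"
    by (rule has_sum_reindex_bij_witness[of _ "\<tau> (- n)" "\<tau> n"]) (auto simp: tau_inverse tau_in)
  then show ?thesis using assms by (simp add: ell2_norm_square ell2_def)
qed

lemma norm_rep_term_le:
  assumes "k \<in> B"
  shows "cmod (apply_bcontfun (a n) (y k) * (c n k * \<xi> (\<tau> n k))) \<le> norm (a n) * cmod (\<xi> (\<tau> n k))"
  using assms by (simp add: norm_mult cmod_c mult_right_mono norm_bounded)

lemma rep_term_summable:
  assumes "a \<in> ell1" "\<xi> \<in> ell2 B" "k \<in> B"
  shows "(\<lambda>n. cmod (apply_bcontfun (a n) (y k) * (c n k * \<xi> (\<tau> n k)))) summable_on UNIV"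
proof (rule Infinite_Sum.abs_summable_on_comparison_test')
  show "(\<lambda>n. norm (a n) * ell2_norm B \<xi>) summable_on UNIV"
    using assms(1) by (intro summable_on_cmult_left) (simp add: ell1_def)
  show "cmod (apply_bcontfun (a n) (y k) * (c n k * \<xi> (\<tau> n k))) \<le> norm (a n) * ell2_norm B \<xi>" for n
    by (rule order_trans[OF norm_rep_term_le[OF assms(3)]])
      (intro mult_left_mono cmod_le_ell2_norm assms norm_ge_zero)
qed

text \<open>Cauchy-Schwarz with weights \<open>norm (a n)\<close> bounds
  \<open>|\<pi> a \<xi> k|^2\<close> by \<open>ell1_norm a\<close> times the weighted sum of
  \<open>|\<xi> (\<tau> n k)|^2\<close>. Summing over \<open>k\<close> removes
  \<open>\<tau> n\<close>, a permutation of \<open>B\<close>, and yields the second factor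
  \<open>ell1_norm a\<close>. Finite \<open>F\<close> come first because summability over
  \<open>B\<close> is part of the claim.\<close>

lemma rep_bound:
  assumes a: "a \<in> ell1" and \<xi>: "\<xi> \<in> ell2 B"
  shows "\<pi> a \<xi> \<in> ell2 B" "ell2_norm B (\<pi> a \<xi>) \<le> ell1_norm a * ell2_norm B \<xi>"
proof -
  let ?w = "\<lambda>n. norm (a n)" and ?x = "\<lambda>k n. cmod (\<xi> (\<tau> n k))"
  have w: "?w summable_on UNIV" using a by (simp add: ell1_def)
  note CS = infsum_Cauchy_Schwarz_weighted[OF w, of "?x k" "ell2_norm B \<xi>" for k,
      OF _ _ cmod_le_ell2_norm[OF \<xi>], simplified]
  have F: "(\<Sum>k\<in>F. (cmod (\<pi> a \<xi> k))\<^sup>2) \<le> (ell1_norm a * ell2_norm B \<xi>)\<^sup>2" if F: "finite F" "F \<subseteq> B" for F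
  proof -
    have "(\<Sum>k\<in>F. (cmod (\<pi> a \<xi> k))\<^sup>2) \<le> (\<Sum>k\<in>F. ell1_norm a * (\<Sum>\<^sub>\<infinity>n. ?w n * (?x k n)\<^sup>2))"
    proof (rule sum_mono)
      fix k assume "k \<in> F"
      then have k: "k \<in> B" using F by auto
      have "cmod (\<pi> a \<xi> k) \<le> (\<Sum>\<^sub>\<infinity>n. cmod (apply_bcontfun (a n) (y k) * (c n k * \<xi> (\<tau> n k))))"
        using norm_infsum_bound[OF rep_term_summable[OF a \<xi> k]] k by (simp add: rep_eq[OF \<xi>])
      also have "\<dots> \<le> (\<Sum>\<^sub>\<infinity>n. ?w n * ?x k n)"
        by (intro infsum_mono rep_term_summable[OF a \<xi> k] CS norm_rep_term_le k)
      finally have "(cmod (\<pi> a \<xi> k))\<^sup>2 \<le> (\<Sum>\<^sub>\<infinity>n. ?w n * ?x k n)\<^sup>2" by (intro power_mono) auto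
      also have "\<dots> \<le> ell1_norm a * (\<Sum>\<^sub>\<infinity>n. ?w n * (?x k n)\<^sup>2)"
        unfolding ell1_norm_def by (rule CS)
      finally show "(cmod (\<pi> a \<xi> k))\<^sup>2 \<le> ell1_norm a * (\<Sum>\<^sub>\<infinity>n. ?w n * (?x k n)\<^sup>2)" .
    qed
    also have "\<dots> = ell1_norm a * (\<Sum>k\<in>F. \<Sum>\<^sub>\<infinity>n. ?w n * (?x k n)\<^sup>2)"
      by (simp add: sum_distrib_left)
    also have "\<dots> \<le> ell1_norm a * (ell1_norm a * (ell2_norm B \<xi>)\<^sup>2)"
    proof (rule mult_left_mono[OF _ ell1_norm_nonneg], rule has_sum_mono)
      show "((\<lambda>n. \<Sum>k\<in>F. ?w n * (?x k n)\<^sup>2) has_sum (\<Sum>k\<in>F. \<Sum>\<^sub>\<infinity>n. ?w n * (?x k n)\<^sup>2)) UNIV"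
        using F(1) by (intro has_sum_finite_sum has_sum_infsum CS) auto
      show "((\<lambda>n. ?w n * (ell2_norm B \<xi>)\<^sup>2) has_sum ell1_norm a * (ell2_norm B \<xi>)\<^sup>2) UNIV"
        unfolding ell1_norm_def by (intro has_sum_cmult_left has_sum_infsum w)
      fix n
      have "(\<Sum>k\<in>F. (?x k n)\<^sup>2) \<le> (ell2_norm B \<xi>)\<^sup>2"
        by (rule finite_sum_le_has_sum[OF has_sum_tau[OF \<xi>] F]) auto
      then show "(\<Sum>k\<in>F. ?w n * (?x k n)\<^sup>2) \<le> ?w n * (ell2_norm B \<xi>)\<^sup>2"
        by (simp add: mult_left_mono flip: sum_distrib_left)
    qed
    finally show ?thesis
      by (simp add: power_mult_distrib power2_eq_square mult_ac)
  qed
  have s: "(\<lambda>k. (cmod (\<pi> a \<xi> k))\<^sup>2) summable_on B"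
    by (rule nonneg_bdd_above_summable_on) (auto intro!: bdd_aboveI2[where M = "(ell1_norm a * ell2_norm B \<xi>)\<^sup>2"] F)
  then show "\<pi> a \<xi> \<in> ell2 B" by (auto simp: ell2_def rep_eq[OF \<xi>])
  have "(ell2_norm B (\<pi> a \<xi>))\<^sup>2 \<le> (ell1_norm a * ell2_norm B \<xi>)\<^sup>2"
    unfolding ell2_norm_square by (rule infsum_le_finite_sums[OF s F])
  then show "ell2_norm B (\<pi> a \<xi>) \<le> ell1_norm a * ell2_norm B \<xi>"
    by (rule power2_le_imp_le) (simp add: ell1_norm_nonneg ell2_norm_nonneg)
qed

lemma rep_add_right:
  assumes "a \<in> ell1" "\<xi> \<in> ell2 B" "\<eta> \<in> ell2 B"
  shows "\<pi> a (\<lambda>k. \<xi> k + \<eta> k) = (\<lambda>k. \<pi> a \<xi> k + \<pi> a \<eta> k)"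
  using assms
  by (auto simp: rep_eq ell2_add distrib_left
      intro!: infsum_add Infinite_Sum.abs_summable_summable[OF rep_term_summable])

lemma rep_scale_right:
  assumes "\<xi> \<in> ell2 B"
  shows "\<pi> a (\<lambda>k. s * \<xi> k) = (\<lambda>k. s * \<pi> a \<xi> k)"
  using assms by (auto simp: rep_eq ell2_scale mult.left_commute[of _ s] infsum_cmult_right')

lemma rep_add_left:
  assumes "a \<in> ell1" "b \<in> ell1" "\<xi> \<in> ell2 B"
  shows "\<pi> (\<lambda>n. a n + b n) \<xi> = (\<lambda>k. \<pi> a \<xi> k + \<pi> b \<xi> k)"
  using assms
  by (auto simp: rep_eq distrib_right intro!: infsum_add Infinite_Sum.abs_summable_summable[OF rep_term_summable])

lemma rep_scale_left:
  assumes "\<xi> \<in> ell2 B"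
  shows "\<pi> (\<lambda>n. cf_scale s (a n)) \<xi> = (\<lambda>k. s * \<pi> a \<xi> k)"
  using assms by (auto simp: rep_eq mult.assoc infsum_cmult_right')

lemma rep_mult:
  assumes a: "a \<in> ell1" and b: "b \<in> ell1" and \<xi>: "\<xi> \<in> ell2 B"
  shows "\<pi> (ell1_mult \<sigma> a b) \<xi> = \<pi> a (\<pi> b \<xi>)"
proof
  fix k
  show "\<pi> (ell1_mult \<sigma> a b) \<xi> k = \<pi> a (\<pi> b \<xi>) k"
  proof (cases "k \<in> B")
    case k: True
    \<comment> \<open>Here \<open>m\<close> is the degree taken from \<open>a\<close> and
      \<open>n\<close> the total degree. Summing over \<open>m\<close> first gives the convolution;
      summing over \<open>n = l + m\<close> first splits by the cocycle law into the iterated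
      action.\<close>
    define G where "G m n = apply_bcontfun (a m) (y k) * apply_bcontfun (b (n - m)) (zpow \<sigma> (- m) (y k)) * (c n k * \<xi> (\<tau> n k))" for m n
    have "(\<lambda>p. cmod (case p of (m, n) \<Rightarrow> G m n)) summable_on UNIV \<times> UNIV"
    proof (rule Infinite_Sum.abs_summable_on_comparison_test')
      show "(\<lambda>x. (case x of (k, n) \<Rightarrow> norm (a k) * norm (b (n - k))) * ell2_norm B \<xi>) summable_on UNIV \<times> UNIV"
        by (intro summable_on_cmult_left ell1_convolution_summable a b)
      show "norm (case x of (m, n) \<Rightarrow> G m n) \<le> (case x of (k, n) \<Rightarrow> norm (a k) * norm (b (n - k))) * ell2_norm B \<xi>" for x
        using k by (cases x) (auto simp: G_def norm_mult cmod_c intro!: mult_mono norm_bounded cmod_le_ell2_norm \<xi>)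
    qed
    then have Gs: "(\<lambda>(m, n). G m n) summable_on UNIV \<times> UNIV" by (rule Infinite_Sum.abs_summable_summable)
    have inner: "(\<Sum>\<^sub>\<infinity>n. G m n) = apply_bcontfun (a m) (y k) * (c m k * \<pi> b \<xi> (\<tau> m k))" for m
    proof -
      have "(\<Sum>\<^sub>\<infinity>n. G m n) = (\<Sum>\<^sub>\<infinity>l. apply_bcontfun (a m) (y k) * (c m k *
          (apply_bcontfun (b l) (y (\<tau> m k)) * (c l (\<tau> m k) * \<xi> (\<tau> l (\<tau> m k))))))"
        by (rule infsum_reindex_bij_witness[of _ "\<lambda>l. l + m" "\<lambda>n. n - m"])
          (use k tau_add[OF k, of m] c_add[OF k, of m] in \<open>auto simp: G_def y_tau simp flip: tau_add c_add\<close>)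
      also have "\<dots> = apply_bcontfun (a m) (y k) * (c m k * \<pi> b \<xi> (\<tau> m k))"
        using k by (simp add: rep_eq[OF \<xi>] tau_in infsum_cmult_right')
      finally show ?thesis .
    qed
    have "\<pi> (ell1_mult \<sigma> a b) \<xi> k = (\<Sum>\<^sub>\<infinity>n. \<Sum>\<^sub>\<infinity>m. G m n)"
      using k by (simp add: rep_eq[OF \<xi>] apply_ell1_mult[OF a b] G_def infsum_cmult_left')
    also have "\<dots> = (\<Sum>\<^sub>\<infinity>m. \<Sum>\<^sub>\<infinity>n. G m n)" using infsum_swap_banach[OF Gs] by simp
    also have "\<dots> = \<pi> a (\<pi> b \<xi>) k"
      using k by (simp add: inner rep_eq[OF rep_bound(1)[OF b \<xi>]])
    finally show ?thesis .
  next
    case False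
    then have "\<pi> a' \<eta> k = 0" if "\<eta> \<in> ell2 B" for a' \<eta> using that by (simp add: rep_eq)
    then show ?thesis using \<xi> rep_bound(1)[OF b \<xi>] by metis
  qed
qed

text \<open>Both sides are double series over \<open>B \<times> UNIV\<close>, exchanged by the
  involution \<open>(k, n) \<mapsto> (\<tau> n k, - n)\<close>: \<open>y_tau\<close> matches the
  points of evaluation and \<open>c_minus\<close> the weights.\<close>

lemma rep_star:
  assumes a: "a \<in> ell1" and \<xi>: "\<xi> \<in> ell2 B" and \<eta>: "\<eta> \<in> ell2 B"
  shows "ell2_inner B (\<pi> (ell1_star \<sigma> a) \<xi>) \<eta> = ell2_inner B \<xi> (\<pi> a \<eta>)"
proof -
  define L where "L = (\<lambda>(j, n). \<xi> j * cnj (apply_bcontfun (a n) (y j) * (c n j * \<eta> (\<tau> n j))))"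
  define H where "H = (\<lambda>(k, n). cnj (apply_bcontfun (a (- n)) (zpow \<sigma> (- n) (y k))) * (c n k * \<xi> (\<tau> n k)) * cnj (\<eta> k))"
  have L: "L summable_on B \<times> UNIV"
  proof (rule Infinite_Sum.abs_summable_summable[OF Infinite_Sum.abs_summable_on_comparison_test'])
    \<comment> \<open>A product of two moduli is replaced by the sum of their squares, whose sum
      over \<open>j\<close> does not depend on \<open>n\<close> because \<open>\<tau> n\<close>
      permutes \<open>B\<close>.\<close>
    have "(\<lambda>(n, j). norm (a n) * ((cmod (\<xi> j))\<^sup>2 + (cmod (\<eta> (\<tau> n j)))\<^sup>2)) summable_on UNIV \<times> B"
    proof (rule summable_on_SigmaI)
      have "((\<lambda>j. (cmod (\<xi> j))\<^sup>2) has_sum (ell2_norm B \<xi>)\<^sup>2) B"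
        using \<xi> by (simp add: ell2_norm_square ell2_def)
      then show "((\<lambda>j. case (n, j) of (n, j) \<Rightarrow> norm (a n) * ((cmod (\<xi> j))\<^sup>2 + (cmod (\<eta> (\<tau> n j)))\<^sup>2))
          has_sum norm (a n) * ((ell2_norm B \<xi>)\<^sup>2 + (ell2_norm B \<eta>)\<^sup>2)) B" for n
        by (auto intro!: has_sum_cmult_right has_sum_add has_sum_tau \<eta>)
      show "(\<lambda>n. norm (a n) * ((ell2_norm B \<xi>)\<^sup>2 + (ell2_norm B \<eta>)\<^sup>2)) summable_on UNIV"
        using a by (intro summable_on_cmult_left) (simp add: ell1_def)
    qed auto
    then show "(\<lambda>(j, n). norm (a n) * ((cmod (\<xi> j))\<^sup>2 + (cmod (\<eta> (\<tau> n j)))\<^sup>2)) summable_on B \<times> UNIV"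
      by (subst (asm) summable_on_swap) simp
    fix p assume "p \<in> B \<times> (UNIV :: int set)"
    then obtain j n where p: "p = (j, n)" "j \<in> B" by auto
    have "cmod (L p) = cmod (apply_bcontfun (a n) (y j)) * (cmod (\<xi> j) * cmod (\<eta> (\<tau> n j)))"
      using p by (simp add: L_def norm_mult cmod_c)
    also have "\<dots> \<le> norm (a n) * ((cmod (\<xi> j))\<^sup>2 + (cmod (\<eta> (\<tau> n j)))\<^sup>2)"
    proof (rule mult_mono)
      have "0 \<le> cmod (\<xi> j) * cmod (\<eta> (\<tau> n j))" by simp
      then show "cmod (\<xi> j) * cmod (\<eta> (\<tau> n j)) \<le> (cmod (\<xi> j))\<^sup>2 + (cmod (\<eta> (\<tau> n j)))\<^sup>2"
        using sum_squares_bound[of "cmod (\<xi> j)" "cmod (\<eta> (\<tau> n j))"] by linarith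
    qed (auto intro: norm_bounded)
    finally show "cmod (L p) \<le> (case p of (j, n) \<Rightarrow> norm (a n) * ((cmod (\<xi> j))\<^sup>2 + (cmod (\<eta> (\<tau> n j)))\<^sup>2))"
      using p by simp
  qed
  have re: "i \<in> B \<times> UNIV \<Longrightarrow> (case i of (k, n) \<Rightarrow> (\<tau> n k, - n)) \<in> B \<times> (UNIV :: int set)"
    "i \<in> B \<times> UNIV \<Longrightarrow> (case (case i of (k, n) \<Rightarrow> (\<tau> n k, - n)) of (k, n) \<Rightarrow> (\<tau> n k, - n)) = i"
    "i \<in> B \<times> UNIV \<Longrightarrow> L (case i of (k, n) \<Rightarrow> (\<tau> n k, - n)) = H i" for i
    by (auto simp: tau_in tau_inverse L_def H_def c_minus y_tau)
  have H: "H summable_on B \<times> UNIV"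
    using L by (subst summable_on_reindex_bij_witness[where h = L and T = "B \<times> UNIV"
          and i = "\<lambda>(k, n). (\<tau> n k, - n)" and j = "\<lambda>(k, n). (\<tau> n k, - n)"]) (use re in auto)
  have "ell2_inner B (\<pi> (ell1_star \<sigma> a) \<xi>) \<eta> = (\<Sum>\<^sub>\<infinity>k\<in>B. \<Sum>\<^sub>\<infinity>n. H (k, n))"
    unfolding ell2_inner_def H_def
    by (rule infsum_cong) (simp add: rep_eq[OF \<xi>] apply_ell1_star infsum_cmult_left')
  also have "\<dots> = infsum H (B \<times> UNIV)" using infsum_Sigma_banach[OF H] by simp
  also have "\<dots> = infsum L (B \<times> UNIV)"
    by (rule infsum_reindex_bij_witness[where i = "\<lambda>(k, n). (\<tau> n k, - n)" and j = "\<lambda>(k, n). (\<tau> n k, - n)"])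
      (use re in auto)
  also have "\<dots> = (\<Sum>\<^sub>\<infinity>k\<in>B. \<Sum>\<^sub>\<infinity>n. L (k, n))" using infsum_Sigma_banach[OF L] by simp
  also have "\<dots> = ell2_inner B \<xi> (\<pi> a \<eta>)"
    unfolding ell2_inner_def L_def
    by (rule infsum_cong) (simp add: rep_eq[OF \<eta>] infsum_cmult_right' del: complex_cnj_mult)
  finally show ?thesis .
qed

lemma rep_monomial:
  assumes "\<xi> \<in> ell2 B"
  shows "\<pi> (monomial f m) \<xi> = (\<lambda>k. if k \<in> B then apply_bcontfun f (y k) * (c m k * \<xi> (\<tau> m k)) else 0)"
proof -
  have *: "(\<Sum>\<^sub>\<infinity>n. apply_bcontfun (monomial f m n) (y k) * (c n k * \<xi> (\<tau> n k))) =
      apply_bcontfun f (y k) * (c m k * \<xi> (\<tau> m k))" for k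
    by (subst infsum_single[of _ m]) (auto simp: monomial_apply)
  show ?thesis unfolding rep_eq[OF assms] * ..
qed

lemma rep_embed:
  assumes "\<xi> \<in> ell2 B"
  shows "\<pi> (embed f) \<xi> = (\<lambda>k. apply_bcontfun f (y k) * \<xi> k)"
  using assms by (auto simp: embed_eq_monomial rep_monomial c_0 tau_0 ell2_def)

lemma rep_monomial_basis:
  assumes "j \<in> B"
  shows "\<pi> (monomial (const_bcontfun 1) m) (basis_vec (\<tau> m j)) = (\<lambda>k. c m j * basis_vec j k)"
proof -
  have "\<tau> m k = \<tau> m j \<longleftrightarrow> k = j" if "k \<in> B" for k
    using tau_inverse(2)[of k m] tau_inverse(2)[of j m] that assms by metis
  then show ?thesis
    unfolding rep_monomial[OF ell2_basis_vec[OF tau_in[OF assms]]] using assms by (auto simp: basis_vec_def)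
qed

lemma unital_involutive_rep: "unital_involutive_rep \<sigma> B \<pi>"
proof -
  have "ell2_operator B (\<pi> a)" if "a \<in> ell1" for a
    unfolding ell2_operator_def using that
    by (intro conjI ballI allI exI[of _ "ell1_norm a"] rep_bound rep_add_right rep_scale_right)
  then show ?thesis
    unfolding unital_involutive_rep_def
    by (simp add: rep_add_left rep_scale_left rep_mult rep_star ell1_one_def rep_embed)
qed

text \<open>Distinct indices carry distinct points, so functions can isolate one nonzero coordinate
  of a vector in an invariant closed subspace. Monomials then carry that basis vector to all others
  by transitivity.\<close>

lemma top_irreducible: "top_irreducible B \<pi>"
  unfolding top_irreducible_def
proof (intro conjI allI impI B_nonempty)
  fix K assume "closed_subspace B K \<and> (\<forall>a\<in>ell1. \<forall>\<xi>\<in>K. \<pi> a \<xi> \<in> K)"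
  then have zero: "(\<lambda>k. 0) \<in> K" and add: "\<And>\<xi> \<eta>. \<xi> \<in> K \<Longrightarrow> \<eta> \<in> K \<Longrightarrow> (\<lambda>k. \<xi> k + \<eta> k) \<in> K"
    and scale: "\<And>s \<xi>. \<xi> \<in> K \<Longrightarrow> (\<lambda>k. s * \<xi> k) \<in> K" and cl: "closedin (ell2_topology B) K"
    and inv: "\<And>a \<xi>. a \<in> ell1 \<Longrightarrow> \<xi> \<in> K \<Longrightarrow> \<pi> a \<xi> \<in> K"
    by (auto simp: closed_subspace_def)
  have sub: "K \<subseteq> ell2 B"
    using closedin_subset[OF cl] by (simp add: ell2_topology_def Metric_space.topspace_mtopology[OF Metric_space_ell2])
  show "K = {\<lambda>k. 0} \<or> K = ell2 B"
  proof (cases "K \<subseteq> {\<lambda>k. 0}")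
    case False
    then obtain \<xi> k where \<xi>: "\<xi> \<in> K" "\<xi> k \<noteq> 0" by (auto simp: fun_eq_iff)
    have \<xi>2: "\<xi> \<in> ell2 B" using \<xi> sub by auto
    with \<xi>(2) have k: "k \<in> B" by (auto simp: ell2_def)
    have "(\<lambda>i. \<xi> k * basis_vec k i) \<in> K"
    proof (rule closedin_ell2_topologyD[OF cl])
      show "(\<lambda>i. \<xi> k * basis_vec k i) \<in> ell2 B" by (intro ell2_scale ell2_basis_vec k)
      fix e :: real assume "0 < e"
      then obtain F where F: "finite F" "F \<subseteq> B"
        "\<And>\<eta>. (\<And>k. k \<in> B \<Longrightarrow> cmod (\<eta> k) \<le> cmod (\<xi> k)) \<Longrightarrow> (\<And>k. k \<in> F \<Longrightarrow> \<eta> k = 0) \<Longrightarrow> ell2_norm B \<eta> < e"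
        using ell2_tail[OF \<xi>2] by metis
      have "y k \<notin> y ` (F - {k})" using inj_y k F(2) by (auto simp: inj_on_def)
      then obtain f where f: "apply_bcontfun f (y k) = 1" "\<And>z. z \<in> y ` (F - {k}) \<Longrightarrow> apply_bcontfun f z = 0"
        "\<And>z. cmod (apply_bcontfun f z) \<le> 1"
        using separating_function[of "y ` (F - {k})" "y k"] F(1) by auto
      \<comment> \<open>The difference vanishes at \<open>k\<close> and on the rest of
        \<open>F\<close>; elsewhere \<open>|f| \<le> 1\<close> keeps it below
        \<open>|\<xi>|\<close>, so only the tail of \<open>\<xi>\<close> counts.\<close>
      have "ell2_norm B (\<lambda>i. \<xi> k * basis_vec k i - \<pi> (embed f) \<xi> i) < e"
      proof (rule F(3))
        show "cmod (\<xi> k * basis_vec k i - \<pi> (embed f) \<xi> i) \<le> cmod (\<xi> i)" for i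
          using f(1) f(3)[of "y i"] by (auto simp: rep_embed[OF \<xi>2] basis_vec_def norm_mult mult_left_le_one_le)
        show "\<xi> k * basis_vec k i - \<pi> (embed f) \<xi> i = 0" if "i \<in> F" for i
          using f(1) f(2)[of "y i"] that by (auto simp: rep_embed[OF \<xi>2] basis_vec_def)
      qed
      then show "\<exists>\<eta>\<in>K. ell2_norm B (\<lambda>i. \<xi> k * basis_vec k i - \<eta> i) < e"
        using inv[OF embed_in_ell1 \<xi>(1)] by blast
    qed
    from scale[OF this, of "1 / \<xi> k"] \<xi>(2) have ek: "basis_vec k \<in> K" by simp
    have ej: "basis_vec j \<in> K" if j: "j \<in> B" for j
    proof -
      obtain m where m: "\<tau> m j = k" using transitive[OF j k] by auto
      have "c m j \<noteq> 0" using cmod_c[OF j, of m] by auto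
      moreover have "(\<lambda>i. c m j * basis_vec j i) \<in> K"
        using inv[OF monomial_in_ell1 ek] rep_monomial_basis[OF j, of m] m by metis
      ultimately show ?thesis using scale[of "\<lambda>i. c m j * basis_vec j i" "1 / c m j"] by simp
    qed
    have "ell2 B \<subseteq> K"
      using closedin_ell2_topologyD[OF cl] ell2_span_basis_dense[OF zero add scale ej] by blast
    with sub show ?thesis by auto
  qed (use zero in auto)
qed

end

section \<open>Pure states\<close>

lemma nonneg_quadratic_imp_zero:
  fixes z :: complex
  assumes "\<And>t::real. of_real t * z + of_real (t\<^sup>2) \<in> \<real>\<^sub>\<ge>\<^sub>0"
  shows "z = 0"
proof -
  have "Im z = 0" using assms[of 1] by (simp add: complex_nonneg_Reals_iff)
  \<comment> \<open>Minimising over \<open>t\<close> leaves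
    \<open>- (Re z)\<^sup>2 / 4\<close>.\<close>
  moreover have "0 \<le> (- Re z / 2) * Re z + (- Re z / 2)\<^sup>2"
    using assms[of "- Re z / 2"] by (simp add: complex_nonneg_Reals_iff)
  then have "(Re z)\<^sup>2 \<le> 0" by (simp add: power2_eq_square field_simps)
  then have "Re z = 0" by simp
  ultimately show ?thesis by (simp add: complex_eq_iff)
qed

text \<open>Polarisation: real \<open>s\<close> yields \<open>A + B = 0\<close>, and purely
  imaginary \<open>s\<close> yields \<open>A = B\<close>.\<close>

lemma nonneg_sesquilinear_imp_zero:
  fixes A B :: complex
  assumes "\<And>s. s * A + (cnj s * B + s * cnj s) \<in> \<real>\<^sub>\<ge>\<^sub>0"
  shows "A = 0" "B = 0"
proof -
  have "A + B = 0"
  proof (rule nonneg_quadratic_imp_zero)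
    show "of_real t * (A + B) + of_real (t\<^sup>2) \<in> \<real>\<^sub>\<ge>\<^sub>0" for t :: real
      using assms[of "of_real t"] by (simp add: algebra_simps power2_eq_square)
  qed
  moreover have "\<i> * A - \<i> * B = 0"
  proof (rule nonneg_quadratic_imp_zero)
    show "of_real t * (\<i> * A - \<i> * B) + of_real (t\<^sup>2) \<in> \<real>\<^sub>\<ge>\<^sub>0" for t :: real
      using assms[of "\<i> * of_real t"] by (simp add: algebra_simps power2_eq_square)
  qed
  then have "A = B" by simp
  ultimately show "A = 0" "B = 0" by auto
qed

text \<open>Multiplication by \<open>cnj u\<close> rotates \<open>u\<close> to 1. Two real parts at
  most 1 with weighted mean 1 both equal 1, and the modulus bound then leaves no imaginary
  part.\<close>

lemma unit_circle_extreme: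
  fixes u v w :: complex
  assumes u: "cmod u = 1" and v: "cmod v \<le> 1" and w: "cmod w \<le> 1" and t: "0 < t" "t < 1"
    and eq: "u = of_real t * v + of_real (1 - t) * w"
  shows "v = u"
proof -
  have Re_of_real_mult: "Re (complex_of_real r * z) = r * Re z" for r z by simp
  have uu: "u * cnj u = 1" using u by (simp flip: complex_norm_square)
  have "1 = u * cnj u" by (simp add: uu)
  also have "\<dots> = of_real t * (v * cnj u) + of_real (1 - t) * (w * cnj u)"
    by (subst eq) (simp add: algebra_simps)
  finally have "Re 1 = Re (of_real t * (v * cnj u) + of_real (1 - t) * (w * cnj u))" by (rule arg_cong)
  then have 1: "1 = t * Re (v * cnj u) + (1 - t) * Re (w * cnj u)"
    by (simp only: Re_of_real_mult plus_complex.sel one_complex.sel)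
  have cv: "cmod (v * cnj u) \<le> 1" and "cmod (w * cnj u) \<le> 1" using u v w by (auto simp: norm_mult)
  then have Re: "Re (v * cnj u) \<le> 1" "Re (w * cnj u) \<le> 1" using complex_Re_le_cmod order_trans by blast+
  define x y where "x = Re (v * cnj u)" and "y = Re (w * cnj u)"
  have xy: "x \<le> 1" "y \<le> 1" "1 = t * x + (1 - t) * y" using Re 1 by (simp_all only: x_def y_def)
  have "(1 - t) * y \<le> (1 - t) * 1" using xy(2) t by (intro mult_left_mono) auto
  with xy(3) have "t * 1 \<le> t * x" unfolding left_diff_distrib by linarith
  with t xy(1) have r1: "Re (v * cnj u) = 1" unfolding x_def[symmetric] by simp
  have "(Re (v * cnj u))\<^sup>2 + (Im (v * cnj u))\<^sup>2 \<le> 1"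
    using cv by (metis cmod_power2 norm_ge_zero power_le_one)
  then have "Im (v * cnj u) = 0" unfolding r1 by simp
  with r1 have "v * cnj u = u * cnj u" unfolding uu complex_eq_iff by (simp only: one_complex.sel)
  then show ?thesis using u by auto
qed

lemma stateD:
  assumes "state \<sigma> \<phi>"
  shows "a \<in> ell1 \<Longrightarrow> b \<in> ell1 \<Longrightarrow> \<phi> (\<lambda>n. a n + b n) = \<phi> a + \<phi> b"
    "a \<in> ell1 \<Longrightarrow> \<phi> (\<lambda>n. cf_scale s (a n)) = s * \<phi> a"
    "a \<in> ell1 \<Longrightarrow> cmod (\<phi> a) \<le> ell1_norm a"
    "a \<in> ell1 \<Longrightarrow> \<phi> (ell1_mult \<sigma> (ell1_star \<sigma> a) a) \<in> \<real>\<^sub>\<ge>\<^sub>0"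
    "\<phi> ell1_one = 1"
  using assms by (auto simp: state_def)

text \<open>States are contractive for the \<open>ell1\<close> norm, and finite sums of monomials
  are dense.\<close>

lemma state_eqI:
  fixes a :: "'a::topological_space cseq"
  assumes \<phi>: "state \<sigma> \<phi>" and \<psi>: "state \<sigma> \<psi>" and eq: "\<And>f n. \<phi> (monomial f n) = \<psi> (monomial f n)"
    and a: "a \<in> ell1"
  shows "\<phi> a = \<psi> a"
proof -
  have "cmod (\<phi> a - \<psi> a) \<le> 0 + e" if "0 < e" for e
  proof -
    obtain F where F: "finite F"
      "\<And>b :: 'a cseq. (\<And>n. norm (b n) \<le> norm (a n)) \<Longrightarrow> (\<And>n. n \<in> F \<Longrightarrow> b n = 0) \<Longrightarrow> ell1_norm b < e / 2"
      using ell1_tail[OF a, of "e / 2"] \<open>0 < e\<close> by auto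
    define b r where "b = (\<lambda>n. if n \<in> F then a n else 0)" and "r = (\<lambda>n. if n \<in> F then 0 else a n)"
    have "b \<in> ell1 \<and> \<phi> b = \<psi> b"
      unfolding b_def using F(1)
    proof (induction F rule: finite_induct)
      case empty
      show ?case using stateD(2)[OF \<phi> a, of 0] stateD(2)[OF \<psi> a, of 0]
        by (auto simp: cf_scale_def Bcontfun_inverse const_bcontfun simp flip: zero_bcontfun_def)
    next
      case (insert m F)
      have "(\<lambda>n. if n \<in> insert m F then a n else 0) = (\<lambda>n. monomial (a m) m n + (if n \<in> F then a n else 0))"
        using insert.hyps by (auto simp: monomial_apply)
      then show ?case
        using insert.IH stateD(1)[OF \<phi>, of "monomial (a m) m"] stateD(1)[OF \<psi>, of "monomial (a m) m"] eq
        by (simp add: ell1_add)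
    qed
    moreover have r: "r \<in> ell1" by (rule ell1_dominated[OF a, where C = 1]) (simp add: r_def)
    moreover have "a = (\<lambda>n. b n + r n)" by (auto simp: b_def r_def)
    ultimately have "\<phi> a - \<psi> a = \<phi> r - \<psi> r"
      using stateD(1)[OF \<phi>, of b r] stateD(1)[OF \<psi>, of b r] by simp
    moreover have "ell1_norm r < e / 2" by (rule F(2)) (auto simp: r_def)
    moreover have "cmod (\<phi> r - \<psi> r) \<le> cmod (\<phi> r) + cmod (\<psi> r)" by (rule norm_triangle_ineq4)
    ultimately show ?thesis using stateD(3)[OF \<phi> r] stateD(3)[OF \<psi> r] by simp
  qed
  then have "cmod (\<phi> a - \<psi> a) \<le> 0" by (rule field_le_epsilon)
  then show ?thesis by simp
qed

context dynamics
begin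

section \<open>Positivity of states on monomials\<close>

lemma ell1_mult_add_left:
  fixes a b d :: "'a cseq"
  assumes "a \<in> ell1" "b \<in> ell1" "d \<in> ell1"
  shows "ell1_mult \<sigma> (\<lambda>n. a n + b n) d = (\<lambda>n. ell1_mult \<sigma> a d n + ell1_mult \<sigma> b d n)"
proof
  fix n
  have "cf_mult (a k + b k) h = cf_mult (a k) h + cf_mult (b k) h" for k h
    by (rule bcontfun_eqI) (simp add: distrib_right)
  then show "ell1_mult \<sigma> (\<lambda>n. a n + b n) d n = ell1_mult \<sigma> a d n + ell1_mult \<sigma> b d n"
    unfolding ell1_mult_def
    using infsum_add[OF bcontfun_has_sum(1)[OF convolution_term_summable[OF assms(1,3)]]
        bcontfun_has_sum(1)[OF convolution_term_summable[OF assms(2,3)]]] by simp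
qed

lemma ell1_star_mult_embed:
  "ell1_mult \<sigma> (ell1_star \<sigma> (embed g)) (embed g) = embed (cf_mult (cf_cnj g) g)"
proof -
  have "ell1_star \<sigma> (embed g) = embed (cf_cnj g)"
    by (rule ext) (auto simp: ell1_star_def embed_def apply_zpow_alpha intro!: bcontfun_eqI)
  then show ?thesis by (simp add: ell1_mult_embed)
qed

text \<open>
  Expanding the positivity of the state on \<open>(g + s\<delta>\<^sup>n)\<^sup>*(g + s\<delta>\<^sup>n)\<close> for all complex \<open>s\<close>
  replaces the Cauchy-Schwarz inequality.
\<close>

lemma state_monomial_eq_zero:
  assumes \<phi>: "state \<sigma> \<phi>" and zero: "\<phi> (embed (cf_mult (cf_cnj g) g)) = 0"
  shows "\<phi> (monomial (cf_cnj g) n) = 0" "\<phi> (monomial (zpow (alpha \<sigma>) (- n) g) (- n)) = 0"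
proof -
  define A where "A = \<phi> (monomial (cf_cnj g) n)"
  define B where "B = \<phi> (monomial (zpow (alpha \<sigma>) (- n) g) (- n))"
  have "s * A + (cnj s * B + s * cnj s) \<in> \<real>\<^sub>\<ge>\<^sub>0" for s
  proof -
    let ?s = "const_bcontfun s :: 'a \<Rightarrow>\<^sub>C complex" and ?t = "const_bcontfun (cnj s) :: 'a \<Rightarrow>\<^sub>C complex"
    define u where "u = (\<lambda>k. embed g k + monomial ?s n k)"
    have u: "u \<in> ell1" by (simp add: u_def ell1_add)
    have star: "ell1_star \<sigma> u = (\<lambda>k. monomial (cf_cnj g) 0 k + monomial ?t (- n) k)"
      by (rule ext, rule bcontfun_eqI) (auto simp: apply_ell1_star u_def embed_eq_monomial monomial_apply)
    have "ell1_mult \<sigma> (ell1_star \<sigma> u) u = (\<lambda>k. embed (cf_mult (cf_cnj g) g) k +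
        (cf_scale s (monomial (cf_cnj g) n k) +
          (cf_scale (cnj s) (monomial (zpow (alpha \<sigma>) (- n) g) (- n) k) + cf_scale (s * cnj s) (ell1_one k))))"
      unfolding star ell1_mult_add_left[OF monomial_in_ell1 monomial_in_ell1 u]
      by (auto simp: ell1_mult_monomial_left apply_zpow_alpha u_def embed_eq_monomial ell1_one_def
          monomial_apply algebra_simps intro!: bcontfun_eqI)
    then have "\<phi> (ell1_mult \<sigma> (ell1_star \<sigma> u) u) = s * A + (cnj s * B + s * cnj s)"
      using zero by (simp add: stateD(1,2)[OF \<phi>] ell1_add ell1_scale A_def B_def ell1_one_def
          stateD(5)[OF \<phi>, unfolded ell1_one_def])
    with stateD(4)[OF \<phi> u] show ?thesis by simp
  qed
  from nonneg_sesquilinear_imp_zero[OF this]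
  show "\<phi> (monomial (cf_cnj g) n) = 0" "\<phi> (monomial (zpow (alpha \<sigma>) (- n) g) (- n)) = 0"
    by (simp_all add: A_def B_def)
qed

end

context orbit_rep
begin

section \<open>Vector states and their purity\<close>

lemma ell2_inner_basis_vec:
  assumes "p \<in> B"
  shows "ell2_inner B \<xi> (basis_vec p) = \<xi> p"
  unfolding ell2_inner_def using assms by (subst infsum_single[of _ p]) (auto simp: basis_vec_def)

lemma ell2_inner_self: "ell2_inner B \<xi> \<xi> \<in> \<real>\<^sub>\<ge>\<^sub>0"
proof -
  have "ell2_inner B \<xi> \<xi> = (\<Sum>\<^sub>\<infinity>k\<in>B. of_real ((cmod (\<xi> k))\<^sup>2))"
    unfolding ell2_inner_def complex_norm_square ..
  also have "\<dots> \<in> \<real>\<^sub>\<ge>\<^sub>0"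
  \<comment> \<open>If the series diverges, its sum is the default value 0, which is nonnegative as
    well.\<close>
  proof (cases "(\<lambda>k. complex_of_real ((cmod (\<xi> k))\<^sup>2)) summable_on B")
    case True
    then show ?thesis
      by (auto simp: complex_nonneg_Reals_iff infsum_nonneg simp flip: infsum_Re infsum_Im simp del: of_real_power)
  qed (simp add: infsum_not_exists)
  finally show ?thesis .
qed

lemma cyclic_basis_vec:
  assumes p: "p \<in> B"
  shows "ell2_topology B closure_of {\<pi> a (basis_vec p) | a. a \<in> ell1} = ell2 B"
proof -
  define K where "K = {\<pi> a (basis_vec p) | a. a \<in> ell1}"
  note e = ell2_basis_vec[OF p]
  have zero: "(\<lambda>k. 0) \<in> K"
    using rep_scale_left[OF e, of 0 "\<lambda>n. 0"] ell1_scale[OF ell1_zero, of 0] by (force simp: K_def)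
  have add: "(\<lambda>k. \<xi> k + \<eta> k) \<in> K" if "\<xi> \<in> K" "\<eta> \<in> K" for \<xi> \<eta>
    using that rep_add_left[OF _ _ e, symmetric] ell1_add by (force simp: K_def)
  have scale: "(\<lambda>k. s * \<xi> k) \<in> K" if "\<xi> \<in> K" for s \<xi>
    using that rep_scale_left[OF e, symmetric] ell1_scale by (force simp: K_def)
  have basis: "basis_vec j \<in> K" if j: "j \<in> B" for j
  proof -
    obtain m where m: "\<tau> m j = p" using transitive[OF j p] by auto
    have "c m j \<noteq> 0" using cmod_c[OF j, of m] by auto
    moreover have "(\<lambda>i. c m j * basis_vec j i) \<in> K"
      using rep_monomial_basis[OF j, of m] m monomial_in_ell1 unfolding K_def mem_Collect_eq by metis
    ultimately show ?thesis using scale[of "\<lambda>i. c m j * basis_vec j i" "1 / c m j"] by simp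
  qed
  have sub: "K \<subseteq> ell2 B" using rep_bound(1) e by (auto simp: K_def)
  have "ell2_topology B closure_of K = ell2 B"
    unfolding ell2_topology_def Metric_space.metric_closure_of[OF Metric_space_ell2]
  proof (intro subset_antisym subsetI CollectI conjI allI impI)
    fix \<xi> and r :: real assume \<xi>: "\<xi> \<in> ell2 B" and "0 < r"
    then obtain \<eta> where "\<eta> \<in> K" "ell2_norm B (\<lambda>k. \<xi> k - \<eta> k) < r"
      using ell2_span_basis_dense[OF zero add scale basis] by metis
    then show "\<exists>\<eta>\<in>K. \<eta> \<in> Metric_space.mball (ell2 B) (\<lambda>\<xi> \<eta>. ell2_norm B (\<lambda>k. \<xi> k - \<eta> k)) \<xi> r"
      using \<xi> sub by (auto simp: Metric_space.in_mball[OF Metric_space_ell2])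
  qed auto
  then show ?thesis by (simp add: K_def)
qed

definition vector_state :: "'b \<Rightarrow> 'a cseq \<Rightarrow> complex" where
  "vector_state p a = ell2_inner B (\<pi> a (basis_vec p)) (basis_vec p)"

lemma vector_state_monomial:
  assumes "p \<in> B"
  shows "vector_state p (monomial f n) = apply_bcontfun f (y p) * (if \<tau> n p = p then c n p else 0)"
  using assms by (simp add: vector_state_def ell2_inner_basis_vec rep_monomial ell2_basis_vec basis_vec_apply)

lemma vector_state_embed:
  assumes "p \<in> B"
  shows "vector_state p (embed f) = apply_bcontfun f (y p)"
  using assms by (simp add: embed_eq_monomial vector_state_monomial tau_0 c_0)

lemma state_vector_state:
  assumes p: "p \<in> B"
  shows "state \<sigma> (vector_state p)"
proof -
  note e = ell2_basis_vec[OF p]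
  have "cmod (vector_state p a) \<le> ell1_norm a" if a: "a \<in> ell1" for a
  proof -
    have "ell2_norm B (basis_vec p) = 1"
      unfolding ell2_norm_def using p by (subst infsum_single[of _ p]) (auto simp: basis_vec_def)
    then show ?thesis
      using cmod_le_ell2_norm[OF rep_bound(1)[OF a e], of p] rep_bound(2)[OF a e]
      by (simp add: vector_state_def ell2_inner_basis_vec[OF p])
  qed
  moreover have "vector_state p (ell1_mult \<sigma> (ell1_star \<sigma> a) a) \<in> \<real>\<^sub>\<ge>\<^sub>0" if a: "a \<in> ell1" for a
    using a e ell2_inner_self by (simp add: vector_state_def rep_mult ell1_star_in_ell1 rep_star rep_bound)
  moreover have "vector_state p ell1_one = 1"
    by (simp add: ell1_one_def vector_state_embed[OF p])
  ultimately show ?thesis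
    using e by (simp add: state_def vector_state_def rep_add_left rep_scale_left ell2_inner_basis_vec[OF p])
qed

lemma convex_component_vector_state:
  assumes p: "p \<in> B" and \<psi>: "state \<sigma> \<psi>\<^sub>1" "state \<sigma> \<psi>\<^sub>2" and t: "0 < t" "t < 1"
    and eq: "\<And>a. a \<in> ell1 \<Longrightarrow>
      vector_state p a = complex_of_real t * \<psi>\<^sub>1 a + complex_of_real (1 - t) * \<psi>\<^sub>2 a"
    and a: "a \<in> ell1"
  shows "\<psi>\<^sub>1 a = vector_state p a"
proof (rule state_eqI[OF \<psi>(1) state_vector_state[OF p] _ a])
  fix f n
  \<comment> \<open>Both components are nonnegative here and a combination of them with positive
    weights is zero, so each vanishes.\<close>
  have null: "\<psi>\<^sub>1 (embed (cf_mult (cf_cnj g) g)) = 0" if "apply_bcontfun g (y p) = 0" for g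
  proof -
    let ?h = "embed (cf_mult (cf_cnj g) g)"
    have "complex_of_real t * \<psi>\<^sub>1 ?h + complex_of_real (1 - t) * \<psi>\<^sub>2 ?h = 0"
      unfolding eq[OF embed_in_ell1, symmetric] using that by (simp add: vector_state_embed[OF p])
    moreover have "\<psi>\<^sub>1 ?h \<in> \<real>\<^sub>\<ge>\<^sub>0" "\<psi>\<^sub>2 ?h \<in> \<real>\<^sub>\<ge>\<^sub>0"
      using stateD(4)[OF \<psi>(1) embed_in_ell1] stateD(4)[OF \<psi>(2) embed_in_ell1] ell1_star_mult_embed by metis+
    then obtain r1 r2 where r: "\<psi>\<^sub>1 ?h = of_real r1" "\<psi>\<^sub>2 ?h = of_real r2" "0 \<le> r1" "0 \<le> r2"
      by (auto simp: nonneg_Reals_def)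
    ultimately have "complex_of_real (t * r1 + (1 - t) * r2) = 0" by simp
    then have "t * r1 + (1 - t) * r2 = 0" using of_real_eq_0_iff by blast
    moreover have "0 \<le> t * r1" "0 \<le> (1 - t) * r2" using r t by auto
    ultimately have "t * r1 = 0" by linarith
    then show ?thesis using r t by simp
  qed
  let ?one = "const_bcontfun 1 :: 'a \<Rightarrow>\<^sub>C complex"
  have coeff: "\<psi>\<^sub>1 (monomial h n) = apply_bcontfun h (y p) * \<psi>\<^sub>1 (monomial ?one n)" for h
  proof -
    \<comment> \<open>The conjugate is taken because positivity annihilates the monomial of
      \<open>cf_cnj g\<close>, which is then \<open>h\<close> minus its value at
      \<open>y p\<close>.\<close>
    define g where "g = cf_cnj (h - const_bcontfun (apply_bcontfun h (y p)))"
    have "\<psi>\<^sub>1 (monomial (cf_cnj g) n) = 0"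
      by (rule state_monomial_eq_zero[OF \<psi>(1) null]) (simp add: g_def)
    moreover have "monomial h n = (\<lambda>m. monomial (cf_cnj g) n m + cf_scale (apply_bcontfun h (y p)) (monomial ?one n m))"
      by (auto simp: monomial_apply g_def intro!: bcontfun_eqI)
    ultimately show ?thesis by (simp add: stateD(1,2)[OF \<psi>(1)] ell1_scale)
  qed
  have "\<psi>\<^sub>1 (monomial ?one n) = (if \<tau> n p = p then c n p else 0)"
  proof (cases "\<tau> n p = p")
    case True
    have "norm ?one \<le> 1" by (rule norm_bound) simp
    then have "cmod (\<psi>\<^sub>1 (monomial ?one n)) \<le> 1" "cmod (\<psi>\<^sub>2 (monomial ?one n)) \<le> 1"
      using stateD(3)[OF \<psi>(1) monomial_in_ell1, of ?one n] stateD(3)[OF \<psi>(2) monomial_in_ell1, of ?one n] by auto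
    moreover have "c n p = complex_of_real t * \<psi>\<^sub>1 (monomial ?one n) + complex_of_real (1 - t) * \<psi>\<^sub>2 (monomial ?one n)"
      unfolding eq[OF monomial_in_ell1, symmetric] using True by (simp add: vector_state_monomial[OF p])
    ultimately have "\<psi>\<^sub>1 (monomial ?one n) = c n p"
      by (intro unit_circle_extreme[OF cmod_c[OF p] _ _ t])
    with True show ?thesis by simp
  next
    case False
    then have neq: "y (\<tau> n p) \<noteq> y p" using inj_y p tau_in[OF p, of n] by (auto simp: inj_on_def)
    obtain g :: "'a \<Rightarrow>\<^sub>C complex" where g: "apply_bcontfun g (y (\<tau> n p)) = 1" "apply_bcontfun g (y p) = 0"
      by (rule separating_function[of "{y p}" "y (\<tau> n p)"]) (use neq in auto)
    \<comment> \<open>At \<open>y p\<close> the translated function takes the value of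
      \<open>g\<close> at \<open>y (\<tau> n p)\<close>, namely 1, so by \<open>coeff\<close> the
      state vanishes on \<open>\<delta>^n\<close> itself.\<close>
    have "\<psi>\<^sub>1 (monomial (zpow (alpha \<sigma>) n g) n) = 0"
      using state_monomial_eq_zero(2)[OF \<psi>(1) null[OF g(2)], of "- n"] by simp
    then show ?thesis using False g(1) by (simp add: coeff[of "zpow (alpha \<sigma>) n g"] apply_zpow_alpha y_tau[OF p])
  qed
  then show "\<psi>\<^sub>1 (monomial f n) = vector_state p (monomial f n)"
    by (simp add: coeff[of f] vector_state_monomial[OF p])
qed

lemma pure_state_vector_state:
  assumes p: "p \<in> B"
  shows "pure_state \<sigma> (vector_state p)"
  unfolding pure_state_def
proof (intro conjI allI impI ballI state_vector_state[OF p]; elim conjE)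
  fix \<psi>\<^sub>1 \<psi>\<^sub>2 t and a :: "'a cseq"
  assume *: "state \<sigma> \<psi>\<^sub>1" "state \<sigma> \<psi>\<^sub>2" "0 < t" "t < 1" "a \<in> ell1"
    "\<forall>a\<in>ell1. vector_state p a = complex_of_real t * \<psi>\<^sub>1 a + complex_of_real (1 - t) * \<psi>\<^sub>2 a"
  then show "\<psi>\<^sub>1 a = vector_state p a"
    by (intro convex_component_vector_state[OF p, of \<psi>\<^sub>1 \<psi>\<^sub>2 t]) auto
  show "\<psi>\<^sub>2 a = vector_state p a"
    using * by (intro convex_component_vector_state[OF p, of \<psi>\<^sub>2 \<psi>\<^sub>1 "1 - t"]) auto
qed

lemma ex_pure_state_GNS:
  assumes "p \<in> B"
  shows "\<exists>\<phi>. pure_state \<sigma> \<phi> \<and> extends_evaluation \<phi> (y p) \<and> GNS_rep \<sigma> \<phi> B \<pi> (basis_vec p)"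
  using pure_state_vector_state[OF assms] vector_state_embed[OF assms] unital_involutive_rep
    ell2_basis_vec[OF assms] cyclic_basis_vec[OF assms]
  by (intro exI[of _ "vector_state p"]) (simp add: extends_evaluation_def GNS_rep_def vector_state_def)

text \<open>
  The representation is transported along \<open>g\<close> because a primitive ideal is defined by
  representations whose index set lies in the type of \<open>\<ell>\<^sup>1(\<Sigma>)\<close>.
\<close>

lemma primitive_ideal_rep_kernel:
  assumes g: "inj (g :: 'b \<Rightarrow> 'a cseq)"
  shows "primitive_ideal \<sigma> (rep_kernel B \<pi>)"
proof -
  define \<rho> where "\<rho> a \<xi> = (\<lambda>k. if k \<in> g ` B then \<Sum>\<^sub>\<infinity>n. apply_bcontfun (a n) (y (inv g k)) *
      (c n (inv g k) * \<xi> (g (\<tau> n (inv g k)))) else 0)" for a :: "'a cseq" and \<xi> :: "'a cseq \<Rightarrow> complex"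
  have ig: "inv g (g k) = k" for k using g by simp
  interpret R: orbit_rep \<sigma> "g ` B" "\<lambda>k. y (inv g k)" "\<lambda>n k. g (\<tau> n (inv g k))" "\<lambda>n k. c n (inv g k)" \<rho>
  proof unfold_locales
    show "inj_on (\<lambda>k. y (inv g k)) (g ` B)" using inj_y by (auto simp: inj_on_def ig)
    show "\<exists>n. g (\<tau> n (inv g k)) = j" if "k \<in> g ` B" "j \<in> g ` B" for k j
      using that transitive by (auto simp: ig) metis
  qed (auto simp: ig B_nonempty tau_in tau_0 tau_add y_tau cmod_c c_add \<rho>_def)
  have "rep_kernel B \<pi> = rep_kernel (g ` B) \<rho>"
  proof (intro subset_antisym subsetI)
    fix a assume a: "a \<in> rep_kernel B \<pi>"
    have "\<rho> a \<xi> k = 0" if \<xi>: "\<xi> \<in> ell2 (g ` B)" for \<xi> k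
    proof (cases "k \<in> g ` B")
      case True
      then obtain j where j: "k = g j" "j \<in> B" by auto
      let ?\<eta> = "\<lambda>i. if i \<in> B then \<xi> (g i) else 0"
      have "?\<eta> \<in> ell2 B"
      proof -
        have "(\<lambda>i. (cmod (\<xi> (g i)))\<^sup>2) summable_on B"
          using \<xi> summable_on_reindex[OF inj_on_subset[OF g subset_UNIV], of "\<lambda>k. (cmod (\<xi> k))\<^sup>2" B]
          by (auto simp: ell2_def o_def)
        then have "(\<lambda>i. (cmod (?\<eta> i))\<^sup>2) summable_on B" by (rule summable_on_cong[THEN iffD1, rotated]) auto
        then show ?thesis by (simp add: ell2_def)
      qed
      then have "\<pi> a ?\<eta> j = 0" using a by (auto simp: rep_kernel_def)
      then show ?thesis using j \<open>?\<eta> \<in> ell2 B\<close> by (simp add: rep_eq \<rho>_def ig tau_in)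
    qed (simp add: \<rho>_def)
    then show "a \<in> rep_kernel (g ` B) \<rho>" using a by (auto simp: rep_kernel_def)
  next
    fix a assume a: "a \<in> rep_kernel (g ` B) \<rho>"
    have "\<pi> a \<xi> k = 0" if \<xi>: "\<xi> \<in> ell2 B" for \<xi> k
    proof (cases "k \<in> B")
      case True
      let ?\<eta> = "\<lambda>i. if i \<in> g ` B then \<xi> (inv g i) else 0"
      have "?\<eta> \<in> ell2 (g ` B)"
      proof -
        have "(\<lambda>i. (cmod (?\<eta> i))\<^sup>2) \<circ> g summable_on B \<longleftrightarrow> (\<lambda>i. (cmod (\<xi> i))\<^sup>2) summable_on B"
          by (rule summable_on_cong) (simp add: ig)
        then show ?thesis
          using \<xi> summable_on_reindex[OF inj_on_subset[OF g subset_UNIV], of "\<lambda>k. (cmod (?\<eta> k))\<^sup>2" B]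
          by (simp add: ell2_def)
      qed
      then have "\<rho> a ?\<eta> (g k) = 0" using a by (auto simp: rep_kernel_def)
      then show ?thesis using True by (simp add: rep_eq[OF \<xi>] \<rho>_def ig tau_in)
    qed (simp add: rep_eq[OF \<xi>])
    then show "a \<in> rep_kernel B \<pi>" using a by (auto simp: rep_kernel_def)
  qed
  then show ?thesis
    unfolding primitive_ideal_def using R.unital_involutive_rep R.top_irreducible by blast
qed

end

section \<open>Point representations and their kernels\<close>

lemma absolutely_summable_Fourier_unique:
  fixes d :: "int \<Rightarrow> complex"
  assumes d: "(\<lambda>q. cmod (d q)) summable_on UNIV"
    and T: "T \<subseteq> circle" "circle \<subseteq> closure T"
    and zero: "\<And>l. l \<in> T \<Longrightarrow> (\<Sum>\<^sub>\<infinity>q. d q * l powi q) = 0"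
  shows "d m = 0"
proof -
  let ?S = "\<lambda>l. \<Sum>\<^sub>\<infinity>q. d q * l powi q"
  have nrm: "cmod (d q * l powi q) \<le> cmod (d q)" if "l \<in> circle" for q l
    using that by (simp add: norm_mult norm_power_int)
  have "continuous_on circle ?S"
  proof (rule uniform_limit_theorem)
    show "uniform_limit circle (\<lambda>X l. \<Sum>q\<in>X. d q * l powi q) ?S (finite_subsets_at_top UNIV)"
      by (rule Weierstrass_m_test_general[OF _ d]) (rule nrm)
    show "\<forall>\<^sub>F X in finite_subsets_at_top UNIV. continuous_on circle (\<lambda>l. \<Sum>q\<in>X. d q * l powi q)"
      by (intro always_eventually allI continuous_intros) auto
  qed auto
  then have "closed {l \<in> circle. ?S l = 0}"
    using continuous_closed_preimage_constant[of circle ?S 0] by simp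
  then have "closure T \<subseteq> {l \<in> circle. ?S l = 0}"
    using T(1) zero by (intro closure_minimal) auto
  then have S0: "?S l = 0" if "l \<in> circle" for l using that T(2) by auto
  have hs: "((\<lambda>q. d q * l powi q) has_sum 0) UNIV" if "l \<in> circle" for l
  proof -
    have "(\<lambda>q. d q * l powi q) summable_on UNIV"
      by (rule Infinite_Sum.abs_summable_summable[OF Infinite_Sum.abs_summable_on_comparison_test'[OF d]])
        (rule nrm[OF that])
    then show ?thesis using S0[OF that] by (simp add: has_sum_iff)
  qed
  have "cmod (d m) \<le> 0 + e" if e0: "0 < e" for e
  proof -
    obtain F where F: "finite F"
      "\<And>g. (\<And>n. n \<in> UNIV \<Longrightarrow> 0 \<le> g n \<and> g n \<le> cmod (d n)) \<Longrightarrow> (\<And>n. n \<in> F \<Longrightarrow> g n = 0) \<Longrightarrow> infsum g UNIV < e"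
      using summable_tail[OF d norm_ge_zero e0] by metis
    \<comment> \<open>The shift by \<open>m\<close> is needed since the average below singles out
      degree \<open>m\<close> instead of 0.\<close>
    obtain N where N: "0 < N" "\<And>n. n \<in> (\<lambda>q. q - m) ` F \<Longrightarrow> \<bar>n\<bar> < int N"
      using finite_set_int_less_nat[of "(\<lambda>q. q - m) ` F"] F(1) by auto
    define z where "z j = cis (2 * pi * real j / real N)" for j
    have z: "z j \<in> circle" "z j \<noteq> 0" for j by (auto simp: z_def)
    \<comment> \<open>This is the aliasing error: averaging against \<open>z powi (- m)\<close> also
      keeps the other degrees congruent to \<open>m\<close> modulo \<open>N\<close>, all of which
      lie outside \<open>F\<close>.\<close>
    define g where "g q = (if int N dvd q - m \<and> q \<noteq> m then d q else 0)" for q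
    have "((\<lambda>q. (1 / of_nat N) * (\<Sum>j<N. z j powi (- m) * (d q * z j powi q))) has_sum
        (1 / of_nat N) * (\<Sum>j<N. z j powi (- m) * 0)) UNIV"
      by (intro has_sum_cmult_right has_sum_finite_sum hs z) auto
    moreover have "(1 / of_nat N) * (\<Sum>j<N. z j powi (- m) * (d q * z j powi q)) =
        (if q = m then d m else 0) + g q" for q
    proof -
      have "(\<Sum>j<N. z j powi (- m) * (d q * z j powi q)) = d q * (\<Sum>j<N. z j powi (q - m))"
        unfolding sum_distrib_left using z by (intro sum.cong) (simp_all add: power_int_diff power_int_minus field_simps)
      then show ?thesis
        using N(1) by (auto simp: z_def sum_roots_of_unity_powi g_def)
    qed
    ultimately have h1: "((\<lambda>q. (if q = m then d m else 0) + g q) has_sum 0) UNIV" by simp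
    have gs: "(\<lambda>q. cmod (g q)) summable_on UNIV"
      by (rule Infinite_Sum.abs_summable_on_comparison_test'[OF d]) (simp add: g_def)
    have "((\<lambda>q. if q = m then d m else 0) has_sum d m) UNIV"
      by (rule has_sum_finite_neutralI[of "{m}"]) auto
    then have "((\<lambda>q. (if q = m then d m else 0) + g q) has_sum (d m + infsum g UNIV)) UNIV"
      by (intro has_sum_add has_sum_infsum Infinite_Sum.abs_summable_summable[OF gs])
    with h1 have "d m + infsum g UNIV = 0" using has_sum_unique by blast
    then have "cmod (d m) = cmod (infsum g UNIV)" by (metis add_eq_0_iff norm_minus_cancel)
    also have "\<dots> \<le> (\<Sum>\<^sub>\<infinity>q. cmod (g q))" by (rule norm_infsum_bound[OF gs])
    also have "\<dots> < e"
    proof (rule F(2))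
      show "0 \<le> cmod (g n) \<and> cmod (g n) \<le> cmod (d n)" for n by (simp add: g_def)
      fix n assume "n \<in> F"
      then have "\<bar>n - m\<bar> < int N" by (intro N(2)) auto
      then have "n = m" if "int N dvd n - m"
        using zdvd_imp_le[of "int N" "\<bar>n - m\<bar>"] that by auto
      then show "cmod (g n) = 0" by (auto simp: g_def)
    qed
    finally show ?thesis by simp
  qed
  then have "cmod (d m) \<le> 0" by (rule field_le_epsilon)
  then show ?thesis by simp
qed

section \<open>Powers of the two shift operators\<close>

lemma zpow_on_shift:
  assumes "\<xi> \<in> ell2 UNIV"
  shows "zpow_on (ell2 UNIV) shift n \<xi> = (\<lambda>k. \<xi> (k - n))"
proof (rule zpow_on_eqI)
  show "inj_on shift (ell2 UNIV)"
  proof (rule inj_onI, rule ext)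
    fix \<xi> \<eta> k assume "shift \<xi> = shift \<eta>"
    then have "shift \<xi> (k + 1) = shift \<eta> (k + 1)" by simp
    then show "\<xi> k = \<eta> k" by (simp add: shift_def)
  qed
  show "(\<lambda>k. \<xi> (k - n)) \<in> ell2 UNIV" for n
    using has_sum_shift[of "\<lambda>k. (cmod (\<xi> k))\<^sup>2" _ n] assms by (auto simp: ell2_def summable_on_def)
qed (auto simp: shift_def algebra_simps)

text \<open>Going back \<open>n\<close> places from \<open>k\<close> on a cycle of length
  \<open>p\<close> is division with remainder: the remainder is the position reached, and the
  negated quotient counts the signed passages through the end, each contributing a factor
  \<open>l\<close>.\<close>

lemma zpow_on_cyclic_shift:
  assumes p: "0 < p" and l: "l \<noteq> 0" and \<xi>: "\<xi> \<in> ell2 {0..<int p}"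
  shows "zpow_on (ell2 {0..<int p}) (cyclic_shift p l) n \<xi> =
    (\<lambda>k. if k \<in> {0..<int p} then l powi (- ((k - n) div int p)) * \<xi> ((k - n) mod int p) else 0)"
proof (rule zpow_on_eqI)
  show "inj_on (cyclic_shift p l) (ell2 {0..<int p})"
  proof (rule inj_onI, rule ext)
    fix \<xi> \<eta> k
    assume el: "\<xi> \<in> ell2 {0..<int p}" "\<eta> \<in> ell2 {0..<int p}" and eq: "cyclic_shift p l \<xi> = cyclic_shift p l \<eta>"
    consider "k \<notin> {0..<int p}" | "k = int p - 1" | "0 \<le> k" "k < int p - 1" by fastforce
    then show "\<xi> k = \<eta> k"
    proof cases
      case 2
      then show ?thesis using fun_cong[OF eq, of 0] l by (simp add: cyclic_shift_def)
    next
      case 3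
      then show ?thesis using fun_cong[OF eq, of "k + 1"] by (simp add: cyclic_shift_def)
    qed (use el in \<open>simp add: ell2_def\<close>)
  qed
  show "(\<lambda>k. if k \<in> {0..<int p} then l powi (- ((k - n) div int p)) * \<xi> ((k - n) mod int p) else 0) \<in> ell2 {0..<int p}" for n
    by (simp add: ell2_def)
  show "(\<lambda>k. if k \<in> {0..<int p} then l powi (- ((k - 0) div int p)) * \<xi> ((k - 0) mod int p) else 0) = \<xi>"
    using \<xi> by (auto simp: ell2_def)
  fix n
  show "(\<lambda>k. if k \<in> {0..<int p} then l powi (- ((k - (n + 1)) div int p)) * \<xi> ((k - (n + 1)) mod int p) else 0) =
    cyclic_shift p l (\<lambda>k. if k \<in> {0..<int p} then l powi (- ((k - n) div int p)) * \<xi> ((k - n) mod int p) else 0)"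
    (is "?L = cyclic_shift p l ?R")
  proof
    fix k
    consider "k < 0 \<or> int p \<le> k" | "k = 0" | "0 < k" "k < int p" by linarith
    then show "?L k = cyclic_shift p l ?R k"
    proof cases
      case 2
      \<comment> \<open>Position 0 is reached from \<open>p - 1\<close>. Adding \<open>p\<close>
        raises the quotient by one, which the extra factor \<open>l\<close> in
        \<open>cyclic_shift\<close> compensates.\<close>
      have "int p - 1 - n = (- n - 1) + int p" by simp
      then have "(int p - 1 - n) div int p = (- n - 1) div int p + 1" "(int p - 1 - n) mod int p = (- n - 1) mod int p"
        using p by (simp_all only: div_add_self2 mod_add_self2)
      moreover have "l powi (- ((- n - 1) div int p)) = l * l powi (- ((- n - 1) div int p + 1))"
        using l power_int_add[of l 1 "- ((- n - 1) div int p + 1)"] by simp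
      ultimately show ?thesis using 2 p by (simp add: cyclic_shift_def mult.assoc)
    next
      case 3
      then show ?thesis by (simp add: cyclic_shift_def algebra_simps)
    qed (use p in \<open>auto simp: cyclic_shift_def\<close>)
  qed
qed

context dynamics
begin

section \<open>Orbits and the representations carried by them\<close>

lemma zpow_eq_imp_Per:
  assumes "zpow \<sigma> i x = zpow \<sigma> j x" "i < j"
  shows "(\<sigma> ^^ nat (j - i)) x = x"
proof -
  have "zpow \<sigma> (j - i) x = zpow \<sigma> (- i) (zpow \<sigma> j x)" by (simp add: zpow_add[symmetric])
  also have "\<dots> = x" by (simp flip: assms(1))
  finally show ?thesis using assms(2) by (simp add: zpow_on_def)
qed

lemma period:
  assumes "x \<in> Per \<sigma>"
  shows "0 < period \<sigma> x" "(\<sigma> ^^ period \<sigma> x) x = x"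
  using LeastI_ex[of "\<lambda>p. p > 0 \<and> (\<sigma> ^^ p) x = x"] assms by (auto simp: Per_def period_def)

lemma zpow_mod_period:
  assumes "x \<in> Per \<sigma>"
  shows "zpow \<sigma> (n mod int (period \<sigma> x)) x = zpow \<sigma> n x"
proof -
  define p where "p = int (period \<sigma> x)"
  have "zpow \<sigma> p x = x" using period(2)[OF assms] by (simp add: p_def zpow_of_nat)
  then have nat: "zpow \<sigma> (int q * p) x = x" for q
    by (induction q) (simp_all add: zpow_add distrib_right)
  have mult: "zpow \<sigma> (q * p) x = x" for q
  proof (cases "0 \<le> q")
    case True
    then show ?thesis using nat[of "nat q"] by simp
  next
    case False
    then have "zpow \<sigma> (- (q * p)) x = x" using nat[of "nat (- q)"] by simp
    then show ?thesis using zpow_minus_cancel(1)[of "q * p" x] by simp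
  qed
  have "zpow \<sigma> (n mod p + n div p * p) x = zpow \<sigma> (n mod p) x" unfolding zpow_add mult ..
  then show ?thesis by (simp add: p_def)
qed

lemma orbit_rep_aper:
  assumes "x \<in> Aper \<sigma>"
  shows "orbit_rep \<sigma> UNIV (\<lambda>k. zpow \<sigma> k x) (\<lambda>n k. k - n) (\<lambda>n k. 1) (pi_aper \<sigma> x)"
proof unfold_locales
  show "inj (\<lambda>k. zpow \<sigma> k x)"
  proof (rule linorder_injI)
    fix i j :: int assume ij: "i < j"
    then have "0 < nat (j - i)" by simp
    then show "zpow \<sigma> i x \<noteq> zpow \<sigma> j x"
      using zpow_eq_imp_Per[OF _ ij] assms unfolding Aper_def Per_def by blast
  qed
  show "\<exists>n. k - n = j" for k j :: int by (rule exI[of _ "k - j"]) simp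
  show "zpow \<sigma> (k - n) x = zpow \<sigma> (- n) (zpow \<sigma> k x)" for k n by (simp add: zpow_add[symmetric])
qed (auto simp: pi_aper_def integrated_rep_def diag_op_def zpow_on_shift)

lemma orbit_rep_per:
  assumes x: "x \<in> Per \<sigma>" and l: "l \<in> circle"
  shows "orbit_rep \<sigma> (per_index \<sigma> x) (\<lambda>k. zpow \<sigma> k x) (\<lambda>n k. (k - n) mod int (period \<sigma> x))
    (\<lambda>n k. l powi (- ((k - n) div int (period \<sigma> x)))) (pi_per \<sigma> x l)"
proof -
  define p where "p = period \<sigma> x"
  have p: "0 < p" using period[OF x] by (simp add: p_def)
  have l0: "l \<noteq> 0" "cmod l = 1" using l by auto
  have "orbit_rep \<sigma> {0..<int p} (\<lambda>k. zpow \<sigma> k x) (\<lambda>n k. (k - n) mod int p)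
    (\<lambda>n k. l powi (- ((k - n) div int p))) (pi_per \<sigma> x l)"
  proof unfold_locales
    show "inj_on (\<lambda>k. zpow \<sigma> k x) {0..<int p}"
    proof (rule linorder_inj_onI)
      fix i j assume ij: "i < j" "i \<in> {0..<int p}" "j \<in> {0..<int p}"
      show "zpow \<sigma> i x \<noteq> zpow \<sigma> j x"
      proof
        assume "zpow \<sigma> i x = zpow \<sigma> j x"
        then have "(\<sigma> ^^ nat (j - i)) x = x" using ij by (intro zpow_eq_imp_Per)
        then have "p \<le> nat (j - i)"
          unfolding p_def period_def using ij by (intro Least_le) auto
        with ij show False by auto
      qed
    qed auto
    fix k assume k: "k \<in> {0..<int p}"
    show "(k - n) mod int p \<in> {0..<int p}" for n using p by simp
    show "(k - 0) mod int p = k" using k by simp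
    show "(k - (m + n)) mod int p = ((k - m) mod int p - n) mod int p" for m n
      by (simp add: mod_diff_left_eq algebra_simps)
    show "zpow \<sigma> ((k - n) mod int p) x = zpow \<sigma> (- n) (zpow \<sigma> k x)" for n
      using zpow_mod_period[OF x, of "k - n"] by (simp add: p_def zpow_add[symmetric])
    show "\<exists>n. (k - n) mod int p = j" if "j \<in> {0..<int p}" for j
      using that by (intro exI[of _ "k - j"]) simp
    show "cmod (l powi (- ((k - n) div int p))) = 1" for n
      using l0 by (simp add: norm_power_int)
    show "l powi (- ((k - (m + n)) div int p)) =
      l powi (- ((k - m) div int p)) * l powi (- (((k - m) mod int p - n) div int p))" for m n
    proof -
      \<comment> \<open>The cocycle law is the additivity of quotients when \<open>m\<close> and
        then \<open>n\<close> are subtracted, the remainder being passed on.\<close>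
      have "k - (m + n) = ((k - m) mod int p - n) + (k - m) div int p * int p"
        by (simp add: algebra_simps minus_mod_eq_mult_div[symmetric])
      then have "(k - (m + n)) div int p = ((k - m) mod int p - n) div int p + (k - m) div int p"
        using p by (simp only: div_mult_self1)
      then have "- ((k - (m + n)) div int p) = - ((k - m) div int p) + - (((k - m) mod int p - n) div int p)" by simp
      then show ?thesis using l0 by (simp only: power_int_add simp_thms)
    qed
  next
    fix \<xi> :: "int \<Rightarrow> complex" and a :: "'a cseq" assume \<xi>: "\<xi> \<in> ell2 {0..<int p}"
    show "pi_per \<sigma> x l a \<xi> = (\<lambda>k. if k \<in> {0..<int p} then
        \<Sum>\<^sub>\<infinity>n. apply_bcontfun (a n) (zpow \<sigma> k x) * (l powi (- ((k - n) div int p)) * \<xi> ((k - n) mod int p)) else 0)"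
      unfolding pi_per_def integrated_rep_def diag_op_def per_index_def p_def[symmetric]
        zpow_on_cyclic_shift[OF p l0(1) \<xi>] by (rule ext) auto
  qed (use p in auto)
  then show ?thesis by (simp add: per_index_def p_def)
qed

section \<open>Kernels of the point representations\<close>

text \<open>The matrix entry in row \<open>k\<close> and column \<open>k - n\<close> is exactly the
  value of \<open>a n\<close> at \<open>zpow \<sigma> k x\<close>.\<close>

lemma P_aper_eq_kernel:
  assumes x: "x \<in> Aper \<sigma>"
  shows "P_aper \<sigma> x = ell1_kernel (orbit \<sigma> x)"
proof -
  interpret orbit_rep \<sigma> UNIV "\<lambda>k. zpow \<sigma> k x" "\<lambda>n k. k - n" "\<lambda>n k. 1" "pi_aper \<sigma> x"
    by (rule orbit_rep_aper[OF x])
  show ?thesis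
  proof (intro subset_antisym subsetI)
    fix a assume a: "a \<in> P_aper \<sigma> x"
    have "apply_bcontfun (a n) (zpow \<sigma> k x) = 0" for n k
    proof -
      have e: "basis_vec (k - n) \<in> ell2 UNIV" by (rule ell2_basis_vec) simp
      have "0 = pi_aper \<sigma> x a (basis_vec (k - n)) k" using a e by (simp add: P_aper_def rep_kernel_def)
      also have "\<dots> = (\<Sum>\<^sub>\<infinity>m. apply_bcontfun (a m) (zpow \<sigma> k x) * (1 * basis_vec (k - n) (k - m)))"
        by (simp add: rep_eq[OF e])
      also have "\<dots> = apply_bcontfun (a n) (zpow \<sigma> k x)"
        by (subst infsum_single[of _ n]) (auto simp: basis_vec_def)
      finally show ?thesis by simp
    qed
    then show "a \<in> ell1_kernel (orbit \<sigma> x)"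
      using a by (auto simp: ell1_kernel_def orbit_def P_aper_def rep_kernel_def)
  next
    fix a assume "a \<in> ell1_kernel (orbit \<sigma> x)"
    then show "a \<in> P_aper \<sigma> x"
      by (auto simp: ell1_kernel_def orbit_def P_aper_def rep_kernel_def rep_eq)
  qed
qed

text \<open>The entry in row \<open>k\<close> and column \<open>j\<close> collects all degrees
  congruent to \<open>k - j\<close> modulo \<open>p\<close>, weighted by powers of \<open>l\<close>.
  Vanishing for all \<open>l\<close> in a dense set separates these degrees.\<close>

lemma Inter_P_per_eq_kernel:
  assumes x: "x \<in> Per \<sigma>" and T: "T \<subseteq> circle" "circle \<subseteq> closure T"
  shows "ell1 \<inter> (\<Inter>l\<in>T. P_per \<sigma> x l) = ell1_kernel (orbit \<sigma> x)"
proof -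
  define p where "p = int (period \<sigma> x)"
  have p: "0 < p" using period[OF x] by (simp add: p_def)
  have rep: "orbit_rep \<sigma> {0..<p} (\<lambda>k. zpow \<sigma> k x) (\<lambda>n k. (k - n) mod p)
      (\<lambda>n k. l powi (- ((k - n) div p))) (pi_per \<sigma> x l)" if "l \<in> T" for l
    using orbit_rep_per[OF x, of l] that T(1) by (auto simp: p_def per_index_def)
  show ?thesis
  proof (intro subset_antisym subsetI)
    fix a assume "a \<in> ell1 \<inter> (\<Inter>l\<in>T. P_per \<sigma> x l)"
    then have a1: "a \<in> ell1" and aP: "\<And>l. l \<in> T \<Longrightarrow> a \<in> P_per \<sigma> x l" by auto
    have "apply_bcontfun (a m) (zpow \<sigma> k x) = 0" if k: "k \<in> {0..<p}" for m k
    proof -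
      \<comment> \<open>This column is the one whose residue class of degrees contains
        \<open>m\<close>; the degree \<open>m\<close> appears in it with exponent
        \<open>q = - ((k - m) div p)\<close>.\<close>
      define j where "j = (k - m) mod p"
      define d where "d q = apply_bcontfun (a (k - j + q * p)) (zpow \<sigma> k x)" for q
      have j: "j \<in> {0..<p}" using p by (simp add: j_def)
      have e: "basis_vec j \<in> ell2 {0..<p}" by (rule ell2_basis_vec[OF j])
      have sol: "k - j + - ((k - n) div p) * p = n" if "(k - n) mod p = j" for n
      proof -
        have eq: "(k - n) div p * p = k - n - j" using minus_mod_eq_div_mult[of "k - n" p] that by metis
        show ?thesis unfolding mult_minus_left eq by simp
      qed
      have "d (- ((k - m) div p)) = 0"
      proof (rule absolutely_summable_Fourier_unique[OF _ T])
        have "(\<lambda>n. norm (a n)) summable_on range (\<lambda>q. k - j + q * p)"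
          using a1 unfolding ell1_def mem_Collect_eq by (rule summable_on_subset_banach) simp
        moreover have "inj (\<lambda>q. k - j + q * p)" using p by (auto simp: inj_on_def)
        ultimately have "(\<lambda>q. norm (a (k - j + q * p))) summable_on UNIV"
          by (subst (asm) summable_on_reindex) (auto simp: o_def)
        then show "(\<lambda>q. cmod (d q)) summable_on UNIV"
          by (rule Infinite_Sum.abs_summable_on_comparison_test') (simp add: d_def norm_bounded)
        fix l assume l: "l \<in> T"
        interpret orbit_rep \<sigma> "{0..<p}" "\<lambda>k. zpow \<sigma> k x" "\<lambda>n k. (k - n) mod p"
          "\<lambda>n k. l powi (- ((k - n) div p))" "pi_per \<sigma> x l" by (rule rep[OF l])
        have "0 = pi_per \<sigma> x l a (basis_vec j) k"
          using aP[OF l] e by (simp add: P_per_def rep_kernel_def per_index_def p_def)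
        also have "\<dots> = (\<Sum>\<^sub>\<infinity>n. apply_bcontfun (a n) (zpow \<sigma> k x) *
            (l powi (- ((k - n) div p)) * basis_vec j ((k - n) mod p)))"
          using k by (simp add: rep_eq[OF e])
        also have "\<dots> = (\<Sum>\<^sub>\<infinity>n\<in>{n. (k - n) mod p = j}. apply_bcontfun (a n) (zpow \<sigma> k x) * l powi (- ((k - n) div p)))"
          by (rule infsum_cong_neutral) (auto simp: basis_vec_def)
        also have "\<dots> = (\<Sum>\<^sub>\<infinity>q. d q * l powi q)"
        proof (rule infsum_reindex_bij_witness[of _ "\<lambda>q. k - j + q * p" "\<lambda>n. - ((k - n) div p)"])
          fix q
          have eq: "k - (k - j + q * p) = j + (- q) * p" by simp
          show "- ((k - (k - j + q * p)) div p) = q" unfolding eq using j by (subst div_mult_self1) auto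
          show "k - j + q * p \<in> {n. (k - n) mod p = j}" unfolding mem_Collect_eq eq using j by (subst mod_mult_self1) auto
        qed (use sol in \<open>auto simp: d_def\<close>)
        finally show "(\<Sum>\<^sub>\<infinity>q. d q * l powi q) = 0" by simp
      qed
      then show ?thesis using sol[of m] by (simp add: d_def j_def)
    qed
    then have "apply_bcontfun (a m) (zpow \<sigma> n x) = 0" for m n
      using zpow_mod_period[OF x, of n] p by (metis atLeastLessThan_iff p_def pos_mod_bound pos_mod_sign)
    then show "a \<in> ell1_kernel (orbit \<sigma> x)"
      using a1 by (auto simp: ell1_kernel_def orbit_def)
  next
    fix a assume a: "a \<in> ell1_kernel (orbit \<sigma> x)"
    have "a \<in> P_per \<sigma> x l" if l: "l \<in> T" for l
    proof -
      interpret orbit_rep \<sigma> "{0..<p}" "\<lambda>k. zpow \<sigma> k x" "\<lambda>n k. (k - n) mod p"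
        "\<lambda>n k. l powi (- ((k - n) div p))" "pi_per \<sigma> x l" by (rule rep[OF l])
      show ?thesis
        using a by (auto simp: ell1_kernel_def orbit_def P_per_def rep_kernel_def rep_eq per_index_def simp flip: p_def)
    qed
    then show "a \<in> ell1 \<inter> (\<Inter>l\<in>T. P_per \<sigma> x l)" using a by (auto simp: ell1_kernel_def)
  qed
qed

lemma Q_per_eq_kernel:
  assumes "x \<in> Per \<sigma>"
  shows "Q_per \<sigma> x = ell1_kernel (orbit \<sigma> x)"
proof -
  \<comment> \<open>A nonempty index set puts the intersection inside \<open>ell1\<close>.\<close>
  have "(1 :: complex) \<in> circle" by simp
  then have "Q_per \<sigma> x \<subseteq> ell1" unfolding Q_per_def P_per_def rep_kernel_def by blast
  then show ?thesis
    using Inter_P_per_eq_kernel[OF assms, of circle] closure_subset unfolding Q_per_def by blast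
qed

lemma ell1_kernel_UN:
  "ell1 \<inter> (\<Inter>x\<in>S. ell1_kernel (O1 x)) \<inter> (\<Inter>x\<in>S'. ell1_kernel (O2 x)) =
    ell1_kernel ((\<Union>x\<in>S. O1 x) \<union> (\<Union>x\<in>S'. O2 x))"
  by (auto simp: ell1_kernel_def)

lemma Inter_P_Q_eq_kernel:
  assumes "Sap \<subseteq> Aper \<sigma>" "Sp \<subseteq> Per \<sigma>"
  shows "ell1 \<inter> (\<Inter>x\<in>Sap. P_aper \<sigma> x) \<inter> (\<Inter>x\<in>Sp. Q_per \<sigma> x) =
    ell1_kernel ((\<Union>x\<in>Sap. orbit \<sigma> x) \<union> (\<Union>x\<in>Sp. orbit \<sigma> x))"
proof -
  have "(\<Inter>x\<in>Sap. P_aper \<sigma> x) = (\<Inter>x\<in>Sap. ell1_kernel (orbit \<sigma> x))"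
    "(\<Inter>x\<in>Sp. Q_per \<sigma> x) = (\<Inter>x\<in>Sp. ell1_kernel (orbit \<sigma> x))"
    using assms P_aper_eq_kernel Q_per_eq_kernel by (auto intro!: INF_cong)
  then show ?thesis by (simp only: ell1_kernel_UN)
qed

lemma well_behaved_iff_Inter_P_Q:
  assumes I: "closed_ideal \<sigma> I"
  shows "well_behaved I \<longleftrightarrow> (\<exists>Sap Sp. Sap \<subseteq> Aper \<sigma> \<and> Sp \<subseteq> Per \<sigma> \<and>
    I = ell1 \<inter> (\<Inter>x\<in>Sap. P_aper \<sigma> x) \<inter> (\<Inter>x\<in>Sp. Q_per \<sigma> x))"
proof
  assume "well_behaved I"
  then have I': "I = ell1_kernel (ell1_hull I)" using well_behaved_iff_kernel_hull[OF I] by simp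
  \<comment> \<open>All points of the hull are taken; by invariance their orbits fill exactly the
    hull.\<close>
  define Sap Sp where "Sap = ell1_hull I \<inter> Aper \<sigma>" and "Sp = ell1_hull I \<inter> Per \<sigma>"
  have "(\<Union>x\<in>Sap. orbit \<sigma> x) \<union> (\<Union>x\<in>Sp. orbit \<sigma> x) = (\<Union>x\<in>ell1_hull I. orbit \<sigma> x)"
    by (auto simp: Sap_def Sp_def Aper_def)
  also have "\<dots> = ell1_hull I"
  proof -
    have "x \<in> orbit \<sigma> x" for x unfolding orbit_def by (metis rangeI zpow_0)
    moreover have "orbit \<sigma> x \<subseteq> ell1_hull I" if "x \<in> ell1_hull I" for x
      using that I hull_invariant[of I x] by (auto simp: orbit_def closed_ideal_def)
    ultimately show ?thesis by blast
  qed
  finally have "I = ell1 \<inter> (\<Inter>x\<in>Sap. P_aper \<sigma> x) \<inter> (\<Inter>x\<in>Sp. Q_per \<sigma> x)"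
    using I' Inter_P_Q_eq_kernel[of Sap Sp] by (simp add: Sap_def Sp_def)
  then show "\<exists>Sap Sp. Sap \<subseteq> Aper \<sigma> \<and> Sp \<subseteq> Per \<sigma> \<and>
      I = ell1 \<inter> (\<Inter>x\<in>Sap. P_aper \<sigma> x) \<inter> (\<Inter>x\<in>Sp. Q_per \<sigma> x)"
    by (intro exI[of _ Sap] exI[of _ Sp]) (auto simp: Sap_def Sp_def)
next
  assume "\<exists>Sap Sp. Sap \<subseteq> Aper \<sigma> \<and> Sp \<subseteq> Per \<sigma> \<and>
    I = ell1 \<inter> (\<Inter>x\<in>Sap. P_aper \<sigma> x) \<inter> (\<Inter>x\<in>Sp. Q_per \<sigma> x)"
  then show "well_behaved I" using Inter_P_Q_eq_kernel well_behaved_kernel by metis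
qed

section \<open>Primitivity and pure state extensions\<close>

text \<open>The powers of \<delta> embed the integers, which index the bases, into the type in which
  primitive ideals take their index sets.\<close>

lemma inj_monomial_one: "inj (\<lambda>n. monomial (const_bcontfun 1 :: 'a \<Rightarrow>\<^sub>C complex) n)"
proof (rule injI)
  fix m n assume "monomial (const_bcontfun 1 :: 'a \<Rightarrow>\<^sub>C complex) m = monomial (const_bcontfun 1) n"
  from fun_cong[OF this, of m] have "const_bcontfun 1 = (0 :: 'a \<Rightarrow>\<^sub>C complex) \<or> m = n"
    by (auto simp: monomial_apply split: if_splits)
  moreover have "const_bcontfun 1 \<noteq> (0 :: 'a \<Rightarrow>\<^sub>C complex)"
    by (metis const_bcontfun.rep_eq zero_bcontfun.rep_eq zero_neq_one)
  ultimately show "m = n" by blast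
qed

text \<open>Index 0 belongs to the point \<open>x\<close> itself, so the vector state of
  \<open>basis_vec 0\<close> extends evaluation at \<open>x\<close>.\<close>

lemma aper_primitive_pure:
  assumes "x \<in> Aper \<sigma>"
  shows "primitive_ideal \<sigma> (P_aper \<sigma> x)"
    "\<exists>\<phi>. pure_state \<sigma> \<phi> \<and> extends_evaluation \<phi> x \<and> GNS_rep \<sigma> \<phi> UNIV (pi_aper \<sigma> x) (basis_vec 0)"
  using orbit_rep.primitive_ideal_rep_kernel[OF orbit_rep_aper[OF assms] inj_monomial_one]
    orbit_rep.ex_pure_state_GNS[OF orbit_rep_aper[OF assms], of 0]
  by (auto simp: P_aper_def)

lemma per_primitive_pure:
  assumes "x \<in> Per \<sigma>" "l \<in> circle"
  shows "primitive_ideal \<sigma> (P_per \<sigma> x l)"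
    "\<exists>\<phi>. pure_state \<sigma> \<phi> \<and> extends_evaluation \<phi> x \<and> GNS_rep \<sigma> \<phi> (per_index \<sigma> x) (pi_per \<sigma> x l) (basis_vec 0)"
proof -
  have "0 \<in> per_index \<sigma> x" using period(1)[OF assms(1)] by (simp add: per_index_def)
  then show "\<exists>\<phi>. pure_state \<sigma> \<phi> \<and> extends_evaluation \<phi> x \<and> GNS_rep \<sigma> \<phi> (per_index \<sigma> x) (pi_per \<sigma> x l) (basis_vec 0)"
    using orbit_rep.ex_pure_state_GNS[OF orbit_rep_per[OF assms], of 0] by simp
  show "primitive_ideal \<sigma> (P_per \<sigma> x l)"
    using orbit_rep.primitive_ideal_rep_kernel[OF orbit_rep_per[OF assms] inj_monomial_one]
    by (simp add: P_per_def)
qed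

end

text \<open>The inclusion in the condition on \<open>circle\<close> amounts to equality, as the
  inverse of \<open>l\<close> lies in \<open>circle\<close> too. The leading \<open>ell1\<close>
  gives intersections over no points their conventional value.\<close>

theorem theorem3p6:
  fixes \<sigma> :: "'a::t2_space \<Rightarrow> 'a"
    and I :: "'a cseq set"
  assumes "compact (UNIV :: 'a set)"
    and "homeomorphism UNIV UNIV \<sigma> (inv \<sigma>)"
    and "closed_ideal \<sigma> I"
  shows
    "(well_behaved I \<longleftrightarrow> embed ` (E ` I) = I \<inter> range embed) \<and>
     (well_behaved I \<longleftrightarrow> I = delta_span (E ` I)) \<and>
     (well_behaved I \<longleftrightarrow> I = ell1_kernel (ell1_hull I)) \<and>
     (well_behaved I \<longleftrightarrow> (\<forall>I'. closed_ideal \<sigma> I' \<longrightarrow> (I' \<subseteq> I \<longleftrightarrow> ell1_hull I' \<supseteq> ell1_hull I))) \<and>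
     (well_behaved I \<longleftrightarrow> (\<forall>l\<in>circle. dual_action l ` I \<subseteq> I)) \<and>
     (well_behaved I \<longleftrightarrow>
        (\<exists>Sap Sp. Sap \<subseteq> Aper \<sigma> \<and> Sp \<subseteq> Per \<sigma> \<and>
           I = ell1 \<inter> (\<Inter>x\<in>Sap. P_aper \<sigma> x) \<inter> (\<Inter>x\<in>Sp. Q_per \<sigma> x))) \<and>
     (well_behaved I \<longrightarrow>
        (\<forall>Sap Sp. Sap \<subseteq> Aper \<sigma> \<and> Sp \<subseteq> Per \<sigma> \<and>
           zero_set (E ` I) = closure ((\<Union>x\<in>Sap. orbit \<sigma> x) \<union> (\<Union>x\<in>Sp. orbit \<sigma> x)) \<longrightarrow>
             I = ell1 \<inter> (\<Inter>x\<in>Sap. P_aper \<sigma> x) \<inter> (\<Inter>x\<in>Sp. Q_per \<sigma> x) \<and>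
             (\<forall>Tx :: 'a \<Rightarrow> complex set.
                (\<forall>x\<in>Sp. Tx x \<subseteq> circle \<and> circle \<subseteq> closure (Tx x)) \<longrightarrow>
                  I = ell1 \<inter> (\<Inter>x\<in>Sap. P_aper \<sigma> x) \<inter> (\<Inter>x\<in>Sp. \<Inter>l\<in>Tx x. P_per \<sigma> x l) \<and>
                  (\<forall>x\<in>Sap. primitive_ideal \<sigma> (P_aper \<sigma> x) \<and>
                     (\<exists>\<phi>. pure_state \<sigma> \<phi> \<and> extends_evaluation \<phi> x \<and>
                        GNS_rep \<sigma> \<phi> UNIV (pi_aper \<sigma> x) (basis_vec 0))) \<and>
                  (\<forall>x\<in>Sp. \<forall>l\<in>Tx x. primitive_ideal \<sigma> (P_per \<sigma> x l) \<and>
                     (\<exists>\<phi>. pure_state \<sigma> \<phi> \<and> extends_evaluation \<phi> x \<and>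
                        GNS_rep \<sigma> \<phi> (per_index \<sigma> x) (pi_per \<sigma> x l) (basis_vec 0))))))"
proof -
  interpret dynamics \<sigma> using assms(1,2) by unfold_locales
  note I = assms(3)
  show ?thesis
  proof (intro conjI well_behaved_iff_E_eq well_behaved_iff_delta_span[OF I] well_behaved_iff_kernel_hull[OF I]
      well_behaved_iff_hull_order[OF I] well_behaved_iff_dual_invariant[OF I] well_behaved_iff_Inter_P_Q[OF I]
      impI allI; elim conjE)
    fix Sap Sp
    assume wb: "well_behaved I" and S: "Sap \<subseteq> Aper \<sigma>" "Sp \<subseteq> Per \<sigma>"
      and zs: "zero_set (E ` I) = closure ((\<Union>x\<in>Sap. orbit \<sigma> x) \<union> (\<Union>x\<in>Sp. orbit \<sigma> x))"
    \<comment> \<open>Kernels do not change under closure, so any family of orbits with dense union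
      in this zero set recovers \<open>I\<close>.\<close>
    have "I = ell1_kernel (zero_set (E ` I))"
      using wb by (simp add: zero_set_E_well_behaved[OF I wb] flip: well_behaved_iff_kernel_hull[OF I])
    then show eq: "I = ell1 \<inter> (\<Inter>x\<in>Sap. P_aper \<sigma> x) \<inter> (\<Inter>x\<in>Sp. Q_per \<sigma> x)"
      by (simp only: zs kernel_closure Inter_P_Q_eq_kernel[OF S])
    fix Tx :: "'a \<Rightarrow> complex set"
    assume T: "\<forall>x\<in>Sp. Tx x \<subseteq> circle \<and> circle \<subseteq> closure (Tx x)"
    have "ell1 \<inter> (\<Inter>l\<in>Tx x. P_per \<sigma> x l) = Q_per \<sigma> x" if "x \<in> Sp" for x
      using Inter_P_per_eq_kernel[of x "Tx x"] Q_per_eq_kernel[of x] that S(2) T by auto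
    then have "ell1 \<inter> (\<Inter>x\<in>Sp. \<Inter>l\<in>Tx x. P_per \<sigma> x l) = ell1 \<inter> (\<Inter>x\<in>Sp. Q_per \<sigma> x)" by blast
    with eq show "I = ell1 \<inter> (\<Inter>x\<in>Sap. P_aper \<sigma> x) \<inter> (\<Inter>x\<in>Sp. \<Inter>l\<in>Tx x. P_per \<sigma> x l)" by blast
    show "\<forall>x\<in>Sap. primitive_ideal \<sigma> (P_aper \<sigma> x) \<and>
        (\<exists>\<phi>. pure_state \<sigma> \<phi> \<and> extends_evaluation \<phi> x \<and> GNS_rep \<sigma> \<phi> UNIV (pi_aper \<sigma> x) (basis_vec 0))"
      using aper_primitive_pure S(1) by blast
    show "\<forall>x\<in>Sp. \<forall>l\<in>Tx x. primitive_ideal \<sigma> (P_per \<sigma> x l) \<and>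
        (\<exists>\<phi>. pure_state \<sigma> \<phi> \<and> extends_evaluation \<phi> x \<and>
          GNS_rep \<sigma> \<phi> (per_index \<sigma> x) (pi_per \<sigma> x l) (basis_vec 0))"
      using per_primitive_pure S(2) T by blast
  qed
qed

end
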